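(* Let $n\ge2$, let $\Omega\subset\mathbb{C}^n$ be a domain, let $\varphi$ be a smooth real-valued function on $\Omega$, let $1\le q\le n$, let $c,d\in\mathbb{R}$ with $c\le d$, and fix $a\in\Omega$. Put $m=\min\{q,n-q\}$ when $1\le q\le n-1$ and $m=n$ when $q=n$. Then the following conditions are equivalent: (1) the sum of any $m$ eigenvalues (counted with multiplicity) of $\sqrt{-1}\partial\bar\partial\varphi(a)$ is greater than or equal to $cm$ and less than or equal to $dm$; (2) for any $\varepsilon>0$ there exists $\rho_\varepsilon>0$ (small enough that the ball of radius $\rho_\varepsilon$ centered at $a$ lies in $\Omega$) such that $$1-(d+\varepsilon)\,\mathfrak{d}^{(q)}(P^{(q)}_{r,s,A})^2\le L^{(q)}_{e^{-\varphi}}(a,r,s,A)\le1-(c-\varepsilon)\,\mathfrak{d}^{(q)}(P^{(q)}_{r,s,A})^2$$ for any $r,s>0$ with $r^2+s^2<\rho_\varepsilon^2$ and any $A\in\mathbf{U}(n)$, where $\mathfrak{d}^{(q)}(P^{(q)}_{r,s,A})=\sqrt{\frac{q}{q+1}r^2+\frac{n-q}{n-q+1}s^2}$.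
   Context: $\mathbf{U}(n)$ is the unitary group of degree $n$, and $\mathbb{B}^{k}_s\subset\mathbb{C}^k$ is the open ball of radius $s$ centered at $0$ (with $\mathbb{B}^0_s=\{0\}$). For $r,s>0$, $A\in\mathbf{U}(n)$, put $P^{(q)}_{r,s,A}=A(\mathbb{B}^q_r\times\mathbb{B}^{n-q}_s)$ (so $P^{(n)}_{r,s,A}=\mathbb{B}^n_r$), with Lebesgue measure $|P^{(q)}_{r,s,A}|$. For $a\in\Omega$, $r,s>0$, $A\in\mathbf{U}(n)$ with $a+P^{(q)}_{r,s,A}\subset\Omega$, the $q$-$L^2$-extension index of the metric $e^{-\varphi}$ on the trivial line bundle is $$L^{(q)}_{e^{-\varphi}}(a,r,s,A)=\inf\left\{\frac{\int_{a+P^{(q)}_{r,s,A}}|\sigma|^2e^{-\varphi}}{|P^{(q)}_{r,s,A}|\,|\xi|^2e^{-\varphi(a)}}\ \middle|\ \sigma\text{ holomorphic on }a+P^{(q)}_{r,s,A},\ \int_{a+P^{(q)}_{r,s,A}}|\sigma|^2e^{-\varphi}<\infty,\ \sigma(a)=\xi\right\},$$ which is independent of $\xi\in\mathbb{C}\setminus\{0\}$ (integrals are with respect to Lebesgue measure). The eigenvalues of $\sqrt{-1}\partial\bar\partial\varphi(a)$ are those of the Hermitian matrix $\big(\partial^2\varphi/\partial z_j\partial\bar z_k(a)\big)_{j,k}$. *)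

theory Defs
  imports
    "HOL-Analysis.Analysis"
    "HOL-Computational_Algebra.Polynomial"
begin

text \<open>
  Complex \<open>n\<close>-space is \<^typ>\<open>complex ^ 'n\<close> with \<open>n = CARD('n)\<close>. The index type is linearly ordered
  (as the numeral types are), so that \<open>\<complex>\<^sup>n = \<complex>\<^sup>q \<times> \<complex>\<^sup>n\<^sup>-\<^sup>q\<close> can be read off the order of the coordinates:
  the zero-based position of the index \<open>i\<close> is \<open>card {..<i}\<close>.
\<close>

subsection \<open>Smooth and holomorphic functions on open sets\<close>

fun Ck_on :: "nat \<Rightarrow> ('a::real_normed_vector \<Rightarrow> 'b::real_normed_vector) \<Rightarrow> 'a set \<Rightarrow> bool" where
  "Ck_on 0 f U \<longleftrightarrow> continuous_on U f"
| "Ck_on (Suc k) f U \<longleftrightarrow>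
     (\<forall>x\<in>U. f differentiable (at x)) \<and> (\<forall>v. Ck_on k (\<lambda>x. frechet_derivative f (at x) v) U)"

definition smooth_on :: "('a::real_normed_vector \<Rightarrow> 'b::real_normed_vector) \<Rightarrow> 'a set \<Rightarrow> bool" where
  "smooth_on f U \<longleftrightarrow> (\<forall>k. Ck_on k f U)"

text \<open>Holomorphy in several variables: a complex-linear differential at each point of the open set.\<close>

definition holomorphic_on_Cn :: "(complex ^ 'n \<Rightarrow> complex) \<Rightarrow> (complex ^ 'n) set \<Rightarrow> bool" where
  "holomorphic_on_Cn f U \<longleftrightarrow>
     (\<forall>z\<in>U. \<exists>f'. (f has_derivative f') (at z) \<and> (\<forall>u v. f' (u *s v) = u * f' v))"

subsection \<open>Wirtinger derivatives and the complex Hessian\<close>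

definition deriv_z :: "'n \<Rightarrow> (complex ^ 'n \<Rightarrow> complex) \<Rightarrow> complex ^ 'n \<Rightarrow> complex" where
  "deriv_z j f z =
     (frechet_derivative f (at z) (axis j 1) - \<i> * frechet_derivative f (at z) (axis j \<i>)) / 2"

definition deriv_zbar :: "'n \<Rightarrow> (complex ^ 'n \<Rightarrow> complex) \<Rightarrow> complex ^ 'n \<Rightarrow> complex" where
  "deriv_zbar j f z =
     (frechet_derivative f (at z) (axis j 1) + \<i> * frechet_derivative f (at z) (axis j \<i>)) / 2"

definition complex_hessian :: "(complex ^ 'n \<Rightarrow> real) \<Rightarrow> complex ^ 'n \<Rightarrow> complex ^ 'n ^ 'n" where
  "complex_hessian \<phi> a = (\<chi> j k. deriv_z j (deriv_zbar k (\<lambda>z. complex_of_real (\<phi> z))) a)"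

subsection \<open>Eigenvalues with multiplicity\<close>

definition charpoly :: "complex ^ 'n ^ 'n \<Rightarrow> complex poly" where
  "charpoly M = det (\<chi> i j. (if i = j then [:0, 1:] else 0) - [:M $ i $ j:])"

text \<open>Meant for Hermitian matrices: the roots of the characteristic polynomial are then real and
  taking real parts only changes their type.\<close>

definition hermitian_eigenvalues :: "complex ^ 'n ^ 'n \<Rightarrow> real multiset" where
  "hermitian_eigenvalues M = image_mset Re (proots (charpoly M))"

subsection \<open>Unitary matrices and the sets \<open>P\<^sup>(\<^sup>q\<^sup>)\<close>\<close>

definition conj_transpose :: "complex ^ 'n ^ 'm \<Rightarrow> complex ^ 'm ^ 'n" where
  "conj_transpose A = (\<chi> i j. cnj (A $ j $ i))"

definition unitary_matrix :: "complex ^ 'n ^ 'n \<Rightarrow> bool" where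
  "unitary_matrix A \<longleftrightarrow> conj_transpose A ** A = mat 1 \<and> A ** conj_transpose A = mat 1"

definition first_coords :: "nat \<Rightarrow> 'n::{finite,linorder} set" where
  "first_coords q = {i. card {..<i} < q}"

text \<open>For \<open>q = n\<close> the second condition is \<open>0 < s\<close>, matching the convention that the
  ball of \<open>\<complex>\<^sup>0\<close> is \<open>{0}\<close>.\<close>

definition ball_prod :: "nat \<Rightarrow> real \<Rightarrow> real \<Rightarrow> (complex ^ 'n::{finite,linorder}) set" where
  "ball_prod q r s =
     {z. L2_set (\<lambda>i. norm (z $ i)) (first_coords q) < r \<and>
         L2_set (\<lambda>i. norm (z $ i)) (- first_coords q) < s}"

definition Pset ::
    "nat \<Rightarrow> real \<Rightarrow> real \<Rightarrow> complex ^ 'n::{finite,linorder} ^ 'n::{finite,linorder}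
      \<Rightarrow> (complex ^ 'n::{finite,linorder}) set" where
  "Pset q r s A = (\<lambda>z. A *v z) ` ball_prod q r s"

text \<open>\<open>n\<close> is the dimension of the ambient space.\<close>

definition pdiam :: "nat \<Rightarrow> nat \<Rightarrow> real \<Rightarrow> real \<Rightarrow> real" where
  "pdiam n q r s =
     sqrt (real q / (real q + 1) * r\<^sup>2 + (real n - real q) / (real n - real q + 1) * s\<^sup>2)"

subsection \<open>The extension index of the metric \<open>e\<^sup>-\<^sup>\<phi>\<close>\<close>

text \<open>The value does not depend on \<open>\<xi> \<noteq> 0\<close>. Extended reals make the infimum over the empty set
  \<open>\<infinity>\<close>.\<close>

definition ext_index ::
    "nat \<Rightarrow> (complex ^ 'n::{finite,linorder} \<Rightarrow> real) \<Rightarrow> complex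
      \<Rightarrow> complex ^ 'n::{finite,linorder} \<Rightarrow> real \<Rightarrow> real
      \<Rightarrow> complex ^ 'n::{finite,linorder} ^ 'n::{finite,linorder} \<Rightarrow> ereal" where
  "ext_index q \<phi> \<xi> a r s A =
     (INF \<sigma> \<in> {\<sigma>. holomorphic_on_Cn \<sigma> ((+) a ` Pset q r s A) \<and>
               set_integrable lebesgue ((+) a ` Pset q r s A) (\<lambda>z. (cmod (\<sigma> z))\<^sup>2 * exp (- \<phi> z)) \<and>
               \<sigma> a = \<xi>}.
        ereal ((LINT z:((+) a ` Pset q r s A)|lebesgue. (cmod (\<sigma> z))\<^sup>2 * exp (- \<phi> z)) /
               (measure lebesgue (Pset q r s A) * (cmod \<xi>)\<^sup>2 * exp (- \<phi> a))))"

end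

theory Submission
  imports Defs "HOL-Complex_Analysis.Cauchy_Integral_Formula"
begin

text \<open>
  Write \<open>P = A(B\<^sub>r \<times> B\<^sub>s)\<close> for the set around \<open>a\<close> on which sections are extended, and let \<open>h\<close> be the
  mean of the Levi form \<open>H\<close> of \<open>\<phi>\<close> at \<open>a\<close> over \<open>P\<close> translated to the origin. The heart of the proof
  is that the extension index equals \<open>1 - h\<close> up to \<open>o(D\<^sup>2)\<close>, where \<open>D\<close> is the value of \<^const>\<open>pdiam\<close>
  at \<open>r\<close> and \<open>s\<close>, uniformly in \<open>A\<close> (\<open>ext_index_asymptotics\<close>).

  To see this, split the second-order Taylor polynomial of \<open>\<phi>\<close> at \<open>a\<close> as \<open>\<phi>(a) + 2 Re g + H\<close> with a
  holomorphic quadratic polynomial \<open>g\<close> that vanishes at the centre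
  (\<open>pluriharmonic_plus_levi_expansion\<close>). Replacing a section \<open>\<sigma>\<close> by \<open>f = \<sigma> e\<^sup>-\<^sup>g / \<xi>\<close> turns the problem into
  minimising the mean of \<open>|f|\<^sup>2 e\<^sup>-\<^sup>\<psi>\<close> over holomorphic \<open>f\<close> with value \<open>1\<close> at the centre, where
  \<open>\<psi> = H + o(|z|\<^sup>2)\<close>. The choice \<open>f = 1\<close> bounds the index above by the mean of \<open>e\<^sup>-\<^sup>\<psi>\<close>. Below, the
  pointwise inequality \<open>|f|\<^sup>2 e\<^sup>-\<^sup>\<psi> \<ge> 2 Re f - e\<^sup>\<psi>\<close> and the mean value property on the circled set \<open>P\<close>
  give \<open>2\<close> minus the mean of \<open>e\<^sup>\<psi>\<close> (\<open>ext_index_bounds\<close>). Both are \<open>1 - h\<close> up to terms of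
  the size of \<open>\<psi>\<^sup>2\<close> and \<open>o(|z|\<^sup>2)\<close>, and the mean of \<open>|z|\<^sup>2\<close> over \<open>P\<close> is exactly \<open>D\<^sup>2\<close>.

  The off-diagonal second moments of a product of balls vanish and the diagonal ones are constant on
  each factor, so \<open>h\<close> is a combination, with weights proportional to \<open>r\<^sup>2\<close> and \<open>s\<^sup>2\<close>, of the traces
  of \<open>H\<close> on the two coordinate subspaces rotated by \<open>A\<close> (\<open>polyball_hermitian_moment\<close>). As \<open>h\<close> and
  \<open>D\<^sup>2\<close> are homogeneous of degree two in \<open>(r, s)\<close>, the second condition of the theorem says
  precisely that \<open>c D\<^sup>2 \<le> h \<le> d D\<^sup>2\<close> for all radii and all \<open>A\<close>. Comparing the coefficients of \<open>r\<^sup>2\<close>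
  and \<open>s\<^sup>2\<close>, this means that the trace of \<open>H\<close> on every complex subspace of dimension \<open>q\<close> or \<open>n - q\<close>
  lies between \<open>c\<close> and \<open>d\<close> times the dimension. By the spectral theorem and an argument of Ky Fan
  type this is the first condition: the smaller positive one of the two dimensions gives the stronger
  requirement, and the traces are extremal on spans of eigenvectors
  (\<open>eigenvalue_sums_iff_partial_traces\<close>).
\<close>

section \<open>Spectral theory of Hermitian matrices\<close>

text \<open>
  The bathtub principle: among weights in \<open>[0, 1]\<close> of given total mass, the weighted sum is
  smallest when the mass sits on the smallest values. Let \<open>J\<close> carry the \<open>m\<close> smallest values of
  \<open>\<mu> - c\<close> and let \<open>\<theta>\<close> be the largest of them. Since the sum over \<open>J\<close> is nonnegative, so is \<open>\<theta>\<close>, and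
  all values outside \<open>J\<close> are at least \<open>\<theta>\<close>.
\<close>

lemma weighted_sum_lower_bound:
  fixes \<mu> p :: "'k \<Rightarrow> real"
  assumes K: "finite K" and m1: "1 \<le> m"
    and sums: "\<And>J. J \<subseteq> K \<Longrightarrow> card J = m \<Longrightarrow> c * real m \<le> sum \<mu> J"
    and p: "\<And>k. k \<in> K \<Longrightarrow> 0 \<le> p k \<and> p k \<le> 1"
    and m: "real m \<le> sum p K"
  shows "c * sum p K \<le> (\<Sum>k\<in>K. \<mu> k * p k)"
proof -
  have "sum p K \<le> (\<Sum>k\<in>K. 1)"
    using p by (intro sum_mono) auto
  then have "m \<le> card K"
    using m by simp
  define F where "F = {J. J \<subseteq> K \<and> card J = m}"
  \<comment> \<open>A minimising \<open>J\<close> consists of the smallest values, by exchanging one element at a time.\<close>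
  have "finite F"
    using K by (simp add: F_def)
  moreover have "F \<noteq> {}"
    using \<open>m \<le> card K\<close> obtain_subset_with_card_n[of m K] by (auto simp: F_def)
  ultimately obtain J where J: "J \<in> F" and min: "\<And>J'. J' \<in> F \<Longrightarrow> sum \<mu> J \<le> sum \<mu> J'"
    using ex_min_if_finite[of "sum \<mu> ` F"] by (force simp: not_less)
  have JK: "J \<subseteq> K" and cJ: "card J = m" and fJ: "finite J"
    using J K by (auto simp: F_def intro: finite_subset)
  have exch: "\<mu> j \<le> \<mu> k" if "j \<in> J" "k \<in> K - J" for j k
  proof -
    have "insert k (J - {j}) \<in> F"
      using that JK cJ fJ m1 by (auto simp: F_def card_insert_if)
    from min[OF this] have "sum \<mu> J \<le> \<mu> k + sum \<mu> (J - {j})"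
      using that fJ by simp
    then show ?thesis
      using that fJ by (simp add: sum_diff1)
  qed
  define \<theta> where "\<theta> = Max ((\<lambda>k. \<mu> k - c) ` J)"
  have "J \<noteq> {}"
    using cJ m1 by auto
  have ge: "\<mu> k - c \<le> \<theta>" if "k \<in> J" for k
    using that fJ by (auto simp: \<theta>_def)
  have "\<theta> \<in> (\<lambda>k. \<mu> k - c) ` J"
    unfolding \<theta>_def using fJ \<open>J \<noteq> {}\<close> by (intro Max_in) auto
  then have le: "\<theta> \<le> \<mu> k - c" if "k \<in> K - J" for k
    using exch that by auto
  have sJ: "0 \<le> (\<Sum>k\<in>J. \<mu> k - c)"
    using sums[OF JK cJ] cJ by (simp add: sum_subtractf mult.commute)
  also have "\<dots> \<le> (\<Sum>k\<in>J. \<theta>)"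
    using ge by (rule sum_mono)
  finally have "0 \<le> \<theta>"
    using cJ m1 by (simp add: zero_le_mult_iff)
  have pt: "\<theta> * p k + (if k \<in> J then \<mu> k - c - \<theta> else 0) \<le> (\<mu> k - c) * p k" if "k \<in> K" for k
  proof (cases "k \<in> J")
    case True
    have "0 \<le> (\<theta> - (\<mu> k - c)) * (1 - p k)"
      using ge[OF True] p[OF that] by (intro mult_nonneg_nonneg) auto
    then show ?thesis
      using True by (simp add: algebra_simps)
  next
    case False
    then show ?thesis
      using le[of k] p[OF that] that by (auto intro!: mult_right_mono)
  qed
  have "0 \<le> \<theta> * (sum p K - real m) + (\<Sum>k\<in>J. \<mu> k - c)"
    using sJ \<open>0 \<le> \<theta>\<close> m by (intro add_nonneg_nonneg mult_nonneg_nonneg) auto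
  also have "\<dots> = \<theta> * sum p K + (\<Sum>k\<in>J. \<mu> k - c - \<theta>)"
    by (simp add: sum_subtractf cJ algebra_simps)
  also have "\<dots> = (\<Sum>k\<in>K. \<theta> * p k + (if k \<in> J then \<mu> k - c - \<theta> else 0))"
    using K JK by (simp add: sum.distrib sum_distrib_left sum.If_cases Int_absorb1)
  also have "\<dots> \<le> (\<Sum>k\<in>K. (\<mu> k - c) * p k)"
    using pt by (rule sum_mono)
  finally show ?thesis
    by (simp add: left_diff_distrib sum_subtractf sum_distrib_left)
qed

definition cdot :: "complex ^ 'n \<Rightarrow> complex ^ 'n \<Rightarrow> complex" where
  "cdot x y = (\<Sum>i\<in>UNIV. x $ i * cnj (y $ i))"

lemma Re_cdot: "Re (cdot x y) = x \<bullet> y"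
  by (simp add: cdot_def inner_vec_def inner_complex_def)

lemma cdot_simps:
  "cdot (x + y) z = cdot x z + cdot y z" "cdot (x - y) z = cdot x z - cdot y z"
  "cdot (r *\<^sub>R x) z = of_real r * cdot x z" "cdot (u *s x) z = u * cdot x z"
  "cdot 0 z = 0" "cdot z (u *s x) = cnj u * cdot z x"
  by (simp_all add: cdot_def sum.distrib sum_subtractf sum_distrib_left algebra_simps
      scaleR_conv_of_real[where 'a = complex])

lemma cdot_commute: "cdot y x = cnj (cdot x y)"
  by (simp add: cdot_def mult.commute)

lemma cdot_self: "cdot x x = of_real ((norm x)\<^sup>2)"
proof (rule complex_eqI)
  show "Im (cdot x x) = Im (of_real ((norm x)\<^sup>2))"
    by (simp add: cdot_def)
qed (simp add: Re_cdot power2_norm_eq_inner)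

lemma cdot_hermitian:
  assumes "\<And>j k. M $ j $ k = cnj (M $ k $ j)"
  shows "cdot (M *v x) y = cdot x (M *v y)"
proof -
  have "cdot (M *v x) y = (\<Sum>i\<in>UNIV. \<Sum>j\<in>UNIV. M $ i $ j * x $ j * cnj (y $ i))"
    by (simp add: cdot_def matrix_vector_mult_def sum_distrib_right)
  also have "\<dots> = (\<Sum>j\<in>UNIV. \<Sum>i\<in>UNIV. M $ i $ j * x $ j * cnj (y $ i))"
    by (rule sum.swap)
  also have "\<dots> = cdot x (M *v y)"
    unfolding cdot_def matrix_vector_mult_def
    by (simp add: sum_distrib_left) (subst assms, simp add: mult_ac)
  finally show ?thesis .
qed

lemma matrix_vector_mult_scaleR_complex:
  "(M :: complex ^ 'n ^ 'm) *v (r *\<^sub>R x) = r *\<^sub>R (M *v x)"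
  by (simp add: matrix_vector_mult_def vec_eq_iff scaleR_sum_right)

lemma linear_matrix_vector_mult_complex: "linear ((*v) (M :: complex ^ 'n ^ 'm))"
  by (rule linearI) (simp_all add: matrix_vector_right_distrib matrix_vector_mult_scaleR_complex)

text \<open>
  The orthogonal complement of a family of eigenvectors is invariant under \<open>M\<close>; a maximiser of the
  Rayleigh quotient on its unit sphere is an eigenvector, because the first variation of the quotient
  vanishes there.
\<close>

lemma hermitian_eigenvector_orthogonal:
  fixes M :: "complex ^ 'n ^ 'n"
  assumes herm: "\<And>j k. M $ j $ k = cnj (M $ k $ j)"
    and B: "finite B" "card B < CARD('n)"
    and eig: "\<And>b. b \<in> B \<Longrightarrow> \<exists>l. M *v b = l *s b"
  obtains x and l :: real where "norm x = 1" "M *v x = of_real l *s x" "\<And>b. b \<in> B \<Longrightarrow> cdot x b = 0"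
proof -
  define W where "W = {x. \<forall>b\<in>B. cdot x b = 0}"
  have MW: "M *v x \<in> W" if "x \<in> W" for x
    unfolding W_def
  proof safe
    fix b assume b: "b \<in> B"
    obtain l where "M *v b = l *s b"
      using eig[OF b] by blast
    then show "cdot (M *v x) b = 0"
      using that b by (simp add: cdot_hermitian[OF herm] cdot_simps W_def)
  qed
  \<comment> \<open>Complex orthogonality to \<open>b\<close> is real orthogonality to \<open>b\<close> and \<open>\<i> b\<close>, which is at most \<open>2 card B\<close>
    real conditions on a space of real dimension \<open>2 n\<close>.\<close>
  define S where "S = B \<union> (\<lambda>b. \<i> *s b) ` B"
  have "dim S \<le> card S"
    using B by (intro dim_le_card') (simp add: S_def)
  also have "card S \<le> card B + card B"
    unfolding S_def by (rule order_trans[OF card_Un_le]) (simp add: card_image_le B)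
  also have "\<dots> < DIM(complex ^ 'n)"
    using B by simp
  finally obtain x1 where x1: "x1 \<noteq> 0" "\<And>y. y \<in> span S \<Longrightarrow> orthogonal x1 y"
    using orthogonal_to_subspace_exists by blast
  have "x1 \<in> W"
    unfolding W_def
  proof safe
    fix b assume "b \<in> B"
    then have "b \<in> span S" "\<i> *s b \<in> span S"
      by (auto simp: S_def intro: span_base)
    then have "x1 \<bullet> b = 0" "x1 \<bullet> (\<i> *s b) = 0"
      using x1 by (auto simp: orthogonal_def)
    then show "cdot x1 b = 0"
      by (simp add: complex_eq_iff flip: Re_cdot) (simp add: cdot_simps)
  qed
  have Wsc: "r *\<^sub>R x \<in> W" "x + y \<in> W" "x - y \<in> W" if "x \<in> W" "y \<in> W" for x y r
    using that by (auto simp: W_def cdot_simps)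
  have clW: "closed W"
  proof -
    have "W = (\<Inter>b\<in>B. {x. cdot x b = 0})"
      by (auto simp: W_def)
    then show ?thesis
      unfolding cdot_def by (simp add: closed_INT closed_Collect_eq continuous_intros)
  qed
  have lin: "linear ((*v) M)"
    by (rule linear_matrix_vector_mult_complex)
  define K where "K = W \<inter> sphere 0 1"
  have "compact K"
    unfolding K_def using clW by (intro closed_Int_compact) auto
  moreover have "K \<noteq> {}"
  proof -
    have "inverse (norm x1) *\<^sub>R x1 \<in> K"
      using Wsc[OF \<open>x1 \<in> W\<close> \<open>x1 \<in> W\<close>] x1 by (simp add: K_def)
    then show ?thesis by blast
  qed
  moreover have "continuous_on K (\<lambda>x. (M *v x) \<bullet> x)"
    using lin by (intro continuous_on_inner linear_continuous_on continuous_on_id)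
      (simp add: linear_conv_bounded_linear)
  ultimately have "\<exists>x\<in>K. \<forall>y\<in>K. (M *v y) \<bullet> y \<le> (M *v x) \<bullet> x"
    by (rule continuous_attains_sup)
  then obtain x0 where x0: "x0 \<in> K" and max: "\<And>x. x \<in> K \<Longrightarrow> (M *v x) \<bullet> x \<le> (M *v x0) \<bullet> x0"
    by blast
  define l where "l = (M *v x0) \<bullet> x0"
  have x0W: "x0 \<in> W" and nx0: "norm x0 = 1"
    using x0 by (auto simp: K_def)
  have Q: "(M *v x) \<bullet> x \<le> l * (norm x)\<^sup>2" if "x \<in> W" for x
  proof (cases "x = 0")
    case False
    have "inverse (norm x) *\<^sub>R x \<in> K"
      using Wsc[OF that that] False by (simp add: K_def)
    from max[OF this] False show ?thesis
      by (simp add: l_def matrix_vector_mult_scaleR_complex field_simps power2_eq_square)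
  qed simp
  define y where "y = M *v x0 - l *\<^sub>R x0"
  have yW: "y \<in> W"
    unfolding y_def using Wsc MW x0W by auto
  define C where "C = l * (norm y)\<^sup>2 - (M *v y) \<bullet> y"
  have sym: "(M *v u) \<bullet> v = u \<bullet> (M *v v)" for u v
    using cdot_hermitian[OF herm, of u v] by (simp flip: Re_cdot)
  \<comment> \<open>Moving from the maximiser in the direction of the defect \<open>y = M x0 - l x0\<close> would increase the
    quotient at first order.\<close>
  have step: "2 * (norm y)\<^sup>2 \<le> t * C" if "0 < t" for t
  proof -
    have "x0 + t *\<^sub>R y \<in> W"
      using Wsc x0W yW by auto
    note Q[OF this]
    moreover have expand1: "(M *v (x0 + t *\<^sub>R y)) \<bullet> (x0 + t *\<^sub>R y) =
        (M *v x0) \<bullet> x0 + 2 * t * ((M *v x0) \<bullet> y) + t\<^sup>2 * ((M *v y) \<bullet> y)"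
      using sym[of y x0]
      by (simp add: linear_add[OF lin] linear_scale[OF lin] inner_add_left inner_add_right
          inner_commute[of y] power2_eq_square distrib_left)
    moreover have expand2: "(norm (x0 + t *\<^sub>R y))\<^sup>2 = 1 + 2 * t * (x0 \<bullet> y) + t\<^sup>2 * (norm y)\<^sup>2"
      using nx0 unfolding power2_norm_eq_inner norm_eq_1
      by (simp add: inner_add_left inner_add_right inner_commute[of y x0] power2_eq_square distrib_left)
    ultimately have "(M *v x0) \<bullet> x0 + 2 * t * ((M *v x0) \<bullet> y) + t\<^sup>2 * ((M *v y) \<bullet> y)
        \<le> l * (1 + 2 * t * (x0 \<bullet> y) + t\<^sup>2 * (norm y)\<^sup>2)"
      by simp
    moreover have "(M *v x0) \<bullet> y - l * (x0 \<bullet> y) = (norm y)\<^sup>2"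
      unfolding power2_norm_eq_inner by (simp add: inner_diff_left[symmetric] y_def flip: inner_scaleR_left)
    ultimately have "t * (2 * (norm y)\<^sup>2) \<le> t * (t * C)"
      unfolding C_def l_def[symmetric] by (simp add: power2_eq_square algebra_simps)
    then show ?thesis
      using that by simp
  qed
  have "2 * (norm y)\<^sup>2 \<le> 0"
  proof (rule tendsto_lowerbound)
    show "((\<lambda>t. t * C) \<longlongrightarrow> 0) (at_right 0)"
      by (auto intro!: tendsto_eq_intros)
    show "\<forall>\<^sub>F t in at_right 0. 2 * (norm y)\<^sup>2 \<le> t * C"
      using step by (auto simp: eventually_at_filter)
  qed simp
  then have "M *v x0 = of_real l *s x0"
    by (simp add: y_def vec_eq_iff scaleR_conv_of_real[symmetric])
  moreover have "\<And>b. b \<in> B \<Longrightarrow> cdot x0 b = 0"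
    using x0W by (simp add: W_def)
  ultimately show thesis
    using nx0 that by blast
qed

text \<open>
  Orthonormal families of eigenvectors are enlarged one vector at a time until they form a basis.
\<close>

lemma hermitian_spectral_decomposition:
  fixes M :: "complex ^ 'n ^ 'n"
  assumes herm: "\<And>j k. M $ j $ k = cnj (M $ k $ j)"
  obtains U and l :: "'n \<Rightarrow> real"
    where "unitary_matrix U"
      and "\<And>j k. M $ j $ k = (\<Sum>p\<in>UNIV. of_real (l p) * U $ j $ p * cnj (U $ k $ p))"
proof -
  define eigenfamily where "eigenfamily B \<longleftrightarrow> finite B \<and>
      (\<forall>b\<in>B. norm b = 1 \<and> (\<exists>l::real. M *v b = of_real l *s b)) \<and>
      (\<forall>b\<in>B. \<forall>b'\<in>B. b \<noteq> b' \<longrightarrow> cdot b b' = 0)" for B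
  have "\<exists>B. eigenfamily B \<and> card B = k" if "k \<le> CARD('n)" for k
    using that
  proof (induction k)
    case 0
    show ?case by (rule exI[of _ "{}"]) (simp add: eigenfamily_def)
  next
    case (Suc k)
    then obtain B where B: "eigenfamily B" "card B = k"
      by (metis Suc_leD)
    have B_fin: "finite B" and lt: "card B < CARD('n)"
      using B Suc.prems by (simp_all add: eigenfamily_def)
    have eig: "\<exists>l. M *v b = l *s b" if "b \<in> B" for b
      using B that unfolding eigenfamily_def by metis
    obtain x and l :: real where x: "norm x = 1" "M *v x = of_real l *s x"
        and orth: "\<And>b. b \<in> B \<Longrightarrow> cdot x b = 0"
      using hermitian_eigenvector_orthogonal[OF herm B_fin lt eig] by metis
    have "x \<notin> B"
      using orth[of x] x(1) by (auto simp: cdot_self)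
    moreover have "cdot b x = 0" if "b \<in> B" for b
      using orth[OF that] cdot_commute[of b x] by simp
    ultimately have "eigenfamily (insert x B)" "card (insert x B) = Suc k"
      using B x orth B_fin unfolding eigenfamily_def by auto
    then show ?case
      by blast
  qed
  from this[OF order_refl] obtain B where B': "eigenfamily B" "card B = CARD('n)"
    by blast
  have B: "finite B" "card B = CARD('n)"
    "\<And>b. b \<in> B \<Longrightarrow> norm b = 1 \<and> (\<exists>l::real. M *v b = of_real l *s b)"
    "\<And>b b'. b \<in> B \<Longrightarrow> b' \<in> B \<Longrightarrow> b \<noteq> b' \<Longrightarrow> cdot b b' = 0"
    using B' unfolding eigenfamily_def by blast+
  obtain f where f: "bij_betw f (UNIV :: 'n set) B"
    using finite_same_card_bij[of "UNIV :: 'n set" B] B by auto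
  then have fB: "f p \<in> B" and finj: "f p = f p' \<longleftrightarrow> p = p'" for p p'
    by (auto simp: bij_betw_def inj_eq)
  obtain l where l: "\<And>p. M *v f p = of_real (l p :: real) *s f p"
    using B(3)[OF fB] by metis
  have ortho: "cdot (f p) (f p') = (if p = p' then 1 else 0)" for p p'
    using B(3)[OF fB] B(4)[OF fB fB] finj by (auto simp: cdot_self)
  define U where "U = (\<chi> j p. f p $ j)"
  have "conj_transpose U ** U = mat 1"
    using ortho by (simp add: conj_transpose_def U_def matrix_matrix_mult_def mat_def vec_eq_iff cdot_def mult.commute)
  then have uni: "unitary_matrix U"
    using matrix_left_right_inverse by (auto simp: unitary_matrix_def)
  have "M $ j $ k = (\<Sum>p\<in>UNIV. of_real (l p) * U $ j $ p * cnj (U $ k $ p))" for j k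
  proof -
    have "M = (M ** U) ** conj_transpose U"
      using uni by (simp add: unitary_matrix_def flip: matrix_mul_assoc)
    then have "M $ j $ k = ((M ** U) ** conj_transpose U) $ j $ k"
      by simp
    also have "\<dots> = (\<Sum>p\<in>UNIV. (M *v f p) $ j * cnj (U $ k $ p))"
      by (simp add: matrix_matrix_mult_def conj_transpose_def matrix_vector_mult_def U_def)
    finally show ?thesis
      by (simp add: l U_def)
  qed
  with uni show thesis by (rule that)
qed

lemma unitary_matrix_columns:
  assumes "unitary_matrix U"
  shows "(\<Sum>k\<in>UNIV. cnj (U $ k $ i) * U $ k $ j) = (if i = j then 1 else 0)"
proof -
  have "(conj_transpose U ** U) $ i $ j = mat 1 $ i $ j"
    using assms by (simp add: unitary_matrix_def)
  then show ?thesis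
    by (simp add: matrix_matrix_mult_def conj_transpose_def mat_def)
qed

lemma unitary_matrix_rows:
  assumes "unitary_matrix U"
  shows "(\<Sum>k\<in>UNIV. U $ i $ k * cnj (U $ j $ k)) = (if i = j then 1 else 0)"
proof -
  have "(U ** conj_transpose U) $ i $ j = mat 1 $ i $ j"
    using assms by (simp add: unitary_matrix_def)
  then show ?thesis
    by (simp add: matrix_matrix_mult_def conj_transpose_def mat_def)
qed

text \<open>
  The unitary diagonalisation is carried out over the polynomial ring, where it turns the characteristic
  matrix into a diagonal matrix of linear factors.
\<close>

lemma hermitian_eigenvalues_spectral:
  fixes M :: "complex ^ 'n ^ 'n"
  assumes U: "unitary_matrix U"
    and M: "\<And>j k. M $ j $ k = (\<Sum>p\<in>UNIV. of_real (l p) * U $ j $ p * cnj (U $ k $ p))"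
  shows "hermitian_eigenvalues M = image_mset l (mset_set UNIV)"
proof -
  define Up where "Up = (\<chi> j p. [:U $ j $ p:])"
  define Vp where "Vp = (\<chi> p k. [:cnj (U $ k $ p):])"
  define D :: "complex poly ^ 'n ^ 'n" where "D = (\<chi> i j. if i = j then [:- of_real (l i), 1:] else 0)"
  have sum_const: "(\<Sum>p\<in>A. [:f p:]) = [:\<Sum>p\<in>A. f p:]" for f :: "'n \<Rightarrow> complex" and A
    by (induction A rule: infinite_finite_induct) auto
  have UV: "Up ** Vp = mat 1"
    using unitary_matrix_rows[OF U]
    by (simp add: Up_def Vp_def matrix_matrix_mult_def mat_def vec_eq_iff sum_const one_pCons mult.commute)
  have entry: "(Up ** D ** Vp) $ j $ k = (if j = k then [:0, 1:] else 0) - [:M $ j $ k:]" for j k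
  proof -
    have "(Up ** D) $ j $ p = [:U $ j $ p:] * [:- of_real (l p), 1:]" for p
      by (simp add: matrix_matrix_mult_def Up_def D_def if_distrib[of "\<lambda>x. _ * x"] cong: if_cong)
    then have "(Up ** D ** Vp) $ j $ k = (\<Sum>p\<in>UNIV. [:U $ j $ p:] * [:- of_real (l p), 1:] * [:cnj (U $ k $ p):])"
      by (simp add: matrix_matrix_mult_def[of "Up ** D"] Vp_def)
    also have "\<dots> = (\<Sum>p\<in>UNIV. [:0, 1:] * [:U $ j $ p * cnj (U $ k $ p):] - [:of_real (l p) * U $ j $ p * cnj (U $ k $ p):])"
      by (intro sum.cong) (auto simp: mult_ac)
    also have "\<dots> = [:0, 1:] * [:\<Sum>p\<in>UNIV. U $ j $ p * cnj (U $ k $ p):] - [:M $ j $ k:]"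
      by (simp only: sum_subtractf sum_distrib_left[symmetric] sum_const M[symmetric])
    finally show ?thesis
      by (simp add: unitary_matrix_rows[OF U])
  qed
  have "charpoly M = det (Up ** D ** Vp)"
    unfolding charpoly_def by (rule arg_cong[where f = det]) (simp add: vec_eq_iff entry)
  also have "\<dots> = det (Up ** Vp) * det D"
    by (simp add: det_mul)
  also have "\<dots> = (\<Prod>i\<in>UNIV. [:- of_real (l i), 1:])"
    unfolding UV by (simp add: det_diagonal D_def)
  finally have "proots (charpoly M) = (\<Sum>i\<in>UNIV. {#complex_of_real (l i)#})"
    by (simp add: proots_prod)
  also have "\<dots> = image_mset (\<lambda>i. complex_of_real (l i)) (mset_set UNIV)"
    by (rule sum_unfold_sum_mset[THEN trans]) simp
  finally show ?thesis
    by (simp add: hermitian_eigenvalues_def image_mset.compositionality o_def)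
qed

lemma subseteq_image_mset_set:
  assumes "finite K" "S \<subseteq># image_mset f (mset_set K)"
  obtains J where "J \<subseteq> K" "S = image_mset f (mset_set J)"
proof -
  obtain R where "image_mset f (mset_set K) = S + R"
    using assms by (metis subset_mset.add_diff_inverse)
  then obtain S' R' where SR: "mset_set K = S' + R'" "S = image_mset f S'"
    by (metis image_mset_eq_plusD)
  have "count S' x \<le> 1" for x
    using SR(1) assms(1) by (metis count_mset_set' count_union le_add1 le_numeral_extra(4) zero_le_one order_trans)
  then have "S' = mset_set (set_mset S')"
    by (intro multiset_eqI)
       (metis count_eq_zero_iff count_mset_set(1,3) finite_set_mset le_antisym not_gr_zero less_one not_le)
  moreover have "set_mset S' \<subseteq> K"
    using SR(1) assms(1) by (metis finite_set_mset_mset_set set_mset_union Un_upper1)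
  ultimately show thesis
    using that SR(2) by metis
qed

lemma card_lessThan_index_bij: "bij_betw (\<lambda>i :: 'n::{finite,linorder}. card {..<i}) UNIV {..<CARD('n)}"
proof -
  have "strict_mono (\<lambda>i :: 'n. card {..<i})"
    by (intro strict_monoI psubset_card_mono) auto
  then have inj: "inj (\<lambda>i :: 'n. card {..<i})"
    by (rule strict_mono_imp_inj_on)
  have "card {..<i} < CARD('n)" for i :: 'n
    by (rule psubset_card_mono) auto
  then have "range (\<lambda>i :: 'n. card {..<i}) \<subseteq> {..<CARD('n)}"
    by auto
  then have "range (\<lambda>i :: 'n. card {..<i}) = {..<CARD('n)}"
    by (intro card_subset_eq) (auto simp: card_image inj)
  with inj show ?thesis
    by (simp add: bij_betw_def)
qed

lemma card_first_coords:
  assumes "q \<le> CARD('n::{finite,linorder})"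
  shows "card (first_coords q :: 'n set) = q"
proof -
  have bij: "bij_betw (\<lambda>i :: 'n. card {..<i}) (first_coords q) {..<q}"
    unfolding first_coords_def
  proof (rule bij_betw_imageI)
    show "inj_on (\<lambda>i :: 'n. card {..<i}) {i. card {..<i} < q}"
      using card_lessThan_index_bij by (auto simp: bij_betw_def intro: inj_on_subset)
    have "{..<q} \<subseteq> range (\<lambda>i :: 'n. card {..<i})"
      using card_lessThan_index_bij[where 'n = 'n] assms by (auto simp: bij_betw_def)
    then show "(\<lambda>i :: 'n. card {..<i}) ` {i. card {..<i} < q} = {..<q}"
      by auto
  qed
  show ?thesis
    using bij_betw_same_card[OF bij] by simp
qed

text \<open>
  The trace, over the coordinates in \<open>I\<close>, of the form with matrix \<open>M\<close> after the substitution
  \<open>z = A w\<close>. The convention is that of Levi forms, linear in the row index of \<open>M\<close> and antilinear in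
  the column index, so the matrix of the substituted form is the transpose of \<open>A\<close> times \<open>M\<close> times the
  complex conjugate of \<open>A\<close>.
\<close>

definition partial_trace :: "complex ^ 'n ^ 'n \<Rightarrow> complex ^ 'n ^ 'n \<Rightarrow> 'n set \<Rightarrow> real" where
  "partial_trace M A I = (\<Sum>i\<in>I. Re (\<Sum>j\<in>UNIV. \<Sum>k\<in>UNIV. A $ j $ i * M $ j $ k * cnj (A $ k $ i)))"

lemma unitary_matrix_mult:
  assumes "unitary_matrix A" "unitary_matrix B"
  shows "unitary_matrix (A ** B)"
proof -
  have ct: "conj_transpose (A ** B) = conj_transpose B ** conj_transpose A"
    by (simp add: conj_transpose_def matrix_matrix_mult_def vec_eq_iff mult.commute)
  have "conj_transpose B ** conj_transpose A ** (A ** B)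
      = conj_transpose B ** (conj_transpose A ** A) ** B"
    by (simp only: matrix_mul_assoc)
  then have "conj_transpose (A ** B) ** (A ** B) = mat 1"
    using assms by (simp add: ct unitary_matrix_def)
  then show ?thesis
    using matrix_left_right_inverse by (auto simp: unitary_matrix_def)
qed

lemma unitary_matrix_transpose:
  assumes "unitary_matrix A"
  shows "unitary_matrix (transpose A)"
proof -
  have "conj_transpose (transpose A) ** transpose A = mat 1"
    using unitary_matrix_rows[OF assms]
    by (simp add: conj_transpose_def transpose_def matrix_matrix_mult_def mat_def vec_eq_iff mult.commute)
  then show ?thesis
    using matrix_left_right_inverse by (auto simp: unitary_matrix_def)
qed

lemma partial_trace_spectral:
  fixes A M :: "complex ^ 'n ^ 'n"
  assumes M: "\<And>j k. M $ j $ k = (\<Sum>p\<in>UNIV. of_real (l p) * U $ j $ p * cnj (U $ k $ p))"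
  shows "partial_trace M A I = (\<Sum>p\<in>UNIV. l p * (\<Sum>i\<in>I. (cmod ((transpose A ** U) $ i $ p))\<^sup>2))"
proof -
  have "Re (\<Sum>j\<in>UNIV. \<Sum>k\<in>UNIV. A $ j $ i * M $ j $ k * cnj (A $ k $ i))
      = (\<Sum>p\<in>UNIV. l p * (cmod ((transpose A ** U) $ i $ p))\<^sup>2)" for i
  proof -
    let ?w = "\<lambda>p. (transpose A ** U) $ i $ p"
    have "(\<Sum>j\<in>UNIV. \<Sum>k\<in>UNIV. A $ j $ i * M $ j $ k * cnj (A $ k $ i))
        = (\<Sum>j\<in>UNIV. \<Sum>k\<in>UNIV. \<Sum>p\<in>UNIV. of_real (l p) * ((A $ j $ i * U $ j $ p) * cnj (A $ k $ i * U $ k $ p)))"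
      unfolding M by (simp add: sum_distrib_left sum_distrib_right mult_ac)
    also have "\<dots> = (\<Sum>j\<in>UNIV. \<Sum>p\<in>UNIV. \<Sum>k\<in>UNIV. of_real (l p) * ((A $ j $ i * U $ j $ p) * cnj (A $ k $ i * U $ k $ p)))"
      by (rule sum.cong[OF refl], rule sum.swap)
    also have "\<dots> = (\<Sum>p\<in>UNIV. \<Sum>j\<in>UNIV. \<Sum>k\<in>UNIV. of_real (l p) * ((A $ j $ i * U $ j $ p) * cnj (A $ k $ i * U $ k $ p)))"
      by (rule sum.swap)
    also have "\<dots> = (\<Sum>p\<in>UNIV. of_real (l p) * (?w p * cnj (?w p)))"
      by (simp only: matrix_matrix_mult_def transpose_def vec_lambda_beta cnj_sum sum_product)
        (simp only: sum_distrib_left)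
    also have "\<dots> = of_real (\<Sum>p\<in>UNIV. l p * (cmod (?w p))\<^sup>2)"
      by (simp only: of_real_sum of_real_mult complex_norm_square)
    finally show ?thesis
      by simp
  qed
  then have "partial_trace M A I = (\<Sum>i\<in>I. \<Sum>p\<in>UNIV. l p * (cmod ((transpose A ** U) $ i $ p))\<^sup>2)"
    by (simp add: partial_trace_def)
  also have "\<dots> = (\<Sum>p\<in>UNIV. \<Sum>i\<in>I. l p * (cmod ((transpose A ** U) $ i $ p))\<^sup>2)"
    by (rule sum.swap)
  finally show ?thesis
    by (simp add: sum_distrib_left)
qed

text \<open>
  The squared moduli of the entries of a unitary matrix are doubly stochastic. Hence a partial trace is
  a weighted sum of the eigenvalues with weights in \<open>[0, 1]\<close> of total mass \<open>card I\<close>. The upper bound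
  is the lower bound for \<open>- M\<close>.
\<close>

lemma partial_trace_bounds:
  fixes A M :: "complex ^ 'n ^ 'n"
  assumes U: "unitary_matrix U" and A: "unitary_matrix A"
    and M: "\<And>j k. M $ j $ k = (\<Sum>p\<in>UNIV. of_real (l p) * U $ j $ p * cnj (U $ k $ p))"
    and m: "1 \<le> m" "m \<le> card I"
    and sums: "\<And>J. card J = m \<Longrightarrow> c * real m \<le> sum l J \<and> sum l J \<le> d * real m"
  shows "c * real (card I) \<le> partial_trace M A I" "partial_trace M A I \<le> d * real (card I)"
proof -
  let ?W = "transpose A ** U"
  define w where "w p = (\<Sum>i\<in>I. (cmod (?W $ i $ p))\<^sup>2)" for p
  have W: "unitary_matrix ?W"
    using A U by (intro unitary_matrix_mult unitary_matrix_transpose)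
  have rows: "(\<Sum>p\<in>UNIV. (cmod (?W $ i $ p))\<^sup>2) = 1" for i
  proof -
    have "complex_of_real (\<Sum>p\<in>UNIV. (cmod (?W $ i $ p))\<^sup>2) = 1"
      unfolding of_real_sum complex_norm_square using unitary_matrix_rows[OF W, of i i] by simp
    then show ?thesis
      unfolding of_real_eq_1_iff .
  qed
  have cols: "(\<Sum>i\<in>UNIV. (cmod (?W $ i $ p))\<^sup>2) = 1" for p
  proof -
    have "complex_of_real (\<Sum>i\<in>UNIV. (cmod (?W $ i $ p))\<^sup>2) = 1"
      unfolding of_real_sum complex_norm_square
      using unitary_matrix_columns[OF W, of p p] by (simp add: mult.commute)
    then show ?thesis
      unfolding of_real_eq_1_iff .
  qed
  have w01: "0 \<le> w p \<and> w p \<le> 1" for p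
  proof -
    have "w p \<le> (\<Sum>i\<in>UNIV. (cmod (?W $ i $ p))\<^sup>2)"
      unfolding w_def by (rule sum_mono2) auto
    then show ?thesis
      by (simp add: cols w_def sum_nonneg)
  qed
  have "sum w UNIV = (\<Sum>i\<in>I. \<Sum>p\<in>UNIV. (cmod (?W $ i $ p))\<^sup>2)"
    unfolding w_def by (rule sum.swap)
  then have sumw: "sum w UNIV = real (card I)"
    by (simp add: rows)
  have pt: "partial_trace M A I = (\<Sum>p\<in>UNIV. l p * w p)"
    unfolding w_def by (rule partial_trace_spectral[OF M])
  show "c * real (card I) \<le> partial_trace M A I"
    unfolding pt sumw[symmetric]
    using sums m w01 sumw by (intro weighted_sum_lower_bound[of UNIV m]) auto
  have "(- d) * sum w UNIV \<le> (\<Sum>p\<in>UNIV. - l p * w p)"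
    using sums m w01 sumw by (intro weighted_sum_lower_bound[of UNIV m]) (auto simp: sum_negf)
  then show "partial_trace M A I \<le> d * real (card I)"
    by (simp add: pt sumw sum_negf)
qed

text \<open>
  Take for the columns of \<open>A\<close> the conjugated eigenvectors, permuted so that \<open>I\<close> is sent to \<open>J\<close>.
\<close>

lemma partial_trace_eigenvalue_sum:
  fixes M :: "complex ^ 'n ^ 'n"
  assumes U: "unitary_matrix U"
    and M: "\<And>j k. M $ j $ k = (\<Sum>p\<in>UNIV. of_real (l p) * U $ j $ p * cnj (U $ k $ p))"
    and card: "card I = card J"
  obtains A where "unitary_matrix A" "partial_trace M A I = sum l J"
proof -
  obtain f where f: "bij_betw f I J"
    using finite_same_card_bij[of I J] card by auto
  have "card (- I) = card (- J)"
    using card by (simp add: Compl_eq_Diff_UNIV card_Diff_subset)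
  then obtain g where g: "bij_betw g (- I) (- J)"
    using finite_same_card_bij[of "- I" "- J"] by auto
  define h where "h i = (if i \<in> I then f i else g i)" for i
  have hI: "bij_betw h I J"
    using f bij_betw_cong[of I h f J] by (simp add: h_def)
  moreover have "bij_betw h (- I) (- J)"
    using g bij_betw_cong[of "- I" h g "- J"] by (simp add: h_def)
  ultimately have "bij_betw h (I \<union> - I) (J \<union> - J)"
    by (rule bij_betw_combine) auto
  then have inj: "h i = h j \<longleftrightarrow> i = j" for i j
    by (auto simp: bij_betw_def inj_eq)
  define A where "A = (\<chi> j i. cnj (U $ j $ h i))"
  have "conj_transpose A ** A = mat 1"
    using unitary_matrix_columns[OF U] inj
    by (simp add: A_def conj_transpose_def matrix_matrix_mult_def mat_def vec_eq_iff mult.commute)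
  then have uni: "unitary_matrix A"
    using matrix_left_right_inverse by (auto simp: unitary_matrix_def)
  have entry: "(transpose A ** U) $ i $ p = (if h i = p then 1 else 0)" for i p
    using unitary_matrix_columns[OF U] by (simp add: A_def transpose_def matrix_matrix_mult_def)
  have "partial_trace M A I = (\<Sum>p\<in>UNIV. \<Sum>i\<in>I. if h i = p then l p else 0)"
    unfolding partial_trace_spectral[OF M] entry
    by (auto simp: sum_distrib_left intro!: sum.cong)
  also have "\<dots> = (\<Sum>i\<in>I. \<Sum>p\<in>UNIV. if h i = p then l p else 0)"
    by (rule sum.swap)
  also have "\<dots> = (\<Sum>i\<in>I. l (h i))"
    by simp
  also have "\<dots> = sum l J"
    using hI by (rule sum.reindex_bij_betw)
  finally show thesis
    using that uni by blast
qed

text \<open>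
  Bounds on all sums of \<open>m\<close> eigenvalues imply the proportional bounds on partial traces over any
  larger number of coordinates. Conversely one of the two blocks of coordinates has exactly \<open>m\<close>
  elements, and every sum of \<open>m\<close> eigenvalues is a partial trace over it.
\<close>

lemma eigenvalue_sums_iff_partial_traces:
  fixes M :: "complex ^ 'n::{finite,linorder} ^ 'n::{finite,linorder}"
  assumes herm: "\<And>j k. M $ j $ k = cnj (M $ k $ j)"
    and q: "1 \<le> q" "q \<le> CARD('n)"
    and m: "m = (if q = CARD('n) then CARD('n) else min q (CARD('n) - q))"
  shows "(\<forall>S. S \<subseteq># hermitian_eigenvalues M \<and> size S = m \<longrightarrow>
            c * real m \<le> sum_mset S \<and> sum_mset S \<le> d * real m)
         \<longleftrightarrow>
         (\<forall>A. unitary_matrix A \<longrightarrow>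
            c * real q \<le> partial_trace M A (first_coords q) \<and>
            partial_trace M A (first_coords q) \<le> d * real q \<and>
            c * (real CARD('n) - real q) \<le> partial_trace M A (- first_coords q) \<and>
            partial_trace M A (- first_coords q) \<le> d * (real CARD('n) - real q))"
    (is "?sums \<longleftrightarrow> ?traces")
proof -
  let ?F = "first_coords q :: 'n set"
  obtain U l where U: "unitary_matrix U"
    and M: "\<And>j k. M $ j $ k = (\<Sum>p\<in>UNIV. complex_of_real (l p) * U $ j $ p * cnj (U $ k $ p))"
    using hermitian_spectral_decomposition[OF herm] by metis
  have ev: "hermitian_eigenvalues M = image_mset l (mset_set UNIV)"
    using hermitian_eigenvalues_spectral[OF U M] .
  have cF: "card ?F = q"
    using q(2) by (rule card_first_coords)
  have cF': "card (- ?F) = CARD('n) - q"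
    by (simp add: Compl_eq_Diff_UNIV card_Diff_subset cF)
  have m1: "1 \<le> m"
    using m q by auto
  show ?thesis
  proof
    assume L: ?sums
    have sums: "c * real m \<le> sum l J \<and> sum l J \<le> d * real m" if "card J = m" for J
    proof -
      have "image_mset l (mset_set J) \<subseteq># hermitian_eigenvalues M"
        unfolding ev by (intro image_mset_subseteq_mono subset_imp_msubset_mset_set) auto
      then show ?thesis
        using L that by (auto simp: sum_unfold_sum_mset)
    qed
    show ?traces
    proof (intro allI impI)
      fix A :: "complex ^ 'n::{finite,linorder} ^ 'n::{finite,linorder}" assume A: "unitary_matrix A"
      have "m \<le> card ?F"
        unfolding cF using m by simp
      note 1 = partial_trace_bounds[OF U A M m1 this sums]
      have 2: "c * (real CARD('n) - real q) \<le> partial_trace M A (- ?F) \<and>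
            partial_trace M A (- ?F) \<le> d * (real CARD('n) - real q)"
      proof (cases "q = CARD('n)")
        case True
        then have "- ?F = {}"
          using cF' by simp
        then show ?thesis
          using True by (simp add: partial_trace_def)
      next
        case False
        then have "m \<le> card (- ?F)"
          unfolding cF' using m by simp
        from partial_trace_bounds[OF U A M m1 this sums] show ?thesis
          using q by (simp add: cF' of_nat_diff)
      qed
      show "c * real q \<le> partial_trace M A ?F \<and> partial_trace M A ?F \<le> d * real q \<and>
            c * (real CARD('n) - real q) \<le> partial_trace M A (- ?F) \<and>
            partial_trace M A (- ?F) \<le> d * (real CARD('n) - real q)"
        using 1 2 by (simp add: cF)
    qed
  next
    assume R: ?traces
    show ?sums
    proof (intro allI impI, elim conjE)
      fix S assume S: "S \<subseteq># hermitian_eigenvalues M" "size S = m"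
      obtain J where J: "S = image_mset l (mset_set J)"
        using subseteq_image_mset_set[of UNIV S l] S(1) unfolding ev by auto
      have cJ: "card J = m" and sJ: "sum_mset S = sum l J"
        using S(2) by (auto simp: J sum_unfold_sum_mset)
      show "c * real m \<le> sum_mset S \<and> sum_mset S \<le> d * real m"
      proof (cases "m = q")
        case True
        then obtain A where "unitary_matrix A" "partial_trace M A ?F = sum l J"
          using partial_trace_eigenvalue_sum[OF U M, of ?F J] cF cJ by auto
        then show ?thesis
          using R True sJ by metis
      next
        case False
        then have mm: "m = CARD('n) - q"
          using m by (auto split: if_splits)
        then obtain A where "unitary_matrix A" "partial_trace M A (- ?F) = sum l J"
          using partial_trace_eigenvalue_sum[OF U M, of "- ?F" J] cF' cJ by auto
        moreover have "real m = real CARD('n) - real q"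
          using mm q by simp
        ultimately show ?thesis
          using R sJ by metis
      qed
    qed
  qed
qed

section \<open>Isometry invariance of Lebesgue measure and the mean value property\<close>

text \<open>
  This is the uniqueness argument for Haar measure. Integrate
  \<open>(x, y) \<mapsto> 1\<^sub>B(T x) 1\<^sub>F(T x + y)\<close>, with \<open>B\<close> the unit ball, in both orders. Integrating over \<open>y\<close>
  first gives \<open>\<lambda>(B) \<lambda>(F)\<close>, as \<open>T\<close> preserves \<open>B\<close>. Translating \<open>x\<close> so that \<open>y\<close> moves to the
  other factor gives \<open>\<lambda>(B)\<close> times the measure of the preimage of \<open>F\<close> under \<open>T\<close>.
\<close>

lemma lborel_distr_isometry:
  fixes T :: "'a::euclidean_space \<Rightarrow> 'a"
  assumes T: "orthogonal_transformation T"
  shows "distr lborel borel T = lborel"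
proof (rule measure_eqI)
  fix F :: "'a set" assume "F \<in> sets (distr lborel borel T)"
  then have F [measurable]: "F \<in> sets borel"
    by simp
  have lin: "linear T" and norm: "norm (T x) = norm x" for x
    using T by (auto simp: orthogonal_transformation)
  have [measurable]: "T \<in> borel_measurable borel"
    using linear_continuous_on[of T UNIV] lin by (intro borel_measurable_continuous_onI) (simp add: linear_conv_bounded_linear)
  define B where "B = ball (0::'a) 1"
  have [measurable]: "B \<in> sets borel"
    by (simp add: B_def)
  define K where "K x y = indicator B (T x) * (indicator F (T x + y) :: ennreal)" for x y
  have [measurable]: "(\<lambda>(x, y). K x y) \<in> borel_measurable (lborel \<Otimes>\<^sub>M lborel)"
    unfolding K_def by measurable
  have ball: "emeasure lborel (ball x 1) = emeasure lborel B" for x :: 'a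
  proof -
    have "emeasure lborel (ball x 1) = emeasure (distr lborel borel ((+) x)) (ball x 1)"
      by (simp add: lborel_distr_plus)
    also have "\<dots> = emeasure lborel ((+) x -` ball x 1)"
      by (subst emeasure_distr) auto
    also have "(+) x -` ball x 1 = B"
      by (auto simp: B_def dist_norm)
    finally show ?thesis .
  qed
  have "(\<integral>\<^sup>+ y. K x y \<partial>lborel) = indicator B x * emeasure lborel F" for x
  proof -
    have "(\<integral>\<^sup>+ y. K x y \<partial>lborel) = indicator B (T x) * (\<integral>\<^sup>+ y. indicator F (T x + y) \<partial>lborel)"
      unfolding K_def by (rule nn_integral_cmult) measurable
    also have "(\<integral>\<^sup>+ y. indicator F (T x + y) \<partial>lborel) = (\<integral>\<^sup>+ y. indicator F y \<partial>distr lborel borel ((+) (T x)))"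
      by (subst nn_integral_distr) auto
    also have "\<dots> = emeasure lborel F"
      by (simp add: lborel_distr_plus)
    also have "indicator B (T x) = (indicator B x :: ennreal)"
      by (simp add: B_def norm indicator_def)
    finally show ?thesis .
  qed
  then have 1: "(\<integral>\<^sup>+ x. \<integral>\<^sup>+ y. K x y \<partial>lborel \<partial>lborel) = emeasure lborel B * emeasure lborel F"
    by (simp add: nn_integral_multc)
  have "(\<integral>\<^sup>+ x. K x y \<partial>lborel) = (\<integral>\<^sup>+ x. indicator B (T x - y) * indicator F (T x) \<partial>lborel)" for y
  proof -
    obtain w where w: "T w = - y"
      using orthogonal_transformation_surj[OF T] by (metis surjD)
    have "(\<integral>\<^sup>+ x. K x y \<partial>lborel) = (\<integral>\<^sup>+ x. K x y \<partial>distr lborel borel ((+) w))"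
      by (simp add: lborel_distr_plus)
    also have "\<dots> = (\<integral>\<^sup>+ x. K (w + x) y \<partial>lborel)"
      unfolding K_def by (subst nn_integral_distr) auto
    finally show ?thesis
      by (simp add: K_def linear_add[OF lin] w)
  qed
  then have "(\<integral>\<^sup>+ y. \<integral>\<^sup>+ x. K x y \<partial>lborel \<partial>lborel)
      = (\<integral>\<^sup>+ y. \<integral>\<^sup>+ x. indicator B (T x - y) * indicator F (T x) \<partial>lborel \<partial>lborel)"
    by simp
  also have "\<dots> = (\<integral>\<^sup>+ x. \<integral>\<^sup>+ y. indicator B (T x - y) * indicator F (T x) \<partial>lborel \<partial>lborel)"
    by (rule lborel_pair.Fubini') measurable
  also have "\<dots> = (\<integral>\<^sup>+ x. emeasure lborel B * indicator F (T x) \<partial>lborel)"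
  proof (rule nn_integral_cong)
    fix x
    have "(\<lambda>y. indicator B (T x - y) * indicator F (T x)) =
        (\<lambda>y. indicator (ball (T x) 1) y * indicator F (T x) :: ennreal)"
      by (simp add: B_def indicator_def dist_norm fun_eq_iff norm_minus_commute[of "T x"])
    then show "(\<integral>\<^sup>+ y. indicator B (T x - y) * indicator F (T x) \<partial>lborel) = emeasure lborel B * indicator F (T x)"
      using nn_integral_multc[of "indicator (ball (T x) 1)" lborel "indicator F (T x)"] ball[of "T x"]
      by (simp add: borel_measurable_indicator)
  qed
  also have "\<dots> = emeasure lborel B * (\<integral>\<^sup>+ x. indicator F (T x) \<partial>lborel)"
    by (rule nn_integral_cmult) measurable
  also have "(\<integral>\<^sup>+ x. indicator F (T x) \<partial>lborel) = emeasure (distr lborel borel T) F"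
    by (subst nn_integral_indicator[symmetric]) (simp_all add: nn_integral_distr del: nn_integral_indicator)
  finally have "emeasure lborel B * emeasure lborel F = emeasure lborel B * emeasure (distr lborel borel T) F"
    using 1 lborel_pair.Fubini'[of K] by simp
  then have "emeasure lborel B = top \<or> emeasure lborel B = 0 \<or>
      emeasure lborel F = emeasure (distr lborel borel T) F"
    unfolding ennreal_mult_cancel_left by blast
  moreover have "emeasure lborel B \<noteq> 0" "emeasure lborel B \<noteq> top"
    using less_imp_neq[OF unit_ball_vol_pos[of "real DIM('a)"]] by (simp_all add: B_def emeasure_ball)
  ultimately show "emeasure (distr lborel borel T) F = emeasure lborel F"
    by (elim disjE) simp_all
qed simp

lemma circle_mean_value:
  assumes "open U" "cball 0 1 \<subseteq> U" "g holomorphic_on U"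
  shows "((\<lambda>x. g (exp (2 * of_real pi * \<i> * of_real x))) has_integral g 0) {0..1}"
proof -
  define w where "w = 2 * complex_of_real pi * \<i>"
  have w: "w \<noteq> 0"
    by (simp add: w_def)
  have circ: "circlepath 0 1 = (\<lambda>x. exp (w * of_real x))"
    by (simp add: circlepath w_def fun_eq_iff)
  have deriv: "vector_derivative (circlepath 0 1) (at x) = w * exp (w * of_real x)" for x
    by (simp add: vector_derivative_circlepath w_def)
  have "((\<lambda>u. g u / (u - 0)) has_contour_integral (2 * of_real pi * \<i> * g 0)) (circlepath 0 1)"
    using holomorphic_on_subset[OF assms(3,2)] by (intro Cauchy_integral_circlepath_simple) auto
  then have "((\<lambda>x. g (exp (w * of_real x)) / (exp (w * of_real x) - 0) * (w * exp (w * of_real x)))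
      has_integral (w * g 0)) {0..1}"
    unfolding has_contour_integral deriv w_def[symmetric] unfolding circ .
  moreover have "g (exp (w * of_real x)) / (exp (w * of_real x) - 0) * (w * exp (w * of_real x))
      = w * g (exp (w * of_real x))" for x :: real
    using exp_not_eq_zero[of "w * of_real x"] by (simp add: field_simps)
  ultimately have "((\<lambda>x. w * g (exp (w * of_real x))) has_integral (w * g 0)) {0..1}"
    by (simp only:)
  from has_integral_mult_right[OF this, of "inverse w"] show ?thesis
    using w by (simp only: w_def[symmetric] mult.assoc[symmetric] left_inverse[OF w] mult_1_left)
qed

lemma holomorphic_on_Cn_continuous:
  assumes "holomorphic_on_Cn f S"
  shows "continuous_on S f"
  using assms unfolding holomorphic_on_Cn_def
  by (meson continuous_at_imp_continuous_on has_derivative_continuous)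

lemma norm_vec_complex_smult: "norm (u *s (v :: complex ^ 'n)) = cmod u * norm v"
  by (simp add: norm_vec_def norm_mult L2_set_right_distrib)

lemma linear_smult_left: "linear (\<lambda>u. u *s (v :: complex ^ 'n))"
  by (rule linearI) (simp_all add: vec_eq_iff algebra_simps)

lemma linear_smult_right: "linear ((*s) (u :: complex) :: complex ^ 'n \<Rightarrow> complex ^ 'n)"
  by (rule linearI) (simp_all add: vec_eq_iff algebra_simps)

lemma holomorphic_on_line:
  assumes f: "holomorphic_on_Cn f S" and S: "open S"
  shows "(\<lambda>u. f (u *s z)) holomorphic_on {u. u *s z \<in> S}" "open {u. u *s z \<in> S}"
proof -
  have blin: "bounded_linear (\<lambda>u. u *s z)"
    using linear_smult_left linear_conv_bounded_linear by blast
  have "open ((\<lambda>u. u *s z) -` S)"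
    using S by (intro open_vimage) (auto intro: linear_continuous_on blin)
  then show op: "open {u. u *s z \<in> S}"
    by (simp add: vimage_def)
  show "(\<lambda>u. f (u *s z)) holomorphic_on {u. u *s z \<in> S}"
    unfolding holomorphic_on_open[OF op]
  proof safe
    fix u assume "u *s z \<in> S"
    then have "\<exists>f'. (f has_derivative f') (at (u *s z)) \<and> (\<forall>u v. f' (u *s v) = u * f' v)"
      using f by (simp add: holomorphic_on_Cn_def)
    then obtain f' where f': "(f has_derivative f') (at (u *s z))" "\<forall>u v. f' (u *s v) = u * f' v"
      by blast
    have "((\<lambda>u. f (u *s z)) has_derivative (\<lambda>h. f' (h *s z))) (at u)"
      using has_derivative_compose[OF bounded_linear_imp_has_derivative[OF blin] f'(1)] .
    moreover have "(\<lambda>h. f' (h *s z)) = (*) (f' z)"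
      by (simp add: fun_eq_iff f'(2))
    ultimately have "((\<lambda>u. f (u *s z)) has_field_derivative f' z) (at u)"
      by (simp add: has_field_derivative_def)
    then show "\<exists>d. ((\<lambda>u. f (u *s z)) has_field_derivative d) (at u)"
      by blast
  qed
qed

lemma orthogonal_transformation_smult:
  assumes "cmod u = 1"
  shows "orthogonal_transformation ((*s) u :: complex ^ 'n \<Rightarrow> complex ^ 'n)"
  using assms by (simp add: orthogonal_transformation linear_smult_right norm_vec_complex_smult)

lemma borel_measurable_isometry:
  fixes T :: "'a::euclidean_space \<Rightarrow> 'a"
  assumes "orthogonal_transformation T"
  shows "T \<in> borel_measurable borel"
  using linear_continuous_on[of T UNIV] assms
  by (intro borel_measurable_continuous_onI) (simp add: linear_conv_bounded_linear orthogonal_transformation_def)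

lemma set_integral_lborel_affine_isometry:
  fixes T :: "'a::euclidean_space \<Rightarrow> 'a" and f :: "'a \<Rightarrow> 'b::{banach, second_countable_topology}"
  assumes T: "orthogonal_transformation T"
    and S: "\<And>x. a + T x \<in> S \<longleftrightarrow> x \<in> S'"
    and f: "(\<lambda>x. indicator S x *\<^sub>R f x) \<in> borel_measurable borel"
  shows "(LINT x:S'|lborel. f (a + T x)) = (LINT x:S|lborel. f x)"
    and "set_integrable lborel S' (\<lambda>x. f (a + T x)) \<longleftrightarrow> set_integrable lborel S f"
proof -
  note [measurable] = borel_measurable_isometry[OF T]
  have "distr lborel borel (\<lambda>x. a + T x) = distr (distr lborel borel T) borel ((+) a)"
    by (subst distr_distr) (auto simp: o_def)
  then have distr: "distr lborel borel (\<lambda>x. a + T x) = lborel"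
    by (simp add: lborel_distr_isometry[OF T] lborel_distr_plus)
  have ind: "indicator S' x = (indicator S (a + T x) :: real)" for x
    using S by (simp add: indicator_def)
  show "(LINT x:S'|lborel. f (a + T x)) = (LINT x:S|lborel. f x)"
    unfolding set_lebesgue_integral_def ind
    using integral_distr[of "\<lambda>x. a + T x" lborel borel "\<lambda>x. indicator S x *\<^sub>R f x"] f
    by (simp add: distr)
  show "set_integrable lborel S' (\<lambda>x. f (a + T x)) \<longleftrightarrow> set_integrable lborel S f"
  proof -
    have "integrable (distr lborel borel (\<lambda>x. a + T x)) (\<lambda>x. indicator S x *\<^sub>R f x)
        = integrable lborel (\<lambda>x. indicator S (a + T x) *\<^sub>R f (a + T x))"
      using f by (intro integrable_distr_eq) auto
    then show ?thesis
      unfolding set_integrable_def ind by (simp only: distr)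
  qed
qed

lemma set_integral_lborel_isometry:
  fixes T :: "'a::euclidean_space \<Rightarrow> 'a" and f :: "'a \<Rightarrow> 'b::{banach, second_countable_topology}"
  assumes "orthogonal_transformation T" "\<And>x. T x \<in> S \<longleftrightarrow> x \<in> S'"
    and "(\<lambda>x. indicator S x *\<^sub>R f x) \<in> borel_measurable borel"
  shows "(LINT x:S'|lborel. f (T x)) = (LINT x:S|lborel. f x)"
    and "set_integrable lborel S' (\<lambda>x. f (T x)) \<longleftrightarrow> set_integrable lborel S f"
  using set_integral_lborel_affine_isometry[of T 0 S S' f] assms by simp_all

text \<open>
  Rotations \<open>z \<mapsto> e\<^sup>i\<^sup>t z\<close> preserve both \<open>S\<close> and Lebesgue measure, so the integral does not
  change when \<open>f\<close> is averaged over them. By the mean value property in one variable, the average of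
  \<open>f\<close> over the circle through \<open>z\<close> is \<open>f(0)\<close>.
\<close>

lemma holomorphic_mean_value_circled:
  fixes S :: "(complex ^ 'n) set"
  assumes S: "open S" and circled: "\<And>u z. cmod u \<le> 1 \<Longrightarrow> z \<in> S \<Longrightarrow> u *s z \<in> S"
    and f: "holomorphic_on_Cn f S" and int: "set_integrable lborel S f"
  shows "(LINT z:S|lborel. f z) = (LINT z:S|lborel. f 0)"
proof -
  define e where "e x = exp (2 * of_real pi * \<i> * of_real x)" for x :: real
  have norm_e: "cmod (e x) = 1" for x
    by (simp add: e_def)
  have e_cont: "continuous_on UNIV e"
    unfolding e_def by (intro continuous_intros)
  have eS: "e x *s z \<in> S \<longleftrightarrow> z \<in> S" for x z
  proof
    assume "e x *s z \<in> S"
    then have "inverse (e x) *s (e x *s z) \<in> S"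
      by (rule circled[rotated]) (simp add: norm_inverse norm_e)
    moreover have "e x \<noteq> 0"
      using norm_e[of x] by auto
    ultimately show "z \<in> S"
      by (simp add: vector_smult_assoc)
  qed (simp add: circled norm_e)
  have fcont: "continuous_on S f"
    using f by (rule holomorphic_on_Cn_continuous)
  have fmeas: "(\<lambda>z. indicator S z *\<^sub>R f z) \<in> borel_measurable borel"
    using S fcont by (intro borel_measurable_continuous_on_indicator) auto
  define F where "F x z = indicator {0..1} x *\<^sub>R indicator S z *\<^sub>R f (e x *s z)" for x z
  have orth: "orthogonal_transformation ((*s) (e x) :: complex ^ 'n \<Rightarrow> complex ^ 'n)" for x
    using norm_e by (rule orthogonal_transformation_smult)
  have nmeas: "(\<lambda>z. indicator S z *\<^sub>R norm (f z)) \<in> borel_measurable borel"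
    using measurable_compose[OF fmeas borel_measurable_norm] by simp
  have rot: "(LINT z:S|lborel. f (e x *s z)) = (LINT z:S|lborel. f z)" for x
    by (rule set_integral_lborel_isometry(1)[OF orth eS fmeas])
  have rot_int: "set_integrable lborel S (\<lambda>z. f (e x *s z))" for x
    using set_integral_lborel_isometry(2)[OF orth eS fmeas] int by blast
  have rot_norm: "(LINT z:S|lborel. norm (f (e x *s z))) = (LINT z:S|lborel. norm (f z))" for x
    by (rule set_integral_lborel_isometry(1)[OF orth eS nmeas])
  have cont: "continuous_on (UNIV \<times> S) (\<lambda>p. f (e (fst p) *s snd p))"
  proof (rule continuous_on_compose2[OF fcont])
    have "continuous_on (UNIV \<times> S) (\<lambda>p. e (fst p))"
      by (rule continuous_on_compose2[OF e_cont]) (simp_all add: continuous_on_fst continuous_on_id)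
    then show "continuous_on (UNIV \<times> S) (\<lambda>p. e (fst p) *s snd p)"
      unfolding vector_scalar_mult_def by (intro continuous_intros)
  qed (auto simp: eS)
  have "(\<lambda>p. indicator (UNIV \<times> S) p *\<^sub>R f (e (fst p) *s snd p)) \<in> borel_measurable borel"
    using borel_open[OF open_Times[OF open_UNIV S]] cont by (rule borel_measurable_continuous_on_indicator)
  then have [measurable]: "(\<lambda>p. indicator (UNIV \<times> S) p *\<^sub>R f (e (fst p) *s snd p)) \<in> borel_measurable (borel \<Otimes>\<^sub>M borel)"
    by (simp add: borel_prod)
  have Feq: "(\<lambda>(x, z). F x z) = (\<lambda>p. indicator {0..1} (fst p) *\<^sub>R (indicator (UNIV \<times> S) p *\<^sub>R f (e (fst p) *s snd p)))"
    unfolding F_def by (rule ext) (simp add: indicator_def split: prod.split)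
  have Fmeas: "(\<lambda>(x, z). F x z) \<in> borel_measurable (lborel \<Otimes>\<^sub>M lborel)"
    unfolding Feq by measurable
  have inner_z: "(LINT z|lborel. F x z) = indicator {0..1} x *\<^sub>R (LINT z:S|lborel. f z)" for x
    using rot[of x] by (simp add: F_def set_lebesgue_integral_def del: scaleR_scaleR)
  have inner_norm: "(LINT z|lborel. norm (F x z)) = indicator {0..1} x *\<^sub>R (LINT z:S|lborel. norm (f z))" for x
  proof -
    have "norm (F x z) = indicator {0..1} x *\<^sub>R (indicator S z *\<^sub>R norm (f (e x *s z)))" for z
      by (simp add: F_def)
    then show ?thesis
      using rot_norm[of x] by (simp add: set_lebesgue_integral_def del: scaleR_scaleR real_scaleR_def)
  qed
  have Fint: "integrable (lborel \<Otimes>\<^sub>M lborel) (\<lambda>(x, z). F x z)"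
  proof (rule lborel_pair.Fubini_integrable[OF Fmeas])
    show "integrable lborel (\<lambda>x. LINT z|lborel. norm (case (x, z) of (x, z) \<Rightarrow> F x z))"
      unfolding prod.case inner_norm
      by (rule integrable_scaleR_left) (simp add: integrable_real_indicator)
    show "AE x in lborel. integrable lborel (\<lambda>z. case (x, z) of (x, z) \<Rightarrow> F x z)"
      unfolding prod.case F_def
      using rot_int by (intro AE_I2 integrable_scaleR_right) (simp add: set_integrable_def)
  qed
  have inner_x: "(LINT x|lborel. F x z) = indicator S z *\<^sub>R f 0" for z
  proof (cases "z \<in> S")
    case True
    have sub: "cball 0 1 \<subseteq> {u. u *s z \<in> S}"
      using circled True by auto
    have "((\<lambda>x. f (e x *s z)) has_integral f 0) {0..1}"
      using circle_mean_value[OF holomorphic_on_line(2)[OF f S] sub holomorphic_on_line(1)[OF f S]]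
      by (simp add: e_def)
    moreover have "continuous_on {0..1} (\<lambda>x. (x :: real, z))"
      by (intro continuous_on_Pair continuous_on_id continuous_on_const)
    then have "continuous_on {0..1} (\<lambda>x. f (e x *s z))"
      using continuous_on_compose2[OF cont, of "{0..1}" "\<lambda>x. (x, z)"] True by auto
    then have "set_integrable lborel {0..1} (\<lambda>x. f (e x *s z))"
      by (rule borel_integrable_atLeastAtMost')
    ultimately have "(LINT x:{0..1}|lborel. f (e x *s z)) = f 0"
      by (simp add: set_borel_integral_eq_integral(2) integral_unique)
    then show ?thesis
      using True by (simp add: F_def set_lebesgue_integral_def)
  qed (simp add: F_def)
  have "(LINT z:S|lborel. f z) = (LINT x|lborel. LINT z|lborel. F x z)"
    unfolding inner_z by simp
  also have "\<dots> = (LINT z|lborel. LINT x|lborel. F x z)"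
    by (rule lborel_pair.Fubini_integral[OF Fint, symmetric])
  also have "\<dots> = (LINT z:S|lborel. f 0)"
    by (simp add: inner_x set_lebesgue_integral_def)
  finally show ?thesis .
qed

section \<open>Second moments of products of balls\<close>

definition coord_sq :: "'n set \<Rightarrow> complex ^ 'n \<Rightarrow> real" where
  "coord_sq I z = (\<Sum>i\<in>I. (cmod (z $ i))\<^sup>2)"

text \<open>
  This is \<^const>\<open>ball_prod\<close> for an arbitrary set of coordinates, which makes the two factors
  interchangeable.
\<close>

definition polyball :: "'n set \<Rightarrow> real \<Rightarrow> real \<Rightarrow> (complex ^ 'n) set" where
  "polyball I r s = {z. L2_set (\<lambda>i. cmod (z $ i)) I < r \<and> L2_set (\<lambda>i. cmod (z $ i)) (- I) < s}"

lemma polyball_compl: "polyball (- I) r s = polyball I s r"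
  by (auto simp: polyball_def)

lemma mem_polyball_iff:
  assumes "0 < r" "0 < s"
  shows "z \<in> polyball I r s \<longleftrightarrow> coord_sq I z < r\<^sup>2 \<and> coord_sq (- I) z < s\<^sup>2"
proof -
  have "sqrt x < t \<longleftrightarrow> x < t\<^sup>2" if "0 < t" for x t :: real
    using that real_sqrt_less_iff[of x "t\<^sup>2"] by simp
  then show ?thesis
    using assms by (simp add: polyball_def L2_set_def coord_sq_def)
qed

lemma norm_sq_coord_sq: "(norm z)\<^sup>2 = coord_sq I z + coord_sq (- I) z"
proof -
  have "(norm z)\<^sup>2 = (\<Sum>i\<in>UNIV. (cmod (z $ i))\<^sup>2)"
    by (simp add: norm_vec_def L2_set_def sum_nonneg)
  also have "\<dots> = coord_sq I z + coord_sq (UNIV - I) z"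
    unfolding coord_sq_def by (subst sum.subset_diff[of I UNIV]) auto
  finally show ?thesis
    by (simp add: Compl_eq_Diff_UNIV)
qed

lemma open_polyball: "open (polyball I r s)"
  unfolding polyball_def L2_set_def
  by (intro open_Collect_conj open_Collect_less continuous_intros)

lemma polyball_borel: "polyball I r s \<in> sets borel"
  using open_polyball by (rule borel_open)

lemma polyball_subset_ball:
  assumes "0 < r" "0 < s" "r\<^sup>2 + s\<^sup>2 < \<rho>\<^sup>2" "0 < \<rho>"
  shows "polyball I r s \<subseteq> ball 0 \<rho>"
proof
  fix z assume "z \<in> polyball I r s"
  then have "(norm z)\<^sup>2 < \<rho>\<^sup>2"
    using assms by (simp add: mem_polyball_iff norm_sq_coord_sq[of z I])
  then show "z \<in> ball 0 \<rho>"
    using assms(4) by (simp add: power2_less_imp_less)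
qed

lemma bounded_polyball:
  assumes "0 < r" "0 < s"
  shows "bounded (polyball I r s)"
proof -
  have "0 < r\<^sup>2 + s\<^sup>2"
    using assms by (simp add: pos_add_strict)
  then have "polyball I r s \<subseteq> ball 0 (1 + sqrt (r\<^sup>2 + s\<^sup>2))"
    using assms by (intro polyball_subset_ball) (simp_all add: power2_sum add_pos_nonneg)
  then show ?thesis
    using bounded_subset bounded_ball by blast
qed

lemma polyball_circled:
  assumes "cmod u \<le> 1" "z \<in> polyball I r s" "0 < r" "0 < s"
  shows "u *s z \<in> polyball I r s"
proof -
  have "coord_sq J (u *s z) \<le> coord_sq J z" for J
    unfolding coord_sq_def
    using assms(1) by (intro sum_mono power_mono) (auto simp: norm_mult mult_left_le_one_le)
  then show ?thesis
    using assms by (auto simp: mem_polyball_iff intro: le_less_trans)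
qed

lemma emeasure_polyball_finite:
  assumes "0 < r" "0 < s"
  shows "emeasure lborel (polyball I r s) < \<infinity>"
  using assms by (intro emeasure_bounded_finite bounded_polyball)

lemma measure_polyball_pos:
  fixes I :: "'n::finite set"
  assumes "0 < r" "0 < s"
  shows "0 < measure lborel (polyball I r s)"
proof -
  have "0 \<in> polyball I r s"
    using assms by (simp add: mem_polyball_iff coord_sq_def)
  then obtain e where e: "0 < e" "ball 0 e \<subseteq> polyball I r s"
    using open_polyball open_contains_ball by blast
  have "0 < measure lborel (ball (0 :: complex ^ 'n) e)"
    using e(1) content_ball_pos by simp
  also have "\<dots> \<le> measure lborel (polyball I r s)"
    using e(2) emeasure_polyball_finite[OF assms] polyball_borel
    by (intro measure_mono_fmeasurable) (auto simp: fmeasurable_def)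
  finally show ?thesis .
qed

lemma set_integrable_continuous_polyball:
  fixes f :: "complex ^ 'n \<Rightarrow> 'b::{banach, second_countable_topology}"
  assumes "continuous_on UNIV f" "0 < r" "0 < s"
  shows "set_integrable lborel (polyball I r s) f"
proof -
  have "set_integrable lborel (closure (polyball I r s)) f"
    unfolding set_integrable_def
    using assms bounded_polyball by (intro borel_integrable_compact) (auto intro: continuous_on_subset)
  then show ?thesis
    by (rule set_integrable_subset) (simp_all add: polyball_borel closure_subset)
qed

lemma orthogonal_transformation_monomial:
  fixes p :: "'n::finite \<Rightarrow> 'n" and c :: "'n \<Rightarrow> complex"
  assumes p: "bij p" and c: "\<And>i. cmod (c i) = 1"
  shows "orthogonal_transformation (\<lambda>z :: complex ^ 'n. \<chi> i. c i * z $ p i)"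
  unfolding orthogonal_transformation
proof (intro conjI allI)
  show "linear (\<lambda>z :: complex ^ 'n. \<chi> i. c i * z $ p i)"
    by (rule linearI) (simp_all add: vec_eq_iff algebra_simps)
  fix z :: "complex ^ 'n"
  have "(\<Sum>i\<in>UNIV. (cmod (z $ p i))\<^sup>2) = (\<Sum>i\<in>UNIV. (cmod (z $ i))\<^sup>2)"
    using p by (rule sum.reindex_bij_betw)
  then show "norm (\<chi> i. c i * z $ p i) = norm z"
    by (simp add: norm_vec_def L2_set_def norm_mult c)
qed

lemma polyball_monomial:
  assumes "bij_betw p I I" "bij_betw p (- I) (- I)" "\<And>i. cmod (c i) = 1" "0 < r" "0 < s"
  shows "(\<chi> i. c i * z $ p i) \<in> polyball I r s \<longleftrightarrow> z \<in> polyball I r s"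
proof -
  have "coord_sq J (\<chi> i. c i * z $ p i) = coord_sq J z" if "bij_betw p J J" for J
    unfolding coord_sq_def
    using sum.reindex_bij_betw[OF that, of "\<lambda>i. (cmod (z $ i))\<^sup>2"] by (simp add: norm_mult assms)
  then show ?thesis
    using assms by (simp add: mem_polyball_iff)
qed

text \<open>
  Changing the sign of the coordinate \<open>j\<close> is a symmetry of the set and reverses the integrand.
\<close>

lemma polyball_cross_moment:
  fixes I :: "'n::finite set"
  assumes "j \<noteq> k" "0 < r" "0 < s"
  shows "(LINT z:polyball I r s|lborel. z $ j * cnj (z $ k)) = 0"
proof -
  define c :: "'n \<Rightarrow> complex" where "c i = (if i = j then - 1 else 1)" for i
  have "(LINT z:polyball I r s|lborel. (\<chi> i. c i * z $ id i) $ j * cnj ((\<chi> i. c i * z $ id i) $ k))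
      = (LINT z:polyball I r s|lborel. z $ j * cnj (z $ k))"
  proof (rule set_integral_lborel_isometry(1))
    show "orthogonal_transformation (\<lambda>z. \<chi> i. c i * z $ id i)"
      by (rule orthogonal_transformation_monomial) (simp_all add: c_def bij_id[unfolded id_def])
    show "(\<chi> i. c i * z $ id i) \<in> polyball I r s \<longleftrightarrow> z \<in> polyball I r s" for z
      using assms by (intro polyball_monomial) (auto simp: c_def bij_betw_id[unfolded id_def])
    show "(\<lambda>z. indicator (polyball I r s) z *\<^sub>R (z $ j * cnj (z $ k))) \<in> borel_measurable borel"
      by (intro borel_measurable_continuous_on_indicator continuous_intros polyball_borel)
  qed
  then have "- (LINT z:polyball I r s|lborel. z $ j * cnj (z $ k))
      = (LINT z:polyball I r s|lborel. z $ j * cnj (z $ k))"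
    using assms(1) by (simp add: c_def set_lebesgue_integral_def)
  then show ?thesis
    by simp
qed

lemma polyball_moment_swap:
  fixes I :: "'n::finite set"
  assumes "i \<in> I" "j \<in> I" "0 < r" "0 < s"
  shows "(LINT z:polyball I r s|lborel. (cmod (z $ i))\<^sup>2) = (LINT z:polyball I r s|lborel. (cmod (z $ j))\<^sup>2)"
proof -
  define p where "p l = (if l = i then j else if l = j then i else l)" for l
  have pp: "p (p l) = l" for l
    by (simp add: p_def)
  have bij: "bij_betw p J J" if "\<And>l. l \<in> J \<Longrightarrow> p l \<in> J" for J
    by (rule bij_betw_byWitness[where f' = p]) (use that pp in auto)
  have "(LINT z:polyball I r s|lborel. (cmod ((\<chi> l. 1 * z $ p l) $ j))\<^sup>2)
      = (LINT z:polyball I r s|lborel. (cmod (z $ j))\<^sup>2)"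
  proof (rule set_integral_lborel_isometry(1))
    show "orthogonal_transformation (\<lambda>z :: complex ^ 'n. \<chi> l. 1 * z $ p l)"
      by (rule orthogonal_transformation_monomial) (auto intro: bij)
    show "(\<chi> l. 1 * z $ p l) \<in> polyball I r s \<longleftrightarrow> z \<in> polyball I r s" for z :: "complex ^ 'n"
      using assms by (intro polyball_monomial bij) (auto simp: p_def)
    show "(\<lambda>z. indicator (polyball I r s) z *\<^sub>R (cmod (z $ j))\<^sup>2) \<in> borel_measurable borel"
      by (intro borel_measurable_continuous_on_indicator continuous_intros polyball_borel)
  qed
  moreover have "p j = i"
    by (simp add: p_def)
  ultimately show ?thesis
    by simp
qed

definition dilation :: "'n set \<Rightarrow> real \<Rightarrow> complex ^ 'n \<Rightarrow> complex ^ 'n" where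
  "dilation I x z = (\<chi> i. if i \<in> I then of_real x * z $ i else z $ i)"

text \<open>
  Each complex coordinate in \<open>I\<close> is two real ones, whence the exponent.
\<close>

lemma lborel_dilation:
  fixes I :: "'n::finite set"
  assumes x: "0 < x"
  shows "lborel = density (distr lborel borel (dilation I x)) (\<lambda>_. ennreal (x ^ (2 * card I)))"
proof -
  \<comment> \<open>The factor by which the real basis vector \<open>b\<close> is stretched.\<close>
  define c :: "complex ^ 'n \<Rightarrow> real" where "c b = (if \<exists>i\<in>I. b $ i \<noteq> 0 then x else 1)" for b
  have c_axis: "c (axis i u) = (if i \<in> I then x else 1)" if "u \<noteq> 0" for i u
    using that by (auto simp: c_def axis_def)
  have Basis: "(Basis :: (complex ^ 'n) set) = (\<lambda>(i, u). axis i u) ` (UNIV \<times> {1, \<i>})"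
    by (auto simp: Basis_vec_def Basis_complex_def)
  have "(\<Prod>b\<in>(Basis :: (complex ^ 'n) set). \<bar>c b\<bar>) = (\<Prod>(i, u)\<in>UNIV \<times> {1, \<i>}. \<bar>c (axis i u)\<bar>)"
    unfolding Basis by (subst prod.reindex) (auto simp: inj_on_def axis_eq_axis case_prod_beta)
  also have "\<dots> = (\<Prod>i\<in>UNIV. \<Prod>u\<in>{1, \<i>}. \<bar>c (axis i u)\<bar>)"
    by (rule prod.cartesian_product[symmetric])
  also have "\<dots> = (\<Prod>i\<in>UNIV. if i \<in> I then x\<^sup>2 else 1)"
    using x by (intro prod.cong) (auto simp: c_axis power2_eq_square)
  also have "\<dots> = x ^ (2 * card I)"
    by (simp add: prod.If_cases power_mult)
  finally have prod: "(\<Prod>b\<in>(Basis :: (complex ^ 'n) set). \<bar>c b\<bar>) = x ^ (2 * card I)" .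
  have T: "(\<lambda>z. 0 + (\<Sum>j\<in>Basis. (c j * (z \<bullet> j)) *\<^sub>R j)) = dilation I x"
  proof (rule ext, rule euclidean_eqI)
    fix z b :: "complex ^ 'n" assume b: "b \<in> Basis"
    then obtain i u where iu: "b = axis i u" "u \<noteq> 0"
      unfolding Basis by auto
    have "(0 + (\<Sum>j\<in>Basis. (c j * (z \<bullet> j)) *\<^sub>R j)) \<bullet> b = c b * (z \<bullet> b)"
      using b by (simp add: inner_sum_left_Basis)
    also have "\<dots> = dilation I x z \<bullet> b"
      by (simp add: iu c_axis inner_axis dilation_def inner_complex_def algebra_simps)
    finally show "(0 + (\<Sum>j\<in>Basis. (c j * (z \<bullet> j)) *\<^sub>R j)) \<bullet> b = dilation I x z \<bullet> b" .
  qed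
  have "c j \<noteq> 0" for j
    using x by (simp add: c_def)
  then show ?thesis
    using lborel_affine_euclidean[of c 0] unfolding T prod by blast
qed

lemma integral_dilation:
  fixes f :: "complex ^ 'n \<Rightarrow> real"
  assumes x: "0 < x" and f: "f \<in> borel_measurable borel"
  shows "integral\<^sup>L lborel f = x ^ (2 * card I) * (LINT z|lborel. f (dilation I x z))"
proof -
  have "continuous_on UNIV (dilation I x)"
    unfolding dilation_def
  proof (intro continuous_intros)
    show "continuous_on UNIV (\<lambda>z :: complex ^ 'n. if i \<in> I then of_real x * z $ i else z $ i)" for i
      by (cases "i \<in> I") (auto intro!: continuous_intros)
  qed
  then have [measurable]: "dilation I x \<in> borel_measurable borel"
    by (rule borel_measurable_continuous_onI)
  note [measurable] = f
  have "integral\<^sup>L lborel f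
      = integral\<^sup>L (density (distr lborel borel (dilation I x)) (\<lambda>_. ennreal (x ^ (2 * card I)))) f"
    using lborel_dilation[OF x, of I] by simp
  also have "\<dots> = integral\<^sup>L (distr lborel borel (dilation I x)) (\<lambda>z. x ^ (2 * card I) *\<^sub>R f z)"
    using x by (intro integral_density) auto
  also have "\<dots> = (LINT z|lborel. x ^ (2 * card I) *\<^sub>R f (dilation I x z))"
    by (rule integral_distr) measurable
  finally show ?thesis
    by simp
qed

text \<open>
  The limit that evaluates the ratio of moment and volume of a thin shell.
\<close>

lemma power_difference_quotient_at_1:
  "((\<lambda>x::real. (x ^ n - 1) / (x - 1)) \<longlongrightarrow> real n) (at_right 1)"
proof -
  have "((\<lambda>x::real. x ^ n) has_field_derivative real n) (at 1)"
    using DERIV_pow[of n "1::real"] by simp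
  then have "((\<lambda>x::real. (x ^ n - 1) / (x - 1)) \<longlongrightarrow> real n) (at 1)"
    by (simp add: has_field_derivative_iff)
  then show ?thesis
    by (rule tendsto_mono[rotated]) (simp add: at_within_le_at)
qed

text \<open>
  Both the volume \<open>V(t)\<close> and the moment \<open>M(t)\<close>, as functions of the radius \<open>t\<close> in the coordinates
  \<open>I\<close>, are homogeneous, of degrees \<open>2k\<close> and \<open>2k + 2\<close> with \<open>k = card I\<close>. On the shell between \<open>r\<close>
  and \<open>x r\<close> the integrand lies between \<open>r\<^sup>2\<close> and \<open>x\<^sup>2 r\<^sup>2\<close>, so letting \<open>x\<close> decrease to \<open>1\<close> gives
  \<open>(2k + 2) M(r) = 2k r\<^sup>2 V(r)\<close>.
\<close>

lemma polyball_second_moment: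
  fixes I :: "'n::finite set"
  assumes r: "0 < r" and s: "0 < s"
  shows "(LINT z:polyball I r s|lborel. coord_sq I z)
       = real (card I) / (real (card I) + 1) * r\<^sup>2 * measure lborel (polyball I r s)"
proof -
  let ?k = "card I"
  define V where "V t = (LINT z:polyball I t s|lborel. 1 :: real)" for t
  define M where "M t = (LINT z:polyball I t s|lborel. coord_sq I z)" for t
  have contsq: "continuous_on UNIV (coord_sq I)"
    unfolding coord_sq_def by (intro continuous_intros)
  have intV: "set_integrable lborel (polyball I t s) (\<lambda>z. 1 :: real)"
    and intM: "set_integrable lborel (polyball I t s) (coord_sq I)" if "0 < t" for t
    using that s contsq by (auto intro!: set_integrable_continuous_polyball)
  have dil: "dilation I x z \<in> polyball I (x * r) s \<longleftrightarrow> z \<in> polyball I r s"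
    and sqdil: "coord_sq I (dilation I x z) = x\<^sup>2 * coord_sq I z" if "0 < x" for x z
  proof -
    show sq: "coord_sq I (dilation I x z) = x\<^sup>2 * coord_sq I z"
      using that by (simp add: coord_sq_def dilation_def norm_mult power_mult_distrib sum_distrib_left)
    have "coord_sq (- I) (dilation I x z) = coord_sq (- I) z"
      by (simp add: coord_sq_def dilation_def)
    then show "dilation I x z \<in> polyball I (x * r) s \<longleftrightarrow> z \<in> polyball I r s"
      using that r s by (simp add: mem_polyball_iff sq power_mult_distrib)
  qed
  have scaleV: "V (x * r) = x ^ (2 * ?k) * V r" if "0 < x" for x
  proof -
    have "V (x * r) = x ^ (2 * ?k) * (LINT z|lborel. indicator (polyball I (x * r) s) (dilation I x z) *\<^sub>R 1)"
      unfolding V_def set_lebesgue_integral_def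
      using that by (intro integral_dilation) (simp_all add: polyball_borel borel_measurable_indicator)
    also have "(\<lambda>z. indicator (polyball I (x * r) s) (dilation I x z) *\<^sub>R (1::real))
        = (\<lambda>z. indicator (polyball I r s) z *\<^sub>R 1)"
      using dil[OF that] by (simp add: indicator_def)
    finally show ?thesis
      by (simp add: V_def set_lebesgue_integral_def)
  qed
  have scaleM: "M (x * r) = x ^ (2 * ?k + 2) * M r" if "0 < x" for x
  proof -
    have "M (x * r) = x ^ (2 * ?k) *
        (LINT z|lborel. indicator (polyball I (x * r) s) (dilation I x z) *\<^sub>R coord_sq I (dilation I x z))"
      unfolding M_def set_lebesgue_integral_def
      using that polyball_borel contsq
      by (intro integral_dilation borel_measurable_continuous_on_indicator) (auto intro: continuous_on_subset)
    also have "(\<lambda>z. indicator (polyball I (x * r) s) (dilation I x z) *\<^sub>R coord_sq I (dilation I x z))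
        = (\<lambda>z. x\<^sup>2 * (indicator (polyball I r s) z *\<^sub>R coord_sq I z))"
      using dil[OF that] sqdil[OF that] by (simp add: indicator_def fun_eq_iff)
    finally show ?thesis
      by (simp add: M_def set_lebesgue_integral_def power_add power2_eq_square)
  qed
  have shell: "r\<^sup>2 * (V (x * r) - V r) \<le> M (x * r) - M r"
      "M (x * r) - M r \<le> x\<^sup>2 * r\<^sup>2 * (V (x * r) - V r)" if x: "1 < x" for x
  proof -
    have xr: "0 < x * r" "r < x * r"
      using x r by auto
    then have sub: "polyball I r s \<subseteq> polyball I (x * r) s"
      by (auto simp: polyball_def)
    define D where "D = polyball I (x * r) s - polyball I r s"
    have D: "D \<in> sets lborel" "D \<subseteq> polyball I (x * r) s"
      using polyball_borel by (auto simp: D_def)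
    have diff: "(LINT z:polyball I (x * r) s|lborel. f z) - (LINT z:polyball I r s|lborel. f z) = (LINT z:D|lborel. f z)"
      "set_integrable lborel D f"
      if f: "\<And>t. 0 < t \<Longrightarrow> set_integrable lborel (polyball I t s) f" for f :: "complex ^ 'n \<Rightarrow> real"
    proof -
      show fD: "set_integrable lborel D f"
        using f[OF xr(1)] D by (rule set_integrable_subset)
      have "(LINT z:polyball I r s \<union> D|lborel. f z) = (LINT z:polyball I r s|lborel. f z) + (LINT z:D|lborel. f z)"
        using f[OF r] fD by (intro set_integral_Un) (auto simp: D_def)
      moreover have "polyball I r s \<union> D = polyball I (x * r) s"
        using sub by (auto simp: D_def)
      ultimately show "(LINT z:polyball I (x * r) s|lborel. f z) - (LINT z:polyball I r s|lborel. f z) = (LINT z:D|lborel. f z)"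
        by simp
    qed
    have VD: "V (x * r) - V r = (LINT z:D|lborel. 1)"
      unfolding V_def by (rule diff(1)[OF intV])
    have MD: "M (x * r) - M r = (LINT z:D|lborel. coord_sq I z)"
      unfolding M_def by (rule diff(1)[OF intM])
    note iV = diff(2)[OF intV] and iM = diff(2)[OF intM]
    have on_D: "r\<^sup>2 * 1 \<le> coord_sq I z" "coord_sq I z \<le> (x\<^sup>2 * r\<^sup>2) * 1" if "z \<in> D" for z
      using that xr r s by (auto simp: D_def mem_polyball_iff power_mult_distrib)
    have "(LINT z:D|lborel. r\<^sup>2 * 1) \<le> (LINT z:D|lborel. coord_sq I z)"
      by (intro set_integral_mono iM set_integrable_mult_right impI iV on_D)
    then show "r\<^sup>2 * (V (x * r) - V r) \<le> M (x * r) - M r"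
      unfolding VD MD by (simp only: set_integral_mult_right)
    have "(LINT z:D|lborel. coord_sq I z) \<le> (LINT z:D|lborel. (x\<^sup>2 * r\<^sup>2) * 1)"
      by (intro set_integral_mono iM set_integrable_mult_right impI iV on_D)
    then show "M (x * r) - M r \<le> x\<^sup>2 * r\<^sup>2 * (V (x * r) - V r)"
      unfolding VD MD by (simp only: set_integral_mult_right)
  qed
  let ?Q = "\<lambda>n x::real. (x ^ n - 1) / (x - 1)"
  have lim2: "((\<lambda>x. M r * ?Q (2 * ?k + 2) x) \<longlongrightarrow> M r * real (2 * ?k + 2)) (at_right 1)"
    by (intro tendsto_intros power_difference_quotient_at_1)
  have "r\<^sup>2 * V r * real (2 * ?k) \<le> M r * real (2 * ?k + 2)"
  proof (rule tendsto_le[OF _ lim2])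
    show "((\<lambda>x. r\<^sup>2 * V r * ?Q (2 * ?k) x) \<longlongrightarrow> r\<^sup>2 * V r * real (2 * ?k)) (at_right 1)"
      by (intro tendsto_intros power_difference_quotient_at_1)
    have "r\<^sup>2 * V r * ?Q (2 * ?k) x \<le> M r * ?Q (2 * ?k + 2) x" if "1 < x" for x
    proof -
      have "r\<^sup>2 * V r * (x ^ (2 * ?k) - 1) \<le> M r * (x ^ (2 * ?k + 2) - 1)"
        using shell(1)[OF that] scaleV[of x] scaleM[of x] that by (simp add: algebra_simps)
      from divide_right_mono[OF this, of "x - 1"] show ?thesis
        using that by (simp only: times_divide_eq_right)
    qed
    then show "\<forall>\<^sub>F x in at_right 1. r\<^sup>2 * V r * ?Q (2 * ?k) x \<le> M r * ?Q (2 * ?k + 2) x"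
      by (auto simp: eventually_at_filter)
  qed simp
  moreover have "M r * real (2 * ?k + 2) \<le> 1\<^sup>2 * r\<^sup>2 * V r * real (2 * ?k)"
  proof (rule tendsto_le[OF _ _ lim2])
    show "((\<lambda>x. x\<^sup>2 * r\<^sup>2 * V r * ?Q (2 * ?k) x) \<longlongrightarrow> 1\<^sup>2 * r\<^sup>2 * V r * real (2 * ?k)) (at_right 1)"
      by (intro tendsto_intros power_difference_quotient_at_1)
    have "M r * ?Q (2 * ?k + 2) x \<le> x\<^sup>2 * r\<^sup>2 * V r * ?Q (2 * ?k) x" if "1 < x" for x
    proof -
      have "M r * (x ^ (2 * ?k + 2) - 1) \<le> x\<^sup>2 * r\<^sup>2 * V r * (x ^ (2 * ?k) - 1)"
        using shell(2)[OF that] scaleV[of x] scaleM[of x] that by (simp add: algebra_simps)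
      from divide_right_mono[OF this, of "x - 1"] show ?thesis
        using that by (simp only: times_divide_eq_right)
    qed
    then show "\<forall>\<^sub>F x in at_right 1. M r * ?Q (2 * ?k + 2) x \<le> x\<^sup>2 * r\<^sup>2 * V r * ?Q (2 * ?k) x"
      by (auto simp: eventually_at_filter)
  qed simp
  ultimately have "M r * (real ?k + 1) = real ?k * r\<^sup>2 * V r"
    by (simp add: algebra_simps)
  moreover have "V r = measure lborel (polyball I r s)"
    by (simp add: V_def set_lebesgue_integral_def)
  ultimately show ?thesis
    by (simp add: M_def field_simps)
qed

text \<open>
  By symmetry the coordinates in \<open>I\<close> share the total moment equally.
\<close>

lemma polyball_coordinate_moment:
  fixes I :: "'n::finite set"
  assumes "i \<in> I" "0 < r" "0 < s"
  shows "(LINT z:polyball I r s|lborel. (cmod (z $ i))\<^sup>2)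
       = r\<^sup>2 / (real (card I) + 1) * measure lborel (polyball I r s)"
proof -
  have int: "set_integrable lborel (polyball I r s) (\<lambda>z. (cmod (z $ j))\<^sup>2)" for j
    using assms by (intro set_integrable_continuous_polyball continuous_intros)
  have "(LINT z:polyball I r s|lborel. coord_sq I z) = (\<Sum>j\<in>I. LINT z:polyball I r s|lborel. (cmod (z $ j))\<^sup>2)"
    unfolding coord_sq_def set_lebesgue_integral_def scaleR_sum_right
    using int unfolding set_integrable_def by (intro Bochner_Integration.integral_sum)
  also have "\<dots> = (\<Sum>j\<in>I. LINT z:polyball I r s|lborel. (cmod (z $ i))\<^sup>2)"
    using assms by (intro sum.cong polyball_moment_swap refl)
  finally have "real (card I) * (LINT z:polyball I r s|lborel. (cmod (z $ i))\<^sup>2)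
      = real (card I) * (r\<^sup>2 / (real (card I) + 1) * measure lborel (polyball I r s))"
    using polyball_second_moment[OF assms(2,3), of I] by simp
  moreover have "card I \<noteq> 0"
    using assms(1) by (auto simp: card_eq_0_iff)
  ultimately show ?thesis
    by (simp only: mult_cancel_left of_nat_eq_0_iff) simp
qed

section \<open>Second-order expansion and the complex Hessian\<close>

definition second_deriv :: "('a::real_normed_vector \<Rightarrow> real) \<Rightarrow> 'a \<Rightarrow> 'a \<Rightarrow> 'a \<Rightarrow> real" where
  "second_deriv f x v w = frechet_derivative (\<lambda>y. frechet_derivative f (at y) w) (at x) v"

lemma Ck2_onD:
  assumes "Ck_on 2 f U"
  shows "x \<in> U \<Longrightarrow> (f has_derivative frechet_derivative f (at x)) (at x)"
    and "x \<in> U \<Longrightarrow>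
      ((\<lambda>y. frechet_derivative f (at y) w) has_derivative (\<lambda>v. second_deriv f x v w)) (at x)"
    and "continuous_on U (\<lambda>x. second_deriv f x v w)"
  using assms
  by (auto simp: numeral_2_eq_2 second_deriv_def frechet_derivative_works[symmetric])

lemma bilinear_second_deriv:
  assumes f: "Ck_on 2 f U" and U: "open U" and x: "x \<in> U"
  shows "bilinear (second_deriv f x)"
  unfolding bilinear_def
proof (intro conjI allI)
  show "linear (\<lambda>v. second_deriv f x v w)" for w
    using Ck2_onD(2)[OF f x] by (rule has_derivative_linear)
  have lin: "linear (frechet_derivative f (at y))" if "y \<in> U" for y
    using Ck2_onD(1)[OF f that] by (rule has_derivative_linear)
  note D = Ck2_onD(2)[OF f x]
  have uniq: "second_deriv f x v w = G v"
    if "(F has_derivative G) (at x)" "\<And>y. y \<in> U \<Longrightarrow> F y = frechet_derivative f (at y) w" for F G v w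
    using has_derivative_unique[OF D[of w] has_derivative_transform_within_open[OF that(1) U x that(2)]]
    by (simp add: fun_eq_iff)
  show "linear (\<lambda>w. second_deriv f x v w)" for v
  proof (rule linearI)
    fix w w' :: 'a and r :: real
    show "second_deriv f x v (w + w') = second_deriv f x v w + second_deriv f x v w'"
      by (rule uniq[OF has_derivative_add[OF D D]]) (simp add: linear_add[OF lin])
    show "second_deriv f x v (r *\<^sub>R w) = r *\<^sub>R second_deriv f x v w"
      by (rule uniq[OF has_derivative_scaleR_right[OF D]]) (simp add: linear_scale[OF lin])
  qed
qed

lemma Ck2_line_derivatives:
  assumes f: "Ck_on 2 f U" and x: "x + t *\<^sub>R v \<in> U"
  shows "((\<lambda>t. f (x + t *\<^sub>R v)) has_real_derivative frechet_derivative f (at (x + t *\<^sub>R v)) v) (at t)"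
    and "((\<lambda>t. frechet_derivative f (at (x + t *\<^sub>R v)) w) has_real_derivative
          second_deriv f (x + t *\<^sub>R v) v w) (at t)"
proof -
  have line: "((\<lambda>t. x + t *\<^sub>R v) has_derivative (\<lambda>h. h *\<^sub>R v)) (at t)"
    by (auto intro!: derivative_eq_intros)
  have chain: "((\<lambda>t. F (x + t *\<^sub>R v)) has_real_derivative F' v) (at t)"
    if F: "(F has_derivative F') (at (x + t *\<^sub>R v))" for F :: "'a \<Rightarrow> real" and F'
  proof -
    have "((\<lambda>t. F (x + t *\<^sub>R v)) has_derivative (\<lambda>h. F' (h *\<^sub>R v))) (at t)"
      using has_derivative_compose[OF line F] .
    moreover have "(\<lambda>h. F' (h *\<^sub>R v)) = (*) (F' v)"
      using linear_scale[OF has_derivative_linear[OF F]] by (simp add: fun_eq_iff)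
    ultimately show ?thesis
      by (simp add: has_field_derivative_def)
  qed
  show "((\<lambda>t. f (x + t *\<^sub>R v)) has_real_derivative frechet_derivative f (at (x + t *\<^sub>R v)) v) (at t)"
    using Ck2_onD(1)[OF f x] by (rule chain)
  show "((\<lambda>t. frechet_derivative f (at (x + t *\<^sub>R v)) w) has_real_derivative
          second_deriv f (x + t *\<^sub>R v) v w) (at t)"
    using Ck2_onD(2)[OF f x] by (rule chain)
qed

text \<open>
  The mean value theorem, applied first along \<open>v\<close> and then along \<open>w\<close>, expresses the second
  difference through a mixed second derivative at a nearby point.
\<close>

lemma second_difference_quotient_tendsto:
  assumes f: "Ck_on 2 f U" and U: "open U" and a: "a \<in> U"
  shows "((\<lambda>t. (f (a + t *\<^sub>R v + t *\<^sub>R w) - f (a + t *\<^sub>R v) - f (a + t *\<^sub>R w) + f a) / t\<^sup>2)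
          \<longlongrightarrow> second_deriv f a w v) (at_right 0)"
proof (rule tendstoI)
  fix e :: real assume e: "0 < e"
  have "isCont (\<lambda>x. second_deriv f x w v) a"
    using Ck2_onD(3)[OF f] U a continuous_on_eq_continuous_at by blast
  then obtain d1 where d1: "0 < d1" "\<And>x. dist x a < d1 \<Longrightarrow> dist (second_deriv f x w v) (second_deriv f a w v) < e"
    using e unfolding continuous_at_eps_delta by blast
  obtain d2 where d2: "0 < d2" "ball a d2 \<subseteq> U"
    using U a open_contains_ball by blast
  \<comment> \<open>Keeps the whole parallelogram spanned by \<open>t v\<close> and \<open>t w\<close> at \<open>a\<close> within \<open>min d1 d2\<close> of \<open>a\<close>.\<close>
  define d where "d = min d1 d2 / (norm v + norm w + 1)"
  have pos: "0 < norm v + norm w + 1"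
    by (simp add: add_nonneg_pos)
  have d: "0 < d"
    using d1 d2 pos by (simp add: d_def)
  have near: "dist (a + s *\<^sub>R v + u *\<^sub>R w) a < min d1 d2"
    if "0 \<le> s" "s \<le> t" "0 \<le> u" "u \<le> t" "0 < t" "t < d" for s t u
  proof -
    have "norm (s *\<^sub>R v + u *\<^sub>R w) \<le> s * norm v + u * norm w"
      using that norm_triangle_ineq[of "s *\<^sub>R v" "u *\<^sub>R w"] by simp
    also have "\<dots> \<le> t * norm v + t * norm w"
      using that by (intro add_mono mult_right_mono) auto
    also have "\<dots> < t * (norm v + norm w + 1)"
      using that by (simp add: algebra_simps)
    also have "\<dots> < min d1 d2"
      using that pos unfolding d_def by (subst (asm) pos_less_divide_eq) auto
    finally show ?thesis
      by (simp add: dist_norm add.assoc)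
  qed
  then have inU: "a + s *\<^sub>R v + u *\<^sub>R w \<in> U"
    if "0 \<le> s" "s \<le> t" "0 \<le> u" "u \<le> t" "0 < t" "t < d" for s t u
    using that d2(2) by (force simp: dist_commute)
  have "dist ((f (a + t *\<^sub>R v + t *\<^sub>R w) - f (a + t *\<^sub>R v) - f (a + t *\<^sub>R w) + f a) / t\<^sup>2)
      (second_deriv f a w v) < e" if t: "0 < t" "t < d" for t
  proof -
    define g where "g s = f ((a + t *\<^sub>R w) + s *\<^sub>R v) - f (a + s *\<^sub>R v)" for s
    define g' where "g' s = frechet_derivative f (at ((a + t *\<^sub>R w) + s *\<^sub>R v)) v
        - frechet_derivative f (at (a + s *\<^sub>R v)) v" for s
    have "(g has_real_derivative g' s) (at s)" if "0 \<le> s" "s \<le> t" for s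
      unfolding g_def g'_def
      using inU[of s t t] inU[of s t 0] that t
      by (intro DERIV_diff Ck2_line_derivatives[OF f]) (simp_all add: algebra_simps)
    from MVT2[OF t(1) this] obtain \<sigma> where \<sigma>: "0 < \<sigma>" "\<sigma> < t" "g t - g 0 = (t - 0) * g' \<sigma>"
      by blast
    have "((\<lambda>u. frechet_derivative f (at ((a + \<sigma> *\<^sub>R v) + u *\<^sub>R w)) v) has_real_derivative
        second_deriv f ((a + \<sigma> *\<^sub>R v) + u *\<^sub>R w) w v) (at u)" if "0 \<le> u" "u \<le> t" for u
      using inU[of \<sigma> t u] that t \<sigma> by (intro Ck2_line_derivatives[OF f]) simp_all
    from MVT2[OF t(1) this] obtain \<tau> where \<tau>: "0 < \<tau>" "\<tau> < t"
      "frechet_derivative f (at ((a + \<sigma> *\<^sub>R v) + t *\<^sub>R w)) v - frechet_derivative f (at ((a + \<sigma> *\<^sub>R v) + 0 *\<^sub>R w)) v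
        = (t - 0) * second_deriv f ((a + \<sigma> *\<^sub>R v) + \<tau> *\<^sub>R w) w v"
      by blast
    have "g' \<sigma> = t * second_deriv f (a + \<sigma> *\<^sub>R v + \<tau> *\<^sub>R w) w v"
      using \<tau>(3) by (simp add: g'_def ac_simps)
    then have "f (a + t *\<^sub>R v + t *\<^sub>R w) - f (a + t *\<^sub>R v) - f (a + t *\<^sub>R w) + f a
        = t * (t * second_deriv f (a + \<sigma> *\<^sub>R v + \<tau> *\<^sub>R w) w v)"
      using \<sigma>(3) by (simp add: g_def ac_simps)
    then have "(f (a + t *\<^sub>R v + t *\<^sub>R w) - f (a + t *\<^sub>R v) - f (a + t *\<^sub>R w) + f a) / t\<^sup>2
        = second_deriv f (a + \<sigma> *\<^sub>R v + \<tau> *\<^sub>R w) w v"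
      using t by (simp add: power2_eq_square)
    then show ?thesis
      using d1(2)[of "a + \<sigma> *\<^sub>R v + \<tau> *\<^sub>R w"] near[of \<sigma> t \<tau>] \<sigma> \<tau> t by simp
  qed
  then show "\<forall>\<^sub>F t in at_right 0.
      dist ((f (a + t *\<^sub>R v + t *\<^sub>R w) - f (a + t *\<^sub>R v) - f (a + t *\<^sub>R w) + f a) / t\<^sup>2)
      (second_deriv f a w v) < e"
    using d by (auto simp: eventually_at_right_field)
qed

text \<open>
  The second difference quotient is symmetric in the two directions, so its limit is too.
\<close>

lemma second_deriv_commute:
  assumes "Ck_on 2 f U" "open U" "a \<in> U"
  shows "second_deriv f a v w = second_deriv f a w v"
proof (rule tendsto_unique)
  show "((\<lambda>t. (f (a + t *\<^sub>R v + t *\<^sub>R w) - f (a + t *\<^sub>R v) - f (a + t *\<^sub>R w) + f a) / t\<^sup>2)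
          \<longlongrightarrow> second_deriv f a w v) (at_right 0)"
    using assms by (rule second_difference_quotient_tendsto)
  have "(\<lambda>t. (f (a + t *\<^sub>R w + t *\<^sub>R v) - f (a + t *\<^sub>R w) - f (a + t *\<^sub>R v) + f a) / t\<^sup>2)
      = (\<lambda>t. (f (a + t *\<^sub>R v + t *\<^sub>R w) - f (a + t *\<^sub>R v) - f (a + t *\<^sub>R w) + f a) / t\<^sup>2)"
    by (simp add: algebra_simps)
  then show "((\<lambda>t. (f (a + t *\<^sub>R v + t *\<^sub>R w) - f (a + t *\<^sub>R v) - f (a + t *\<^sub>R w) + f a) / t\<^sup>2)
          \<longlongrightarrow> second_deriv f a v w) (at_right 0)"
    using second_difference_quotient_tendsto[OF assms, of w v] by simp
qed simp

lemma bilinear_diag_bound: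
  fixes B :: "'a::euclidean_space \<Rightarrow> 'a \<Rightarrow> real"
  assumes B: "bilinear B" and le: "\<And>b b'. b \<in> Basis \<Longrightarrow> b' \<in> Basis \<Longrightarrow> \<bar>B b b'\<bar> \<le> e"
  shows "\<bar>B z z\<bar> \<le> (real DIM('a))\<^sup>2 * e * (norm z)\<^sup>2"
proof -
  have "B z z = B (\<Sum>b\<in>Basis. (z \<bullet> b) *\<^sub>R b) (\<Sum>b\<in>Basis. (z \<bullet> b) *\<^sub>R b)"
    by (simp add: euclidean_representation)
  also have "\<dots> = (\<Sum>(b, b')\<in>Basis \<times> Basis. (z \<bullet> b) * ((z \<bullet> b') * B b b'))"
    by (simp add: bilinear_sum[OF B] bilinear_lmul[OF B] bilinear_rmul[OF B] mult.left_commute)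
  also have "\<bar>\<dots>\<bar> \<le> (\<Sum>p\<in>Basis \<times> Basis. \<bar>case p of (b, b') \<Rightarrow> (z \<bullet> b) * ((z \<bullet> b') * B b b')\<bar>)"
    by (rule sum_abs)
  also have "\<dots> \<le> (\<Sum>p\<in>(Basis :: 'a set) \<times> (Basis :: 'a set). norm z * (norm z * e))"
  proof (rule sum_mono)
    fix p assume "p \<in> (Basis :: 'a set) \<times> (Basis :: 'a set)"
    then obtain b b' where b: "p = (b, b')" "b \<in> Basis" "b' \<in> Basis"
      by blast
    have "\<bar>z \<bullet> b\<bar> * (\<bar>z \<bullet> b'\<bar> * \<bar>B b b'\<bar>) \<le> norm z * (norm z * e)"
      using b le[of b b'] Basis_le_norm[of b z] Basis_le_norm[of b' z]
      by (intro mult_mono) auto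
    then show "\<bar>case p of (b, b') \<Rightarrow> (z \<bullet> b) * ((z \<bullet> b') * B b b')\<bar> \<le> norm z * (norm z * e)"
      by (simp add: b(1) abs_mult)
  qed
  also have "\<dots> = (real DIM('a))\<^sup>2 * e * (norm z)\<^sup>2"
    by (simp add: card_cartesian_product power2_eq_square)
  finally show ?thesis .
qed

text \<open>
  Lagrange's remainder is the second derivative at a nearby point; it differs little from the one at
  \<open>a\<close> because the finitely many second derivatives along basis vectors are continuous.
\<close>

lemma second_order_taylor:
  fixes f :: "'a::euclidean_space \<Rightarrow> real"
  assumes f: "Ck_on 2 f U" and U: "open U" and a: "a \<in> U" and \<eta>: "0 < \<eta>"
  obtains \<rho> where "0 < \<rho>" "ball a \<rho> \<subseteq> U"
    "\<And>z. norm z < \<rho> \<Longrightarrow>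
      \<bar>f (a + z) - f a - frechet_derivative f (at a) z - second_deriv f a z z / 2\<bar> \<le> \<eta> * (norm z)\<^sup>2"
proof -
  define e where "e = \<eta> / (real DIM('a))\<^sup>2"
  have e: "0 < e"
    using \<eta> by (simp add: e_def)
  have "\<forall>\<^sub>F x in at a. \<forall>b\<in>Basis. \<forall>b'\<in>Basis. dist (second_deriv f x b b') (second_deriv f a b b') < e"
  proof (intro eventually_ball_finite ballI finite_Basis)
    fix b b' :: 'a
    have "isCont (\<lambda>x. second_deriv f x b b') a"
      using Ck2_onD(3)[OF f] U a continuous_on_eq_continuous_at by blast
    then show "\<forall>\<^sub>F x in at a. dist (second_deriv f x b b') (second_deriv f a b b') < e"
      using e unfolding isCont_def by (rule tendstoD)
  qed
  then obtain d1 where d1: "0 < d1" and d1': "\<forall>x. x \<noteq> a \<and> dist x a < d1 \<longrightarrow>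
      (\<forall>b\<in>Basis. \<forall>b'\<in>Basis. dist (second_deriv f x b b') (second_deriv f a b b') < e)"
    unfolding eventually_at by blast
  have near_a: "\<bar>second_deriv f x b b' - second_deriv f a b b'\<bar> < e"
    if "dist x a < d1" "b \<in> Basis" "b' \<in> Basis" for x b b'
    using d1' that e by (cases "x = a") (auto simp: dist_real_def)
  obtain d2 where d2: "0 < d2" "ball a d2 \<subseteq> U"
    using U a open_contains_ball by blast
  show thesis
  proof (rule that)
    show "0 < min d1 d2" "ball a (min d1 d2) \<subseteq> U"
      using d1 d2 by auto
    fix z :: 'a assume z: "norm z < min d1 d2"
    have near: "dist (a + t *\<^sub>R z) a < min d1 d2" if "0 \<le> t" "t \<le> 1" for t
    proof -
      have "t * norm z \<le> norm z"
        using that by (simp add: mult_left_le_one_le)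
      then show ?thesis
        using z that by (simp add: dist_norm)
    qed
    have inU: "a + t *\<^sub>R z \<in> U" if "0 \<le> t" "t \<le> 1" for t
      using near[OF that] d2(2) by (auto simp: dist_commute)
    define D where "D m t = (if m = 0 then f (a + t *\<^sub>R z) else if m = 1 then frechet_derivative f (at (a + t *\<^sub>R z)) z
        else second_deriv f (a + t *\<^sub>R z) z z)" for m :: nat and t
    have "\<forall>m t. m < 2 \<and> 0 \<le> t \<and> t \<le> 1 \<longrightarrow> DERIV (D m) t :> D (Suc m) t"
    proof (intro allI impI)
      fix m :: nat and t :: real assume mt: "m < 2 \<and> 0 \<le> t \<and> t \<le> 1"
      then consider "m = 0" | "m = 1"
        by linarith
      then show "DERIV (D m) t :> D (Suc m) t"
        using Ck2_line_derivatives[OF f, OF inU[of t]] mt by cases (simp_all add: D_def[abs_def])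
    qed
    then obtain \<tau> where \<tau>: "0 < \<tau>" "\<tau> \<le> 1"
      "D 0 1 = (\<Sum>m<2. D m 0 / fact m * 1 ^ m) + D 2 \<tau> / fact 2 * 1 ^ 2"
      using Maclaurin2[of 1 D "D 0" 2] by auto
    then have eq: "f (a + z) = f a + frechet_derivative f (at a) z + second_deriv f (a + \<tau> *\<^sub>R z) z z / 2"
      by (simp add: D_def numeral_2_eq_2)
    define B where "B v w = second_deriv f (a + \<tau> *\<^sub>R z) v w - second_deriv f a v w" for v w
    have bil: "bilinear B"
      using bilinear_second_deriv[OF f U a] bilinear_second_deriv[OF f U inU[of \<tau>]] \<tau>
      unfolding B_def bilinear_def by (auto intro: linear_compose_sub)
    have "\<bar>B z z\<bar> \<le> (real DIM('a))\<^sup>2 * e * (norm z)\<^sup>2"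
      using near_a[of "a + \<tau> *\<^sub>R z"] near[of \<tau>] \<tau> by (intro bilinear_diag_bound[OF bil]) (auto simp: B_def less_imp_le)
    also have "(real DIM('a))\<^sup>2 * e = \<eta>"
      by (simp add: e_def)
    finally have "\<bar>B z z / 2\<bar> \<le> \<eta> * (norm z)\<^sup>2"
      using \<eta> by simp
    then show "\<bar>f (a + z) - f a - frechet_derivative f (at a) z - second_deriv f a z z / 2\<bar> \<le> \<eta> * (norm z)\<^sup>2"
      by (simp add: eq B_def diff_divide_distrib)
  qed
qed

definition hermitian_form :: "complex ^ 'n ^ 'n \<Rightarrow> complex ^ 'n \<Rightarrow> real" where
  "hermitian_form M z = Re (\<Sum>j\<in>UNIV. \<Sum>k\<in>UNIV. z $ j * M $ j $ k * cnj (z $ k))"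

text \<open>
  A real bilinear form \<open>B\<close> is twice the real part of the sum of a form that is linear in the first and
  antilinear in the second argument, which is this one, and a complex-bilinear form, given next. For
  the second derivative of \<open>\<phi>\<close> the matrix of the first form is the complex Hessian.
\<close>

definition sesquilinear_part :: "(complex ^ 'n \<Rightarrow> complex ^ 'n \<Rightarrow> real) \<Rightarrow> complex ^ 'n \<Rightarrow> complex ^ 'n \<Rightarrow> complex" where
  "sesquilinear_part B z w =
     Complex (B z w + B (\<i> *s z) (\<i> *s w)) (B z (\<i> *s w) - B (\<i> *s z) w) / 4"

definition complex_bilinear_part :: "(complex ^ 'n \<Rightarrow> complex ^ 'n \<Rightarrow> real) \<Rightarrow> complex ^ 'n \<Rightarrow> complex ^ 'n \<Rightarrow> complex" where
  "complex_bilinear_part B z w =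
     Complex (B z w - B (\<i> *s z) (\<i> *s w)) (- B z (\<i> *s w) - B (\<i> *s z) w) / 4"

lemma smult_ii: "\<i> *s (\<i> *s (z :: complex ^ 'n)) = - z"
  by (simp add: vector_smult_assoc vec_eq_iff)

lemma smult_complex_split:
  "(u :: complex) *s (z :: complex ^ 'n) = Re u *\<^sub>R z + Im u *\<^sub>R (\<i> *s z)"
  by (simp add: vec_eq_iff complex_eq_iff)

lemma complex_linear_if:
  fixes F :: "complex ^ 'n \<Rightarrow> complex"
  assumes "linear F" "\<And>z. F (\<i> *s z) = \<i> * F z"
  shows "F (u *s z) = u * F z"
proof -
  have "F (u *s z) = Re u *\<^sub>R F z + Im u *\<^sub>R (\<i> * F z)"
    by (subst smult_complex_split) (simp add: linear_add[OF assms(1)] linear_scale[OF assms(1)] assms(2))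
  also have "\<dots> = u * F z"
    by (simp add: complex_eq_iff)
  finally show ?thesis .
qed

lemma linear_Complex_parts:
  assumes "linear f" "linear g"
  shows "linear (\<lambda>z. Complex (f z) (g z) / 4)"
  using assms by (auto intro!: linearI simp: linear_add linear_scale complex_eq_iff add_divide_distrib)

lemma linear_smult_ii: "linear ((*s) \<i> :: complex ^ 'n \<Rightarrow> complex ^ 'n)"
  by (rule linear_smult_right)

lemma bilinear_linear:
  assumes "bilinear B"
  shows "linear (\<lambda>x. B x y)" "linear (\<lambda>y. B x y)"
  using assms by (auto simp: bilinear_def)

lemma complex_bilinear_part_bilinear:
  fixes B :: "complex ^ 'n \<Rightarrow> complex ^ 'n \<Rightarrow> real"
  assumes B: "bilinear B"
  shows "bilinear (complex_bilinear_part B)"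
    and "complex_bilinear_part B (u *s z) w = u * complex_bilinear_part B z w"
    and "complex_bilinear_part B z (u *s w) = u * complex_bilinear_part B z w"
proof -
  note lin = bilinear_linear[OF B] linear_compose[OF linear_smult_ii bilinear_linear(1)[OF B], unfolded o_def]
    linear_compose[OF linear_smult_ii bilinear_linear(2)[OF B], unfolded o_def]
  have l1: "linear (\<lambda>z. complex_bilinear_part B z w)" for w
    unfolding complex_bilinear_part_def
    by (intro linear_Complex_parts linear_compose_sub linear_compose_neg lin)
  have l2: "linear (\<lambda>w. complex_bilinear_part B z w)" for z
    unfolding complex_bilinear_part_def
    by (intro linear_Complex_parts linear_compose_sub linear_compose_neg lin)
  show "bilinear (complex_bilinear_part B)"
    unfolding bilinear_def using l1 l2 by simp
  show "complex_bilinear_part B (u *s z) w = u * complex_bilinear_part B z w"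
    by (rule complex_linear_if[OF l1])
       (simp add: complex_bilinear_part_def smult_ii complex_eq_iff linear_neg[OF lin(1)])
  show "complex_bilinear_part B z (u *s w) = u * complex_bilinear_part B z w"
    by (rule complex_linear_if[OF l2])
       (simp add: complex_bilinear_part_def smult_ii complex_eq_iff linear_neg[OF lin(2)])
qed

text \<open>
  Sesquilinearity over \<open>\<complex>\<close> reduces \<open>sesquilinear_part B\<close> to its values on the complex standard basis.
\<close>

lemma sesquilinear_part_expand:
  fixes B :: "complex ^ 'n \<Rightarrow> complex ^ 'n \<Rightarrow> real"
  assumes B: "bilinear B"
  shows "sesquilinear_part B z w =
    (\<Sum>j\<in>UNIV. \<Sum>k\<in>UNIV. z $ j * sesquilinear_part B (axis j 1) (axis k 1) * cnj (w $ k))"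
proof -
  note lin = bilinear_linear[OF B] linear_compose[OF linear_smult_ii bilinear_linear(1)[OF B], unfolded o_def]
    linear_compose[OF linear_smult_ii bilinear_linear(2)[OF B], unfolded o_def]
  let ?S = "sesquilinear_part B"
  have l1: "linear (\<lambda>z. ?S z w)" for w
    unfolding sesquilinear_part_def
    by (intro linear_Complex_parts linear_compose_sub linear_compose_add lin)
  have l2: "linear (\<lambda>w. ?S z w)" for z
    unfolding sesquilinear_part_def
    by (intro linear_Complex_parts linear_compose_sub linear_compose_add lin)
  have l2': "linear (\<lambda>w. cnj (?S z w))" for z
    using l2[of z] by (auto intro!: linearI simp: linear_add linear_scale)
  have s1: "?S (u *s z) w = u * ?S z w" for u z w
    by (rule complex_linear_if[OF l1])
       (simp add: sesquilinear_part_def smult_ii complex_eq_iff linear_neg[OF lin(1)])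
  have "cnj (?S z (u *s w)) = u * cnj (?S z w)" for u z w
    by (rule complex_linear_if[OF l2'])
       (simp add: sesquilinear_part_def smult_ii complex_eq_iff linear_neg[OF lin(2)])
  then have s2: "?S z (u *s w) = cnj u * ?S z w" for u z w
    by (metis complex_cnj_cnj complex_cnj_mult)
  have expand: "z = (\<Sum>j\<in>UNIV. z $ j *s axis j 1)" for z :: "complex ^ 'n"
    by (simp add: vec_eq_iff axis_def if_distrib[of "\<lambda>x. _ * x"] cong: if_cong)
  have "?S z w = ?S (\<Sum>j\<in>UNIV. z $ j *s axis j 1) w"
    using expand[of z] by simp
  also have "\<dots> = (\<Sum>j\<in>UNIV. z $ j * ?S (axis j 1) w)"
    by (simp add: linear_sum[OF l1] s1)
  also have "\<dots> = (\<Sum>j\<in>UNIV. z $ j * ?S (axis j 1) (\<Sum>k\<in>UNIV. w $ k *s axis k 1))"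
    using expand[of w] by simp
  also have "\<dots> = (\<Sum>j\<in>UNIV. z $ j * (\<Sum>k\<in>UNIV. cnj (w $ k) * ?S (axis j 1) (axis k 1)))"
    by (simp add: linear_sum[OF l2] s2)
  finally show ?thesis
    by (simp add: sum_distrib_left mult_ac)
qed

lemma complex_hessian_eq:
  fixes \<phi> :: "complex ^ 'n \<Rightarrow> real"
  assumes f: "Ck_on 2 \<phi> U" and U: "open U" and a: "a \<in> U"
  shows "complex_hessian \<phi> a $ j $ k = sesquilinear_part (second_deriv \<phi> a) (axis j 1) (axis k 1)"
proof -
  let ?D = "\<lambda>v y. frechet_derivative \<phi> (at y) v" and ?B = "second_deriv \<phi> a"
  have D: "frechet_derivative (\<lambda>z. complex_of_real (\<phi> z)) (at y) v = of_real (?D v y)" if "y \<in> U" for y v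
    using fun_cong[OF frechet_derivative_at[OF has_derivative_of_real[where 'a = complex, OF Ck2_onD(1)[OF f that]]], of v]
    by simp
  define F where "F y = (complex_of_real (?D (axis k 1) y) + \<i> * of_real (?D (axis k \<i>) y)) / 2" for y
  have zbar: "deriv_zbar k (\<lambda>z. complex_of_real (\<phi> z)) y = F y" if "y \<in> U" for y
    by (simp add: deriv_zbar_def F_def D[OF that])
  have "(F has_derivative (\<lambda>v. (of_real (?B v (axis k 1)) + \<i> * of_real (?B v (axis k \<i>))) / 2)) (at a)"
    unfolding F_def
    by (intro bounded_linear.has_derivative[OF bounded_linear_divide] has_derivative_add has_derivative_mult_right has_derivative_of_real Ck2_onD(2)[OF f a])
  then have "(deriv_zbar k (\<lambda>z. complex_of_real (\<phi> z)) has_derivative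
      (\<lambda>v. (of_real (?B v (axis k 1)) + \<i> * of_real (?B v (axis k \<i>))) / 2)) (at a)"
    by (rule has_derivative_transform_within_open[OF _ U a]) (simp add: zbar)
  then have 2: "frechet_derivative (deriv_zbar k (\<lambda>z. complex_of_real (\<phi> z))) (at a)
      = (\<lambda>v. (of_real (?B v (axis k 1)) + \<i> * of_real (?B v (axis k \<i>))) / 2)"
    by (rule frechet_derivative_at[symmetric])
  have ax: "\<i> *s axis l 1 = (axis l \<i> :: complex ^ 'n)" for l
    by (simp add: vec_eq_iff axis_def)
  show ?thesis
    by (simp add: complex_hessian_def deriv_z_def 2 sesquilinear_part_def ax complex_eq_iff field_simps)
qed

lemma complex_hessian_hermitian:
  fixes \<phi> :: "complex ^ 'n \<Rightarrow> real"
  assumes f: "Ck_on 2 \<phi> U" and U: "open U" and a: "a \<in> U"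
  shows "complex_hessian \<phi> a $ j $ k = cnj (complex_hessian \<phi> a $ k $ j)"
  unfolding complex_hessian_eq[OF assms] sesquilinear_part_def
  using second_deriv_commute[OF assms] by (simp add: complex_eq_iff)

text \<open>
  In the second-order Taylor polynomial, the linear term is the real part of a complex-linear
  function, and the quadratic term splits into the Levi form and the real part of a complex-bilinear
  form. The two real parts together are \<open>2 Re g\<close>.
\<close>

lemma pluriharmonic_plus_levi_expansion:
  fixes \<phi> :: "complex ^ 'n \<Rightarrow> real"
  assumes f: "Ck_on 2 \<phi> U" and U: "open U" and a: "a \<in> U"
  obtains g where "holomorphic_on_Cn g UNIV" "g 0 = 0"
    "\<And>\<eta>. 0 < \<eta> \<Longrightarrow> \<exists>\<rho>>0. ball a \<rho> \<subseteq> U \<and> (\<forall>z. norm z < \<rho> \<longrightarrow>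
      \<bar>\<phi> (a + z) - \<phi> a - 2 * Re (g z) - hermitian_form (complex_hessian \<phi> a) z\<bar> \<le> \<eta> * (norm z)\<^sup>2)"
proof -
  define L where "L = frechet_derivative \<phi> (at a)"
  define B where "B = second_deriv \<phi> a"
  have B: "bilinear B"
    unfolding B_def by (rule bilinear_second_deriv[OF assms])
  have linL: "linear L"
    unfolding L_def using Ck2_onD(1)[OF f a] by (rule has_derivative_linear)
  define h where "h z = Complex (L z) (- L (\<i> *s z)) / 4" for z
  define l where "l z = 2 * h z" for z
  define C where "C = complex_bilinear_part B"
  define g where "g z = l z + C z z / 2" for z
  have linh: "linear h"
    unfolding h_def using linear_compose[OF linear_smult_ii linL, unfolded o_def]
    by (intro linear_Complex_parts linL linear_compose_neg)
  have linl: "linear l"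
    by (rule linearI) (simp_all add: l_def linear_add[OF linh] linear_scale[OF linh] algebra_simps)
  have l_cx: "l (u *s z) = u * l z" for u z
    by (rule complex_linear_if[OF linl])
       (simp add: l_def h_def smult_ii complex_eq_iff linear_neg[OF linL])
  note C = complex_bilinear_part_bilinear[OF B, folded C_def]
  have bbC: "bounded_bilinear C"
    using C(1) by (simp add: bilinear_conv_bounded_bilinear)
  have "holomorphic_on_Cn g UNIV"
    unfolding holomorphic_on_Cn_def
  proof
    fix z :: "complex ^ 'n"
    have "(l has_derivative l) (at z)"
      using linl linear_imp_has_derivative by blast
    moreover have "((\<lambda>z. C z z) has_derivative (\<lambda>h. C z h + C h z)) (at z)"
      by (rule bounded_bilinear.FDERIV[OF bbC has_derivative_ident has_derivative_ident])
    ultimately have "(g has_derivative (\<lambda>h. l h + (C z h + C h z) / 2)) (at z)"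
      unfolding g_def by (intro has_derivative_add bounded_linear.has_derivative[OF bounded_linear_divide])
    moreover have "l (u *s v) + (C z (u *s v) + C (u *s v) z) / 2 = u * (l v + (C z v + C v z) / 2)" for u v
      by (simp add: C l_cx algebra_simps)
    ultimately show "\<exists>f'. (g has_derivative f') (at z) \<and> (\<forall>u v. f' (u *s v) = u * f' v)"
      by blast
  qed
  moreover have "g 0 = 0"
    by (simp add: g_def linear_0[OF linl] bilinear_lzero[OF C(1)])
  moreover have "\<exists>\<rho>>0. ball a \<rho> \<subseteq> U \<and> (\<forall>z. norm z < \<rho> \<longrightarrow>
      \<bar>\<phi> (a + z) - \<phi> a - 2 * Re (g z) - hermitian_form (complex_hessian \<phi> a) z\<bar> \<le> \<eta> * (norm z)\<^sup>2)"
    if \<eta>: "0 < \<eta>" for \<eta>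
  proof -
    have split: "2 * Re (g z) + hermitian_form (complex_hessian \<phi> a) z = L z + B z z / 2" for z
    proof -
      have "hermitian_form (complex_hessian \<phi> a) z = Re (sesquilinear_part B z z)"
        unfolding hermitian_form_def complex_hessian_eq[OF assms]
        unfolding B_def[symmetric] by (subst sesquilinear_part_expand[OF B, of z z]) simp
      then show ?thesis
        by (simp add: g_def l_def h_def C_def complex_bilinear_part_def sesquilinear_part_def field_simps)
    qed
    obtain \<rho> where \<rho>: "0 < \<rho>" "ball a \<rho> \<subseteq> U"
      "\<And>z. norm z < \<rho> \<Longrightarrow> \<bar>\<phi> (a + z) - \<phi> a - L z - B z z / 2\<bar> \<le> \<eta> * (norm z)\<^sup>2"
      using second_order_taylor[OF assms \<eta>] unfolding L_def B_def by blast
    have "\<bar>\<phi> (a + z) - \<phi> a - 2 * Re (g z) - hermitian_form (complex_hessian \<phi> a) z\<bar> \<le> \<eta> * (norm z)\<^sup>2"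
      if "norm z < \<rho>" for z
      using \<rho>(3)[OF that] split[of z] by (simp add: diff_diff_eq)
    then show ?thesis
      using \<rho> by blast
  qed
  ultimately show thesis
    by (rule that)
qed

section \<open>Integration over unitary images of products of balls\<close>

lemma cdot_unitary:
  assumes "unitary_matrix A"
  shows "cdot (A *v x) (A *v y) = cdot x y"
proof -
  have "cdot (A *v x) (A *v y)
      = (\<Sum>i\<in>UNIV. \<Sum>j\<in>UNIV. \<Sum>k\<in>UNIV. (x $ j * cnj (y $ k)) * (cnj (A $ i $ k) * A $ i $ j))"
    by (simp add: cdot_def matrix_vector_mult_def sum_product mult_ac)
  also have "\<dots> = (\<Sum>j\<in>UNIV. \<Sum>i\<in>UNIV. \<Sum>k\<in>UNIV. (x $ j * cnj (y $ k)) * (cnj (A $ i $ k) * A $ i $ j))"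
    by (rule sum.swap)
  also have "\<dots> = (\<Sum>j\<in>UNIV. \<Sum>k\<in>UNIV. \<Sum>i\<in>UNIV. (x $ j * cnj (y $ k)) * (cnj (A $ i $ k) * A $ i $ j))"
    by (rule sum.cong[OF refl], rule sum.swap)
  also have "\<dots> = (\<Sum>j\<in>UNIV. \<Sum>k\<in>UNIV. (x $ j * cnj (y $ k)) * (if k = j then 1 else 0))"
    by (simp only: sum_distrib_left[symmetric] unitary_matrix_columns[OF assms])
  also have "\<dots> = cdot x y"
    by (simp add: cdot_def if_distrib[of "\<lambda>u. _ * u"] cong: if_cong)
  finally show ?thesis .
qed

lemma orthogonal_transformation_unitary:
  assumes "unitary_matrix A"
  shows "orthogonal_transformation ((*v) A)"
  unfolding orthogonal_transformation_def
  using cdot_unitary[OF assms] linear_matrix_vector_mult_complex by (metis Re_cdot)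

lemma norm_unitary:
  assumes "unitary_matrix A"
  shows "norm (A *v z) = norm z"
  using orthogonal_transformation_unitary[OF assms] by (simp add: orthogonal_transformation)

text \<open>
  The coefficients of the substituted form in the coordinates of \<open>z\<close>; those with \<open>l = p\<close> are the
  summands of \<^const>\<open>partial_trace\<close>.
\<close>

lemma hermitian_form_unitary:
  "hermitian_form M (A *v z) = Re (\<Sum>l\<in>UNIV. \<Sum>p\<in>UNIV.
     (\<Sum>j\<in>UNIV. \<Sum>k\<in>UNIV. A $ j $ l * M $ j $ k * cnj (A $ k $ p)) * (z $ l * cnj (z $ p)))"
proof -
  let ?t = "\<lambda>j k l p. A $ j $ l * M $ j $ k * cnj (A $ k $ p) * (z $ l * cnj (z $ p))"
  have "(\<Sum>j\<in>UNIV. \<Sum>k\<in>UNIV. (A *v z) $ j * M $ j $ k * cnj ((A *v z) $ k))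
      = (\<Sum>j\<in>UNIV. \<Sum>k\<in>UNIV. \<Sum>l\<in>UNIV. \<Sum>p\<in>UNIV. ?t j k l p)"
  proof (intro sum.cong refl)
    fix j k
    have "(A *v z) $ j * M $ j $ k * cnj ((A *v z) $ k)
        = M $ j $ k * ((\<Sum>l\<in>UNIV. A $ j $ l * z $ l) * (\<Sum>p\<in>UNIV. cnj (A $ k $ p * z $ p)))"
      by (simp add: matrix_vector_mult_def)
    also have "\<dots> = (\<Sum>l\<in>UNIV. \<Sum>p\<in>UNIV. M $ j $ k * (A $ j $ l * z $ l * cnj (A $ k $ p * z $ p)))"
      by (simp only: sum_product) (simp only: sum_distrib_left)
    also have "\<dots> = (\<Sum>l\<in>UNIV. \<Sum>p\<in>UNIV. ?t j k l p)"
      by (simp add: mult_ac)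
    finally show "(A *v z) $ j * M $ j $ k * cnj ((A *v z) $ k) = (\<Sum>l\<in>UNIV. \<Sum>p\<in>UNIV. ?t j k l p)" .
  qed
  also have "\<dots> = (\<Sum>j\<in>UNIV. \<Sum>l\<in>UNIV. \<Sum>k\<in>UNIV. \<Sum>p\<in>UNIV. ?t j k l p)"
    by (rule sum.cong[OF refl], rule sum.swap)
  also have "\<dots> = (\<Sum>l\<in>UNIV. \<Sum>j\<in>UNIV. \<Sum>k\<in>UNIV. \<Sum>p\<in>UNIV. ?t j k l p)"
    by (rule sum.swap)
  also have "\<dots> = (\<Sum>l\<in>UNIV. \<Sum>j\<in>UNIV. \<Sum>p\<in>UNIV. \<Sum>k\<in>UNIV. ?t j k l p)"
    by (rule sum.cong[OF refl], rule sum.cong[OF refl], rule sum.swap)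
  also have "\<dots> = (\<Sum>l\<in>UNIV. \<Sum>p\<in>UNIV. \<Sum>j\<in>UNIV. \<Sum>k\<in>UNIV. ?t j k l p)"
    by (rule sum.cong[OF refl], rule sum.swap)
  finally show ?thesis
    unfolding hermitian_form_def by (simp only: sum_distrib_right)
qed

lemma continuous_on_hermitian_form: "continuous_on S (\<lambda>z. hermitian_form M (A *v z))"
  unfolding hermitian_form_unitary by (intro continuous_intros)

lemma polyball_coordinate_moment_cases:
  fixes I :: "'n::finite set"
  assumes "0 < r" "0 < s"
  shows "(LINT z:polyball I r s|lborel. (cmod (z $ i))\<^sup>2)
       = (if i \<in> I then r\<^sup>2 / (real (card I) + 1) else s\<^sup>2 / (real (card (- I)) + 1)) * measure lborel (polyball I r s)"
proof (cases "i \<in> I")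
  case False
  then have "i \<in> - I"
    by simp
  from polyball_coordinate_moment[OF this assms(2,1)] False show ?thesis
    by (simp add: polyball_compl)
qed (simp add: polyball_coordinate_moment assms)

lemma polyball_norm_sq_moment:
  fixes I :: "'n::finite set"
  assumes "0 < r" "0 < s"
  shows "(LINT z:polyball I r s|lborel. (norm z)\<^sup>2)
       = (real (card I) / (real (card I) + 1) * r\<^sup>2 + real (card (- I)) / (real (card (- I)) + 1) * s\<^sup>2)
         * measure lborel (polyball I r s)"
proof -
  have int: "set_integrable lborel (polyball I r s) (coord_sq J)" for J
    using assms unfolding coord_sq_def
    by (intro set_integrable_continuous_polyball continuous_intros)
  have "(LINT z:polyball I r s|lborel. (norm z)\<^sup>2)
      = (LINT z:polyball I r s|lborel. coord_sq I z) + (LINT z:polyball I r s|lborel. coord_sq (- I) z)"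
    unfolding norm_sq_coord_sq[of _ I] by (rule set_integral_add(2)[OF int int])
  also have "(LINT z:polyball I r s|lborel. coord_sq (- I) z)
      = real (card (- I)) / (real (card (- I)) + 1) * s\<^sup>2 * measure lborel (polyball I r s)"
    using polyball_second_moment[OF assms(2,1), of "- I"] by (simp add: polyball_compl)
  finally show ?thesis
    by (simp add: polyball_second_moment[OF assms] distrib_right)
qed

text \<open>
  Only the diagonal coefficients survive, since the mixed moments vanish.
\<close>

lemma polyball_hermitian_moment:
  fixes A M :: "complex ^ 'n ^ 'n"
  assumes "0 < r" "0 < s"
  shows "(LINT z:polyball I r s|lborel. hermitian_form M (A *v z))
       = (r\<^sup>2 / (real (card I) + 1) * partial_trace M A I
          + s\<^sup>2 / (real (card (- I)) + 1) * partial_trace M A (- I)) * measure lborel (polyball I r s)"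
proof -
  let ?P = "polyball I r s"
  define N where "N l p = (\<Sum>j\<in>UNIV. \<Sum>k\<in>UNIV. A $ j $ l * M $ j $ k * cnj (A $ k $ p))" for l p
  define v where "v l = (if l \<in> I then r\<^sup>2 / (real (card I) + 1) else s\<^sup>2 / (real (card (- I)) + 1))
      * measure lborel ?P" for l
  have int: "set_integrable lborel ?P (\<lambda>z. N l p * (z $ l * cnj (z $ p)))" for l p
    using assms by (intro set_integrable_continuous_polyball continuous_intros)
  have int': "set_integrable lborel ?P (\<lambda>z. \<Sum>l\<in>UNIV. \<Sum>p\<in>UNIV. N l p * (z $ l * cnj (z $ p)))"
    using assms by (intro set_integrable_continuous_polyball continuous_intros)
  have entry: "(LINT z:?P|lborel. N l p * (z $ l * cnj (z $ p))) = (if p = l then N l l * of_real (v l) else 0)" for l p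
  proof (cases "p = l")
    case True
    have "(LINT z:?P|lborel. z $ l * cnj (z $ l)) = (LINT z:?P|lborel. complex_of_real ((cmod (z $ l))\<^sup>2))"
      by (simp only: complex_norm_square)
    also have "\<dots> = of_real (LINT z:?P|lborel. (cmod (z $ l))\<^sup>2)"
      by (rule set_integral_complex_of_real)
    also have "\<dots> = of_real (v l)"
      unfolding v_def by (simp only: polyball_coordinate_moment_cases[OF assms])
    finally show ?thesis
      using True by simp
  next
    case False
    then show ?thesis
      using polyball_cross_moment[of l p r s I] assms by simp
  qed
  have "(LINT z:?P|lborel. hermitian_form M (A *v z))
      = Re (LINT z:?P|lborel. \<Sum>l\<in>UNIV. \<Sum>p\<in>UNIV. N l p * (z $ l * cnj (z $ p)))"
    using integral_Re[OF int'[unfolded set_integrable_def]]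
    by (simp add: hermitian_form_unitary N_def set_lebesgue_integral_def)
  also have "(LINT z:?P|lborel. \<Sum>l\<in>UNIV. \<Sum>p\<in>UNIV. N l p * (z $ l * cnj (z $ p)))
      = (\<Sum>l\<in>UNIV. \<Sum>p\<in>UNIV. LINT z:?P|lborel. N l p * (z $ l * cnj (z $ p)))"
    unfolding set_lebesgue_integral_def scaleR_sum_right
  proof (subst Bochner_Integration.integral_sum)
    note int'' = int[unfolded set_integrable_def]
    show "integrable lborel (\<lambda>z. \<Sum>p\<in>UNIV. indicator ?P z *\<^sub>R (N l p * (z $ l * cnj (z $ p))))" for l
      by (intro Bochner_Integration.integrable_sum int'')
    show "(\<Sum>l\<in>UNIV. (LINT z|lborel. (\<Sum>p\<in>UNIV. indicator ?P z *\<^sub>R (N l p * (z $ l * cnj (z $ p))))))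
        = (\<Sum>l\<in>UNIV. \<Sum>p\<in>UNIV. (LINT z|lborel. indicator ?P z *\<^sub>R (N l p * (z $ l * cnj (z $ p)))))"
      by (intro sum.cong refl Bochner_Integration.integral_sum int'')
  qed
  also have "\<dots> = (\<Sum>l\<in>UNIV. N l l * of_real (v l))"
    unfolding entry by simp
  also have "Re \<dots> = (\<Sum>l\<in>UNIV. v l * Re (N l l))"
    by (simp add: mult.commute)
  also have "\<dots> = (\<Sum>l\<in>I. v l * Re (N l l)) + (\<Sum>l\<in>-I. v l * Re (N l l))"
    using sum.subset_diff[of I UNIV "\<lambda>l. v l * Re (N l l)"] by (simp add: Compl_eq_Diff_UNIV)
  also have "(\<Sum>l\<in>I. v l * Re (N l l)) = r\<^sup>2 / (real (card I) + 1) * measure lborel ?P * partial_trace M A I"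
    by (simp add: v_def partial_trace_def N_def sum_distrib_left)
  also have "(\<Sum>l\<in>-I. v l * Re (N l l)) = s\<^sup>2 / (real (card (- I)) + 1) * measure lborel ?P * partial_trace M A (- I)"
    by (simp add: v_def partial_trace_def N_def sum_distrib_left)
  finally show ?thesis
    by (simp add: algebra_simps)
qed

lemma ball_prod_eq_polyball: "ball_prod q r s = polyball (first_coords q) r s"
  by (simp add: ball_prod_def polyball_def)

lemma unitary_inverse:
  assumes "unitary_matrix A"
  shows "conj_transpose A *v (A *v z) = z" "A *v (conj_transpose A *v z) = z"
  using assms by (simp_all add: unitary_matrix_def matrix_vector_mul_assoc)

lemma mem_translate_Pset:
  assumes "unitary_matrix A"
  shows "a + A *v w \<in> (+) a ` Pset q r s A \<longleftrightarrow> w \<in> polyball (first_coords q) r s"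
  unfolding Pset_def ball_prod_eq_polyball
  using unitary_inverse(1)[OF assms] by (auto simp: image_iff) metis

lemma translate_Pset_cases:
  assumes "z \<in> (+) a ` Pset q r s A"
  obtains w where "z = a + A *v w" "w \<in> polyball (first_coords q) r s"
  using assms unfolding Pset_def ball_prod_eq_polyball by blast

lemma open_translate_Pset:
  assumes "unitary_matrix A"
  shows "open ((+) a ` Pset q r s A)"
proof -
  have lin: "linear ((*v) (conj_transpose A))"
    by (rule linear_matrix_vector_mult_complex)
  have "Pset q r s A = (*v) (conj_transpose A) -` polyball (first_coords q) r s"
    unfolding Pset_def ball_prod_eq_polyball
    using unitary_inverse[OF assms] by (auto simp: image_iff) metis
  moreover have "open ((*v) (conj_transpose A) -` polyball (first_coords q) r s)"
    using open_polyball lin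
    by (intro open_vimage linear_continuous_on) (simp_all add: linear_conv_bounded_linear)
  ultimately show ?thesis
    by (simp add: open_translation)
qed

text \<open>
  The change of variables \<open>z = a + A w\<close> preserves Lebesgue measure because \<open>A\<close> is unitary.
\<close>

lemma set_integral_translate_Pset:
  fixes f :: "complex ^ 'n::{finite,linorder} \<Rightarrow> real"
  assumes A: "unitary_matrix A" and f: "continuous_on ((+) a ` Pset q r s A) f"
  shows "(LINT z:((+) a ` Pset q r s A)|lebesgue. f z)
       = (LINT w:polyball (first_coords q) r s|lborel. f (a + A *v w))"
    and "set_integrable lebesgue ((+) a ` Pset q r s A) f
       \<longleftrightarrow> set_integrable lborel (polyball (first_coords q) r s) (\<lambda>w. f (a + A *v w))"
proof -
  let ?X = "(+) a ` Pset q r s A"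
  have meas: "(\<lambda>z. indicator ?X z *\<^sub>R f z) \<in> borel_measurable borel"
    using borel_open[OF open_translate_Pset[OF A]] f by (rule borel_measurable_continuous_on_indicator)
  note iso = set_integral_lborel_affine_isometry[OF orthogonal_transformation_unitary[OF A]
      mem_translate_Pset[OF A] meas]
  have "(LINT z:?X|lebesgue. f z) = (LINT z:?X|lborel. f z)"
    unfolding set_lebesgue_integral_def using meas by (intro integral_completion) simp
  then show "(LINT z:?X|lebesgue. f z) = (LINT w:polyball (first_coords q) r s|lborel. f (a + A *v w))"
    by (simp only: iso(1))
  have "set_integrable lebesgue ?X f \<longleftrightarrow> set_integrable lborel ?X f"
    unfolding set_integrable_def using meas by (intro integrable_completion) simp
  then show "set_integrable lebesgue ?X f
       \<longleftrightarrow> set_integrable lborel (polyball (first_coords q) r s) (\<lambda>w. f (a + A *v w))"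
    by (simp only: iso(2))
qed

lemma measure_Pset:
  fixes A :: "complex ^ 'n::{finite,linorder} ^ 'n::{finite,linorder}"
  assumes A: "unitary_matrix A"
  shows "measure lebesgue (Pset q r s A) = measure lborel (polyball (first_coords q :: 'n set) r s)"
proof -
  have "(LINT z:((+) 0 ` Pset q r s A)|lebesgue. 1 :: real) = (LINT w:polyball (first_coords q :: 'n set) r s|lborel. 1)"
    by (rule set_integral_translate_Pset(1)[OF A]) simp
  then show ?thesis
    by (simp add: set_lebesgue_integral_def)
qed

section \<open>Holomorphic functions under products, exponentials and affine maps\<close>

lemma holomorphic_on_Cn_mult:
  assumes "holomorphic_on_Cn f S" "holomorphic_on_Cn g S"
  shows "holomorphic_on_Cn (\<lambda>z. f z * g z) S"
  unfolding holomorphic_on_Cn_def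
proof
  fix z assume z: "z \<in> S"
  obtain f' where f': "(f has_derivative f') (at z)" "\<forall>u v. f' (u *s v) = u * f' v"
    using assms(1) z unfolding holomorphic_on_Cn_def by blast
  obtain g' where g': "(g has_derivative g') (at z)" "\<forall>u v. g' (u *s v) = u * g' v"
    using assms(2) z unfolding holomorphic_on_Cn_def by blast
  have "((\<lambda>z. f z * g z) has_derivative (\<lambda>h. f z * g' h + f' h * g z)) (at z)"
    by (rule has_derivative_mult[OF f'(1) g'(1)])
  moreover have "f z * g' (u *s v) + f' (u *s v) * g z = u * (f z * g' v + f' v * g z)" for u v
    by (simp add: f' g' algebra_simps)
  ultimately show "\<exists>D. ((\<lambda>z. f z * g z) has_derivative D) (at z) \<and> (\<forall>u v. D (u *s v) = u * D v)"
    by blast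
qed

lemma holomorphic_on_Cn_const_mult_exp:
  assumes "holomorphic_on_Cn g S"
  shows "holomorphic_on_Cn (\<lambda>z. c * exp (b * g z)) S"
  unfolding holomorphic_on_Cn_def
proof
  fix z assume "z \<in> S"
  then obtain g' where g': "(g has_derivative g') (at z)" "\<forall>u v. g' (u *s v) = u * g' v"
    using assms unfolding holomorphic_on_Cn_def by blast
  have "((\<lambda>y. c * exp (b * y)) has_field_derivative c * (b * exp (b * g z))) (at (g z))"
    by (auto intro!: derivative_eq_intros)
  then have "((\<lambda>y. c * exp (b * y)) has_derivative (*) (c * (b * exp (b * g z)))) (at (g z))"
    by (simp add: has_field_derivative_def)
  from has_derivative_compose[OF g'(1) this]
  have "((\<lambda>z. c * exp (b * g z)) has_derivative (\<lambda>h. c * (b * exp (b * g z)) * g' h)) (at z)" .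
  moreover have "c * (b * exp (b * g z)) * g' (u *s v) = u * (c * (b * exp (b * g z)) * g' v)" for u v
    by (simp add: g')
  ultimately show "\<exists>D. ((\<lambda>z. c * exp (b * g z)) has_derivative D) (at z) \<and> (\<forall>u v. D (u *s v) = u * D v)"
    by blast
qed

lemma holomorphic_on_Cn_affine:
  assumes f: "holomorphic_on_Cn f S" and T: "\<And>w. w \<in> S' \<Longrightarrow> b + A *v w \<in> S"
  shows "holomorphic_on_Cn (\<lambda>w. f (b + A *v w)) S'"
  unfolding holomorphic_on_Cn_def
proof
  fix w assume "w \<in> S'"
  then obtain f' where f': "(f has_derivative f') (at (b + A *v w))" "\<forall>u v. f' (u *s v) = u * f' v"
    using f T unfolding holomorphic_on_Cn_def by blast
  have "((*v) A has_derivative (*v) A) (at w)"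
    using linear_matrix_vector_mult_complex linear_imp_has_derivative by blast
  then have "((\<lambda>w. b + A *v w) has_derivative (\<lambda>h. A *v h)) (at w)"
    by (auto intro!: derivative_eq_intros)
  from has_derivative_compose[OF this f'(1)]
  have "((\<lambda>w. f (b + A *v w)) has_derivative (\<lambda>h. f' (A *v h))) (at w)" .
  moreover have "f' (A *v (u *s v)) = u * f' (A *v v)" for u v
    by (simp add: f' vector_scalar_commute)
  ultimately show "\<exists>D. ((\<lambda>w. f (b + A *v w)) has_derivative D) (at w) \<and> (\<forall>u v. D (u *s v) = u * D v)"
    by blast
qed

section \<open>Bounds for the extension index\<close>

lemma exp_le_quadratic:
  fixes x :: real
  assumes "\<bar>x\<bar> \<le> 1"
  shows "exp x \<le> 1 + x + x\<^sup>2"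
proof (cases "0 \<le> x")
  case True
  then show ?thesis
    using exp_bound[of x] assms by simp
next
  case False
  define y where "y = - x"
  have y: "0 \<le> y"
    using False by (simp add: y_def)
  \<comment> \<open>For negative \<open>x = - y\<close> the claim is that \<open>(1 - y + y\<^sup>2) e\<^sup>y \<ge> 1\<close>, which the quadratic lower bound
    for \<open>e\<^sup>y\<close> gives.\<close>
  have pos: "0 < 1 - y + y\<^sup>2"
  proof -
    have "1 - y + y\<^sup>2 = (1 / 2 - y)\<^sup>2 + 3 / 4"
      by (simp add: power2_eq_square algebra_simps)
    then show ?thesis
      by (simp add: add_nonneg_pos)
  qed
  have "1 \<le> (1 - y + y\<^sup>2) * (1 + y + y\<^sup>2 / 2)"
  proof -
    have "(1 - y + y\<^sup>2) * (1 + y + y\<^sup>2 / 2) = 1 + (y\<^sup>2 / 2 + y ^ 3 / 2 + y ^ 4 / 2)"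
      by (simp add: power2_eq_square power3_eq_cube power4_eq_xxxx field_simps)
    then show ?thesis
      using y by simp
  qed
  also have "\<dots> \<le> (1 - y + y\<^sup>2) * exp y"
    using exp_lower_Taylor_quadratic[OF y] pos by (intro mult_left_mono) auto
  finally have "exp (- y) \<le> 1 - y + y\<^sup>2"
    by (simp add: exp_minus field_simps)
  then show ?thesis
    by (simp add: y_def)
qed

text \<open>
  With \<open>f = \<sigma> e\<^sup>-\<^sup>g / \<xi>\<close> the weighted norm of \<open>\<sigma>\<close> becomes that of \<open>f\<close> with weight \<open>e\<^sup>-\<^sup>\<psi>\<close>, and the
  constraint becomes \<open>f(0) = 1\<close>. The upper bound is the value at \<open>f = 1\<close>. For the lower bound,
  completing the square gives \<open>|f|\<^sup>2 e\<^sup>-\<^sup>\<psi> \<ge> 2 Re f - e\<^sup>\<psi>\<close>, and the mean of \<open>f\<close> is \<open>f(0) = 1\<close>.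
\<close>

lemma ext_index_bounds:
  fixes \<phi> :: "complex ^ 'n::{finite,linorder} \<Rightarrow> real"
    and A :: "complex ^ 'n::{finite,linorder} ^ 'n::{finite,linorder}"
  assumes \<phi>: "continuous_on ((+) a ` Pset q r s A) \<phi>"
    and g: "holomorphic_on_Cn g UNIV" and g0: "g 0 = 0"
    and A: "unitary_matrix A" and rs: "0 < r" "0 < s" and \<xi>: "\<xi> \<noteq> 0"
    and \<psi>: "\<And>w. \<psi> w = \<phi> (a + A *v w) - \<phi> a - 2 * Re (g (A *v w))"
    and \<psi>_le: "\<And>w. w \<in> polyball (first_coords q) r s \<Longrightarrow> \<bar>\<psi> w\<bar> \<le> 1"
  shows "ereal (2 - (LINT w:polyball (first_coords q) r s|lborel. exp (\<psi> w)) / measure lborel (polyball (first_coords q :: 'n set) r s))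
          \<le> ext_index q \<phi> \<xi> a r s A"
    and "ext_index q \<phi> \<xi> a r s A
          \<le> ereal ((LINT w:polyball (first_coords q) r s|lborel. exp (- \<psi> w)) / measure lborel (polyball (first_coords q :: 'n set) r s))"
proof -
  let ?X = "(+) a ` Pset q r s A"
  let ?P = "polyball (first_coords q :: 'n set) r s"
  define V where "V = measure lborel ?P"
  have V: "0 < V"
    unfolding V_def using rs by (rule measure_polyball_pos)
  have gcont: "continuous_on S g" for S
    using holomorphic_on_Cn_continuous[OF g] continuous_on_subset by blast
  have Acont: "continuous_on S ((*v) A)" for S
    using linear_matrix_vector_mult_complex[of A] by (simp add: linear_continuous_on linear_conv_bounded_linear)
  have \<psi>cont: "continuous_on ?P \<psi>"
  proof -
    have "continuous_on ?P (\<lambda>w. \<phi> (a + A *v w))"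
      using mem_translate_Pset[OF A, of a _ q r s]
      by (intro continuous_on_compose2[OF \<phi>] continuous_intros Acont) auto
    moreover have "continuous_on ?P (\<lambda>w. g (A *v w))"
      by (rule continuous_on_compose2[OF gcont Acont]) auto
    ultimately show ?thesis
      unfolding \<psi>[abs_def] by (intro continuous_intros)
  qed
  have int_one: "set_integrable lborel ?P (\<lambda>w. 1 :: real)"
    using rs by (intro set_integrable_continuous_polyball continuous_intros)
  have int_dom: "set_integrable lborel ?P f"
    if "continuous_on ?P f" "\<And>w. w \<in> ?P \<Longrightarrow> norm (f w) \<le> h w" "set_integrable lborel ?P h"
    for f :: "_ \<Rightarrow> 'b::{banach, second_countable_topology}" and h :: "_ \<Rightarrow> real"
  proof (rule set_integrable_bound[OF that(3)])
    show "set_borel_measurable lborel ?P f"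
      unfolding set_borel_measurable_def
      using borel_measurable_continuous_on_indicator[OF polyball_borel that(1)] by simp
    show "AE w in lborel. w \<in> ?P \<longrightarrow> norm (f w) \<le> norm (h w)"
      using order_trans[OF that(2) abs_ge_self] by (intro AE_I2 impI) simp
  qed
  have int_exp: "set_integrable lborel ?P (\<lambda>w. exp (b * \<psi> w))" if "\<bar>b\<bar> = 1" for b
  proof (rule int_dom)
    show "continuous_on ?P (\<lambda>w. exp (b * \<psi> w))"
      using \<psi>cont by (intro continuous_intros)
    show "set_integrable lborel ?P (\<lambda>w. exp 1 * (1 :: real))"
      using int_one by (rule set_integrable_mult_right)
    show "norm (exp (b * \<psi> w)) \<le> exp 1 * 1" if "w \<in> ?P" for w
      using \<psi>_le[OF that] \<open>\<bar>b\<bar> = 1\<close> abs_le_D1[of "b * \<psi> w" 1] by (simp add: abs_mult)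
  qed
  have weight: "(cmod (\<sigma> (a + A *v w)))\<^sup>2 * exp (- \<phi> (a + A *v w))
      = (cmod \<xi>)\<^sup>2 * exp (- \<phi> a) * ((cmod (1 / \<xi> * exp (- 1 * g (A *v w)) * \<sigma> (a + A *v w)))\<^sup>2 * exp (- \<psi> w))"
    for \<sigma> :: "_ \<Rightarrow> complex" and w
  proof -
    have "- \<phi> (a + A *v w) = - \<phi> a + (2 * Re (- g (A *v w)) + (- \<psi> w))"
      by (simp add: \<psi>)
    then have "exp (- \<phi> (a + A *v w)) = exp (- \<phi> a) * ((exp (Re (- g (A *v w))))\<^sup>2 * exp (- \<psi> w))"
      by (simp only: exp_add exp_double)
    then show ?thesis
      using \<xi> by (simp add: norm_mult norm_divide power_mult_distrib power_divide)
  qed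
  have index: "(LINT z:?X|lebesgue. (cmod (\<sigma> z))\<^sup>2 * exp (- \<phi> z)) / (measure lebesgue (Pset q r s A) * (cmod \<xi>)\<^sup>2 * exp (- \<phi> a))
      = (LINT w:?P|lborel. (cmod (1 / \<xi> * exp (- 1 * g (A *v w)) * \<sigma> (a + A *v w)))\<^sup>2 * exp (- \<psi> w)) / V"
    and index_int: "set_integrable lebesgue ?X (\<lambda>z. (cmod (\<sigma> z))\<^sup>2 * exp (- \<phi> z)) \<longleftrightarrow>
      set_integrable lborel ?P (\<lambda>w. (cmod (1 / \<xi> * exp (- 1 * g (A *v w)) * \<sigma> (a + A *v w)))\<^sup>2 * exp (- \<psi> w))"
    if "holomorphic_on_Cn \<sigma> ?X" for \<sigma>
  proof -
    have cont: "continuous_on ?X (\<lambda>z. (cmod (\<sigma> z))\<^sup>2 * exp (- \<phi> z))"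
      using holomorphic_on_Cn_continuous[OF that] \<phi> by (intro continuous_intros)
    have c: "(cmod \<xi>)\<^sup>2 * exp (- \<phi> a) \<noteq> 0"
      using \<xi> by simp
    show "(LINT z:?X|lebesgue. (cmod (\<sigma> z))\<^sup>2 * exp (- \<phi> z)) / (measure lebesgue (Pset q r s A) * (cmod \<xi>)\<^sup>2 * exp (- \<phi> a))
      = (LINT w:?P|lborel. (cmod (1 / \<xi> * exp (- 1 * g (A *v w)) * \<sigma> (a + A *v w)))\<^sup>2 * exp (- \<psi> w)) / V"
      unfolding set_integral_translate_Pset(1)[OF A cont] weight measure_Pset[OF A] V_def
        set_integral_mult_right mult.assoc[of "measure _ _"]
      using c by (simp add: field_simps)
    show "set_integrable lebesgue ?X (\<lambda>z. (cmod (\<sigma> z))\<^sup>2 * exp (- \<phi> z)) \<longleftrightarrow>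
      set_integrable lborel ?P (\<lambda>w. (cmod (1 / \<xi> * exp (- 1 * g (A *v w)) * \<sigma> (a + A *v w)))\<^sup>2 * exp (- \<psi> w))"
      unfolding set_integral_translate_Pset(2)[OF A cont] weight
      using c by (subst set_integrable_mult_right_iff) simp_all
  qed
  show "ext_index q \<phi> \<xi> a r s A \<le> ereal ((LINT w:?P|lborel. exp (- \<psi> w)) / measure lborel ?P)"
  proof -
    \<comment> \<open>The section corresponding to \<open>f = 1\<close>.\<close>
    define \<sigma> where "\<sigma> z = \<xi> * exp (1 * g (- a + mat 1 *v z))" for z
    have "holomorphic_on_Cn (\<lambda>z. g (- a + mat 1 *v z)) ?X"
      by (rule holomorphic_on_Cn_affine[OF g]) simp
    then have hol: "holomorphic_on_Cn \<sigma> ?X"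
      unfolding \<sigma>_def by (rule holomorphic_on_Cn_const_mult_exp)
    have one: "1 / \<xi> * exp (- 1 * g (A *v w)) * \<sigma> (a + A *v w) = 1" for w
      using \<xi> by (simp add: \<sigma>_def flip: exp_add)
    have "\<sigma> a = \<xi>"
      by (simp add: \<sigma>_def g0)
    moreover have "set_integrable lebesgue ?X (\<lambda>z. (cmod (\<sigma> z))\<^sup>2 * exp (- \<phi> z))"
      unfolding index_int[OF hol] one using int_exp[of "- 1"] by simp
    ultimately have "ext_index q \<phi> \<xi> a r s A \<le> ereal ((LINT z:?X|lebesgue. (cmod (\<sigma> z))\<^sup>2 * exp (- \<phi> z)) /
        (measure lebesgue (Pset q r s A) * (cmod \<xi>)\<^sup>2 * exp (- \<phi> a)))"
      unfolding ext_index_def using hol by (intro INF_lower) simp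
    then show ?thesis
      unfolding index[OF hol] one V_def by simp
  qed
  show "ereal (2 - (LINT w:?P|lborel. exp (\<psi> w)) / measure lborel ?P) \<le> ext_index q \<phi> \<xi> a r s A"
    unfolding ext_index_def
  proof (rule INF_greatest, clarify)
    fix \<sigma>
    assume hol: "holomorphic_on_Cn \<sigma> ?X" and \<sigma>int: "set_integrable lebesgue ?X (\<lambda>z. (cmod (\<sigma> z))\<^sup>2 * exp (- \<phi> z))"
      and \<xi>': "\<xi> = \<sigma> a"
    define f where "f w = 1 / \<xi> * exp (- 1 * g (A *v w)) * \<sigma> (a + A *v w)" for w
    have fhol: "holomorphic_on_Cn f ?P"
    proof -
      have "holomorphic_on_Cn (\<lambda>w. g (0 + A *v w)) ?P"
        by (rule holomorphic_on_Cn_affine[OF g]) simp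
      moreover have "holomorphic_on_Cn (\<lambda>w. \<sigma> (a + A *v w)) ?P"
        using mem_translate_Pset[OF A] by (intro holomorphic_on_Cn_affine[OF hol]) simp
      ultimately show ?thesis
        unfolding f_def using holomorphic_on_Cn_const_mult_exp holomorphic_on_Cn_mult by fastforce
    qed
    have f0: "f 0 = 1"
      using \<xi> by (simp add: f_def g0 \<xi>')
    have fint2: "set_integrable lborel ?P (\<lambda>w. (cmod (f w))\<^sup>2 * exp (- \<psi> w))"
      using \<sigma>int unfolding index_int[OF hol] f_def .
    have fcont: "continuous_on ?P f"
      using fhol by (rule holomorphic_on_Cn_continuous)
    have fint: "set_integrable lborel ?P f"
    proof (rule int_dom[OF fcont])
      show "set_integrable lborel ?P (\<lambda>w. 1 + exp 1 * ((cmod (f w))\<^sup>2 * exp (- \<psi> w)))"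
        by (intro set_integral_add(1) int_one set_integrable_mult_right impI fint2)
      fix w assume "w \<in> ?P"
      then have "1 \<le> exp (1 + (- \<psi> w))"
        using \<psi>_le[of w] by simp
      then have "(cmod (f w))\<^sup>2 * 1 \<le> (cmod (f w))\<^sup>2 * (exp 1 * exp (- \<psi> w))"
        unfolding exp_add[symmetric] by (intro mult_left_mono) auto
      moreover have "cmod (f w) \<le> 1 + (cmod (f w))\<^sup>2"
        using zero_le_power2[of "cmod (f w) - 1 / 2"] by (simp add: power2_eq_square algebra_simps)
      ultimately show "norm (f w) \<le> 1 + exp 1 * ((cmod (f w))\<^sup>2 * exp (- \<psi> w))"
        by (simp add: mult_ac)
    qed
    have mean: "(LINT w:?P|lborel. Re (f w)) = V"
    proof -
      have "(LINT w:?P|lborel. f w) = (LINT w:?P|lborel. f 0)"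
        by (rule holomorphic_mean_value_circled[OF open_polyball _ fhol fint]) (use polyball_circled rs in blast)
      also have "\<dots> = (LINT w:?P|lborel. complex_of_real 1)"
        by (simp add: f0)
      also have "\<dots> = of_real V"
        unfolding set_integral_complex_of_real by (simp add: set_lebesgue_integral_def V_def)
      finally have "Re (LINT w:?P|lborel. f w) = V"
        by simp
      then show ?thesis
        using integral_Re[OF fint[unfolded set_integrable_def]] by (simp add: set_lebesgue_integral_def)
    qed
    have Reint: "set_integrable lborel ?P (\<lambda>w. Re (f w))"
      using integrable_Re[OF fint[unfolded set_integrable_def]] by (simp add: set_integrable_def)
    have "2 * V - (LINT w:?P|lborel. exp (\<psi> w)) = (LINT w:?P|lborel. 2 * Re (f w) - exp (1 * \<psi> w))"
      using set_integral_diff(2)[OF set_integrable_mult_right[OF Reint, of 2] int_exp[of 1]] by (simp add: mean)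
    also have "\<dots> \<le> (LINT w:?P|lborel. (cmod (f w))\<^sup>2 * exp (- \<psi> w))"
    proof (rule set_integral_mono)
      show "set_integrable lborel ?P (\<lambda>w. 2 * Re (f w) - exp (1 * \<psi> w))"
        by (intro set_integral_diff(1) set_integrable_mult_right impI Reint int_exp) simp
      show "2 * Re (f w) - exp (1 * \<psi> w) \<le> (cmod (f w))\<^sup>2 * exp (- \<psi> w)" for w
      proof -
        define y where "y = exp (\<psi> w)"
        have y: "0 < y"
          by (simp add: y_def)
        have "Re (f w) * y \<le> cmod (f w) * y"
          using y by (intro mult_right_mono complex_Re_le_cmod) simp
        then have "2 * Re (f w) * y - y\<^sup>2 \<le> (cmod (f w))\<^sup>2"
          using zero_le_power2[of "cmod (f w) - y"] by (simp only: power2_diff)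
        then have "2 * Re (f w) - y \<le> (cmod (f w))\<^sup>2 / y"
          using y by (simp add: field_simps power2_eq_square)
        then show ?thesis
          by (simp add: y_def exp_minus divide_inverse)
      qed
    qed (rule fint2)
    finally have "(2 * V - (LINT w:?P|lborel. exp (\<psi> w))) / V \<le> (LINT w:?P|lborel. (cmod (f w))\<^sup>2 * exp (- \<psi> w)) / V"
      using V by (intro divide_right_mono) auto
    then have "2 - (LINT w:?P|lborel. exp (\<psi> w)) / V \<le> (LINT w:?P|lborel. (cmod (f w))\<^sup>2 * exp (- \<psi> w)) / V"
      using V by (simp add: diff_divide_distrib)
    then show "ereal (2 - (LINT w:?P|lborel. exp (\<psi> w)) / measure lborel ?P)
        \<le> ereal ((LINT z:?X|lebesgue. (cmod (\<sigma> z))\<^sup>2 * exp (- \<phi> z)) /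
          (measure lebesgue (Pset q r s A) * (cmod (\<sigma> a))\<^sup>2 * exp (- \<phi> a)))"
      using index[OF hol] unfolding f_def[symmetric] \<xi>'[symmetric] V_def by simp
  qed
qed

lemma hermitian_form_bound:
  fixes M :: "complex ^ 'n ^ 'n"
  shows "\<bar>hermitian_form M z\<bar> \<le> (\<Sum>j\<in>UNIV. \<Sum>k\<in>UNIV. cmod (M $ j $ k)) * (norm z)\<^sup>2"
proof -
  have "\<bar>hermitian_form M z\<bar> \<le> cmod (\<Sum>j\<in>UNIV. \<Sum>k\<in>UNIV. z $ j * M $ j $ k * cnj (z $ k))"
    unfolding hermitian_form_def by (rule abs_Re_le_cmod)
  also have "\<dots> \<le> (\<Sum>j\<in>UNIV. \<Sum>k\<in>UNIV. cmod (M $ j $ k) * (norm z)\<^sup>2)"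
  proof (intro order_trans[OF norm_sum] sum_mono)
    fix j k
    have "cmod (z $ j) * cmod (z $ k) \<le> norm z * norm z"
      by (intro mult_mono Finite_Cartesian_Product.norm_nth_le) auto
    then have "cmod (M $ j $ k) * (cmod (z $ j) * cmod (z $ k)) \<le> cmod (M $ j $ k) * (norm z * norm z)"
      by (intro mult_left_mono) auto
    then show "cmod (z $ j * M $ j $ k * cnj (z $ k)) \<le> cmod (M $ j $ k) * (norm z)\<^sup>2"
      by (simp add: norm_mult power2_eq_square mult_ac)
  qed
  finally show ?thesis
    by (simp add: sum_distrib_right)
qed

lemma pdiam_sq:
  assumes "q \<le> n"
  shows "(pdiam n q r s)\<^sup>2 = real q / (real q + 1) * r\<^sup>2 + (real n - real q) / (real n - real q + 1) * s\<^sup>2"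
  using assms unfolding pdiam_def by (intro real_sqrt_pow2 add_nonneg_nonneg mult_nonneg_nonneg) auto

text \<open>
  For unitary \<open>A\<close>, the mean of the form with matrix \<open>M\<close> over \<^term>\<open>Pset q r s A\<close>, by
  \<open>polyball_hermitian_moment\<close>.
\<close>

definition mean_levi ::
    "complex ^ 'n::{finite,linorder} ^ 'n::{finite,linorder} \<Rightarrow> nat \<Rightarrow> real \<Rightarrow> real
      \<Rightarrow> complex ^ 'n::{finite,linorder} ^ 'n::{finite,linorder} \<Rightarrow> real" where
  "mean_levi M q r s A = r\<^sup>2 / (real q + 1) * partial_trace M A (first_coords q)
     + s\<^sup>2 / (real CARD('n) - real q + 1) * partial_trace M A (- first_coords q)"

text \<open>
  On a small ball \<open>\<psi>\<close> differs from the Levi form by at most \<open>\<eta>|w|\<^sup>2 / 2\<close>, and \<open>\<psi>\<^sup>2\<close>, being of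
  fourth order, is bounded by the same quantity. Thus \<open>e\<^sup>\<psi>\<close> and \<open>e\<^sup>-\<^sup>\<psi>\<close> are at most one plus or minus
  the Levi form, plus \<open>\<eta>|w|\<^sup>2\<close>; taking means turns the error into \<open>\<eta>\<close> times the square of
  \<^const>\<open>pdiam\<close>, with the same \<open>\<eta>\<close> for all \<open>A\<close>.
\<close>

lemma ext_index_asymptotics:
  fixes \<phi> :: "complex ^ 'n::{finite,linorder} \<Rightarrow> real"
  assumes C2: "Ck_on 2 \<phi> U" and cont: "continuous_on U \<phi>" and U: "open U" and a: "a \<in> U"
    and q: "q \<le> CARD('n)" and \<xi>: "\<xi> \<noteq> 0" and \<eta>: "0 < \<eta>"
  obtains \<rho> where "0 < \<rho>" "ball a \<rho> \<subseteq> U"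
    "\<And>r s A. \<lbrakk>0 < r; 0 < s; r\<^sup>2 + s\<^sup>2 < \<rho>\<^sup>2; unitary_matrix A\<rbrakk> \<Longrightarrow>
      ereal (1 - mean_levi (complex_hessian \<phi> a) q r s A - \<eta> * (pdiam CARD('n) q r s)\<^sup>2) \<le> ext_index q \<phi> \<xi> a r s A \<and>
      ext_index q \<phi> \<xi> a r s A \<le> ereal (1 - mean_levi (complex_hessian \<phi> a) q r s A + \<eta> * (pdiam CARD('n) q r s)\<^sup>2)"
proof -
  define M where "M = complex_hessian \<phi> a"
  define e where "e = \<eta> / 2"
  have e: "0 < e"
    using \<eta> by (simp add: e_def)
  obtain g where g: "holomorphic_on_Cn g UNIV" "g 0 = 0"
    and g_exp: "\<And>\<eta>. 0 < \<eta> \<Longrightarrow> \<exists>\<rho>>0. ball a \<rho> \<subseteq> U \<and> (\<forall>z. norm z < \<rho> \<longrightarrow>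
      \<bar>\<phi> (a + z) - \<phi> a - 2 * Re (g z) - hermitian_form M z\<bar> \<le> \<eta> * (norm z)\<^sup>2)"
    using pluriharmonic_plus_levi_expansion[OF C2 U a] unfolding M_def by blast
  obtain \<rho>1 where \<rho>1: "0 < \<rho>1" "ball a \<rho>1 \<subseteq> U"
    "\<And>z. norm z < \<rho>1 \<Longrightarrow> \<bar>\<phi> (a + z) - \<phi> a - 2 * Re (g z) - hermitian_form M z\<bar> \<le> e * (norm z)\<^sup>2"
    using g_exp[OF e] by blast
  define K where "K = (\<Sum>j\<in>UNIV. \<Sum>k\<in>UNIV. cmod (M $ j $ k)) + e"
  have K: "0 < K"
    unfolding K_def using e by (intro add_nonneg_pos sum_nonneg) auto
  \<comment> \<open>With \<open>|\<psi> w| \<le> K |w|\<^sup>2\<close>, this radius ensures both \<open>|\<psi> w| \<le> 1\<close> and \<open>(\<psi> w)\<^sup>2 \<le> e |w|\<^sup>2\<close>.\<close>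
  define \<rho> where "\<rho> = min \<rho>1 (sqrt (min 1 e) / (K + 1))"
  have \<rho>: "0 < \<rho>"
    using \<rho>1 e K by (simp add: \<rho>_def)
  have K\<rho>: "K * \<rho>\<^sup>2 \<le> 1" "(K * \<rho>)\<^sup>2 \<le> e"
  proof -
    have "\<rho> * (K + 1) \<le> sqrt (min 1 e)"
      using K by (simp add: \<rho>_def flip: pos_le_divide_eq)
    then have "(\<rho> * (K + 1))\<^sup>2 \<le> (sqrt (min 1 e))\<^sup>2"
      using K \<rho> by (intro power_mono) auto
    then have le: "(\<rho> * (K + 1))\<^sup>2 \<le> 1" "(\<rho> * (K + 1))\<^sup>2 \<le> e"
      using e by auto
    have "(\<rho> * K)\<^sup>2 \<le> (\<rho> * (K + 1))\<^sup>2"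
      using K \<rho> by (intro power_mono) auto
    then show "(K * \<rho>)\<^sup>2 \<le> e"
      using le by (simp add: mult.commute)
    have "K * 1 \<le> (K + 1) * (K + 1)"
      using K by (intro mult_mono) auto
    then have "K * \<rho>\<^sup>2 \<le> ((K + 1) * (K + 1)) * \<rho>\<^sup>2"
      by (intro mult_right_mono) auto
    also have "\<dots> = (\<rho> * (K + 1))\<^sup>2"
      by (simp add: power2_eq_square mult_ac)
    finally show "K * \<rho>\<^sup>2 \<le> 1"
      using le by simp
  qed
  show thesis
  proof (rule that[OF \<rho>])
    show "ball a \<rho> \<subseteq> U"
      using \<rho>1(2) by (auto simp: \<rho>_def)
    fix r s :: real and A :: "complex ^ 'n::{finite,linorder} ^ 'n::{finite,linorder}"
    assume r: "0 < r" and s: "0 < s" and rs: "r\<^sup>2 + s\<^sup>2 < \<rho>\<^sup>2" and A: "unitary_matrix A"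
    let ?F = "first_coords q :: 'n set"
    let ?P = "polyball ?F r s"
    define V where "V = measure lborel ?P"
    have V: "0 < V"
      unfolding V_def using r s by (rule measure_polyball_pos)
    define \<psi> where "\<psi> w = \<phi> (a + A *v w) - \<phi> a - 2 * Re (g (A *v w))" for w
    have small: "norm (A *v w) < \<rho>" if "w \<in> ?P" for w
      using polyball_subset_ball[OF r s rs \<rho>] that norm_unitary[OF A] by fastforce
    have \<psi>_approx: "\<bar>\<psi> w - hermitian_form M (A *v w)\<bar> \<le> e * (norm w)\<^sup>2" if "w \<in> ?P" for w
      using \<rho>1(3)[of "A *v w"] small[OF that] norm_unitary[OF A] by (simp add: \<psi>_def \<rho>_def)
    have \<psi>_K: "\<bar>\<psi> w\<bar> \<le> K * (norm w)\<^sup>2" if "w \<in> ?P" for w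
      using \<psi>_approx[OF that] hermitian_form_bound[of M "A *v w"] norm_unitary[OF A]
      by (simp add: K_def distrib_right)
    have norm_sq: "(norm w)\<^sup>2 \<le> \<rho>\<^sup>2" if "w \<in> ?P" for w
      using small[OF that] norm_unitary[OF A] by (intro power_mono) auto
    have \<psi>_le1: "\<bar>\<psi> w\<bar> \<le> 1" if "w \<in> ?P" for w
      using \<psi>_K[OF that] mult_left_mono[OF norm_sq[OF that], of K] K K\<rho>(1) by linarith
    have \<psi>_sq: "(\<psi> w)\<^sup>2 \<le> e * (norm w)\<^sup>2" if "w \<in> ?P" for w
    proof -
      have "(\<psi> w)\<^sup>2 = \<bar>\<psi> w\<bar>\<^sup>2"
        by simp
      also have "\<dots> \<le> (K * (norm w)\<^sup>2)\<^sup>2"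
        using \<psi>_K[OF that] by (intro power_mono) auto
      also have "\<dots> = (K\<^sup>2 * (norm w)\<^sup>2) * (norm w)\<^sup>2"
        by (simp add: power2_eq_square mult_ac)
      also have "\<dots> \<le> (K\<^sup>2 * \<rho>\<^sup>2) * (norm w)\<^sup>2"
        using norm_sq[OF that] by (intro mult_right_mono mult_left_mono) auto
      also have "\<dots> \<le> e * (norm w)\<^sup>2"
        using K\<rho>(2) by (intro mult_right_mono) (auto simp: power_mult_distrib)
      finally show ?thesis .
    qed
    have sub: "(+) a ` Pset q r s A \<subseteq> U"
    proof
      fix z assume "z \<in> (+) a ` Pset q r s A"
      then obtain w where "z = a + A *v w" "w \<in> ?P"
        by (rule translate_Pset_cases)
      then show "z \<in> U"
        using small[of w] \<rho>1(2) by (auto simp: \<rho>_def dist_norm)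
    qed
    have bounds: "ereal (2 - (LINT w:?P|lborel. exp (\<psi> w)) / V) \<le> ext_index q \<phi> \<xi> a r s A"
      "ext_index q \<phi> \<xi> a r s A \<le> ereal ((LINT w:?P|lborel. exp (- \<psi> w)) / V)"
      unfolding V_def
      by (rule ext_index_bounds[OF continuous_on_subset[OF cont sub] g A r s \<xi> \<psi>_def \<psi>_le1]; assumption)+
    have cF: "card ?F = q" "real (card (- ?F)) = real CARD('n) - real q"
      using card_first_coords[OF q] q by (simp_all add: Compl_eq_Diff_UNIV card_Diff_subset of_nat_diff)
    define h where "h = mean_levi M q r s A"
    define D where "D = (pdiam CARD('n) q r s)\<^sup>2"
    have int1: "set_integrable lborel ?P (\<lambda>w. 1 :: real)"
      and intH: "set_integrable lborel ?P (\<lambda>w. b * hermitian_form M (A *v w))"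
      and intN: "set_integrable lborel ?P (\<lambda>w. 2 * e * (norm w)\<^sup>2)" for b
      using r s by (auto intro!: set_integrable_continuous_polyball continuous_intros continuous_on_hermitian_form)
    have quad: "(LINT w:?P|lborel. 1 + b * hermitian_form M (A *v w) + 2 * e * (norm w)\<^sup>2)
        = V * (1 + b * h + 2 * e * D)" for b
    proof -
      have "(LINT w:?P|lborel. 1 + b * hermitian_form M (A *v w) + 2 * e * (norm w)\<^sup>2)
          = (LINT w:?P|lborel. 1) + (LINT w:?P|lborel. b * hermitian_form M (A *v w)) + (LINT w:?P|lborel. 2 * e * (norm w)\<^sup>2)"
        by (simp only: set_integral_add int1 intH intN)
      also have "(LINT w:?P|lborel. 1) = V"
        by (simp add: set_lebesgue_integral_def V_def)
      also have "(LINT w:?P|lborel. b * hermitian_form M (A *v w)) = b * (h * V)"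
        by (simp only: set_integral_mult_right polyball_hermitian_moment[OF r s] cF h_def mean_levi_def V_def)
      also have "(LINT w:?P|lborel. 2 * e * (norm w)\<^sup>2) = 2 * e * (D * V)"
        by (simp only: set_integral_mult_right polyball_norm_sq_moment[OF r s] cF D_def pdiam_sq[OF q] V_def)
      finally show ?thesis
        by (simp add: algebra_simps)
    qed
    have mean_exp: "(LINT w:?P|lborel. exp (b * \<psi> w)) / V \<le> 1 + b * h + \<eta> * D" if b: "b = 1 \<or> b = - 1" for b
    proof -
      have "(LINT w:?P|lborel. exp (b * \<psi> w)) \<le> (LINT w:?P|lborel. 1 + b * hermitian_form M (A *v w) + 2 * e * (norm w)\<^sup>2)"
        unfolding set_lebesgue_integral_def
      proof (rule integral_mono')
        have le: "exp (b * \<psi> w) \<le> 1 + b * hermitian_form M (A *v w) + 2 * e * (norm w)\<^sup>2" if "w \<in> ?P" for w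
          using exp_le_quadratic[of "b * \<psi> w"] \<psi>_le1[OF that] \<psi>_sq[OF that] \<psi>_approx[OF that] b
          by auto
        show "integrable lborel (\<lambda>w. indicator ?P w *\<^sub>R (1 + b * hermitian_form M (A *v w) + 2 * e * (norm w)\<^sup>2))"
          unfolding set_integrable_def[symmetric] by (intro set_integral_add(1) int1 intH intN)
        show "indicator ?P w *\<^sub>R exp (b * \<psi> w)
            \<le> indicator ?P w *\<^sub>R (1 + b * hermitian_form M (A *v w) + 2 * e * (norm w)\<^sup>2)" for w
          using le by (auto simp: indicator_def)
        show "0 \<le> indicator ?P w *\<^sub>R (1 + b * hermitian_form M (A *v w) + 2 * e * (norm w)\<^sup>2)" for w
          using order_trans[OF exp_ge_zero le] by (auto simp: indicator_def)
      qed
      then have "(LINT w:?P|lborel. exp (b * \<psi> w)) \<le> V * (1 + b * h + \<eta> * D)"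
        unfolding quad by (simp add: e_def)
      then show ?thesis
        using V by (simp add: pos_divide_le_eq mult.commute)
    qed
    have "1 - h - \<eta> * D \<le> 2 - (LINT w:?P|lborel. exp (\<psi> w)) / V"
      "(LINT w:?P|lborel. exp (- \<psi> w)) / V \<le> 1 - h + \<eta> * D"
      using mean_exp[of 1] mean_exp[of "- 1"] by simp_all
    then show "ereal (1 - mean_levi (complex_hessian \<phi> a) q r s A - \<eta> * (pdiam CARD('n) q r s)\<^sup>2) \<le> ext_index q \<phi> \<xi> a r s A \<and>
      ext_index q \<phi> \<xi> a r s A \<le> ereal (1 - mean_levi (complex_hessian \<phi> a) q r s A + \<eta> * (pdiam CARD('n) q r s)\<^sup>2)"
      using bounds unfolding h_def D_def M_def by (meson ereal_less_eq(3) order_trans)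
  qed
qed

text \<open>
  Letting one of the two radii shrink to zero isolates the coefficient of the other.
\<close>

lemma quadratic_form_nonpos:
  fixes x y :: real
  assumes "\<And>r s. 0 < r \<Longrightarrow> 0 < s \<Longrightarrow> r\<^sup>2 * x + s\<^sup>2 * y \<le> 0"
  shows "x \<le> 0" "y \<le> 0"
proof -
  have lim: "((\<lambda>t. u + t\<^sup>2 * v) \<longlongrightarrow> u) (at_right 0)" for u v :: real
    by (auto intro!: tendsto_eq_intros)
  show "x \<le> 0"
    using assms[of 1] by (intro tendsto_upperbound[OF lim[of x y]]) (auto simp: eventually_at_filter)
  show "y \<le> 0"
    using assms[of _ 1] by (intro tendsto_upperbound[OF lim[of y x]]) (auto simp: eventually_at_filter add.commute)
qed

section \<open>The theorem\<close>

theorem theorem3p3: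
  fixes \<Omega> :: "(complex ^ 'n::{finite,linorder}) set"
    and \<phi> :: "complex ^ 'n::{finite,linorder} \<Rightarrow> real"
    and q m :: nat
    and c d :: real
    and a :: "complex ^ 'n::{finite,linorder}"
    and \<xi> :: complex
  assumes "CARD('n) \<ge> 2"
    and "open \<Omega>" and "connected \<Omega>"
    and "smooth_on \<phi> \<Omega>"
    and "1 \<le> q" and "q \<le> CARD('n)"
    and "c \<le> d"
    and "a \<in> \<Omega>"
    and "\<xi> \<noteq> 0"
    and "m = (if q = CARD('n) then CARD('n) else min q (CARD('n) - q))"
  shows "(\<forall>S. S \<subseteq># hermitian_eigenvalues (complex_hessian \<phi> a) \<and> size S = m \<longrightarrow>
            c * real m \<le> sum_mset S \<and> sum_mset S \<le> d * real m)
         \<longleftrightarrow>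
         (\<forall>\<epsilon>>0. \<exists>\<rho>>0. ball a \<rho> \<subseteq> \<Omega> \<and>
            (\<forall>r s. \<forall>A.
               r > 0 \<and> s > 0 \<and> r\<^sup>2 + s\<^sup>2 < \<rho>\<^sup>2 \<and> unitary_matrix A \<longrightarrow>
                 ereal (1 - (d + \<epsilon>) * (pdiam CARD('n) q r s)\<^sup>2) \<le> ext_index q \<phi> \<xi> a r s A \<and>
                 ext_index q \<phi> \<xi> a r s A \<le> ereal (1 - (c - \<epsilon>) * (pdiam CARD('n) q r s)\<^sup>2)))"
proof -
  define M where "M = complex_hessian \<phi> a"
  define D where "D r s = (pdiam CARD('n) q r s)\<^sup>2" for r s
  let ?F = "first_coords q :: 'n set"
  let ?n = "real CARD('n)"
  have C2: "Ck_on 2 \<phi> \<Omega>" and cont: "continuous_on \<Omega> \<phi>"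
    using assms(4) Ck_on.simps(1)[of \<phi> \<Omega>] unfolding smooth_on_def by blast+
  note q = assms(5,6)
  have D_eq: "D r s = real q / (real q + 1) * r\<^sup>2 + (?n - real q) / (?n - real q + 1) * s\<^sup>2" for r s
    unfolding D_def by (rule pdiam_sq[OF q(2)])
  have D_nonneg: "0 \<le> D r s" for r s
    by (simp add: D_def)
  have scale: "D (t * r) (t * s) = t\<^sup>2 * D r s" "mean_levi M q (t * r) (t * s) A = t\<^sup>2 * mean_levi M q r s A"
    for t r s A
    by (simp_all add: D_eq mean_levi_def power_mult_distrib algebra_simps)
  have den: "0 < real q + 1" "0 < ?n - real q + 1"
    using q(2) by simp_all
  have diff: "mean_levi M q r s A - b * D r s
      = r\<^sup>2 * ((partial_trace M A ?F - b * real q) / (real q + 1))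
        + s\<^sup>2 * ((partial_trace M A (- ?F) - b * (?n - real q)) / (?n - real q + 1))" for r s A b
    unfolding D_eq mean_levi_def by (simp add: diff_divide_distrib add_divide_distrib algebra_simps)
  have traces: "(\<forall>r>0. \<forall>s>0. c * D r s \<le> mean_levi M q r s A \<and> mean_levi M q r s A \<le> d * D r s) \<longleftrightarrow>
      c * real q \<le> partial_trace M A ?F \<and> partial_trace M A ?F \<le> d * real q \<and>
      c * (?n - real q) \<le> partial_trace M A (- ?F) \<and> partial_trace M A (- ?F) \<le> d * (?n - real q)"
    (is "?L \<longleftrightarrow> ?R") for A
  proof
    assume L: ?L
    have "r\<^sup>2 * ((partial_trace M A ?F - d * real q) / (real q + 1))
        + s\<^sup>2 * ((partial_trace M A (- ?F) - d * (?n - real q)) / (?n - real q + 1)) \<le> 0"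
      if "0 < r" "0 < s" for r s
      unfolding diff[symmetric] using L that by simp
    note up = quadratic_form_nonpos[OF this]
    have "r\<^sup>2 * (- ((partial_trace M A ?F - c * real q) / (real q + 1)))
        + s\<^sup>2 * (- ((partial_trace M A (- ?F) - c * (?n - real q)) / (?n - real q + 1))) \<le> 0"
      if "0 < r" "0 < s" for r s
      unfolding mult_minus_right minus_add_distrib[symmetric] diff[symmetric] using L that by simp
    note low = quadratic_form_nonpos[OF this]
    show ?R
      using up low den by (simp add: divide_le_0_iff zero_le_divide_iff)
  next
    assume R: ?R
    show ?L
    proof (intro allI impI conjI)
      fix r s :: real
      have "0 \<le> mean_levi M q r s A - c * D r s"
        unfolding diff using R den by (intro add_nonneg_nonneg mult_nonneg_nonneg divide_nonneg_pos) auto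
      then show "c * D r s \<le> mean_levi M q r s A"
        by simp
      have "mean_levi M q r s A - d * D r s \<le> 0"
        unfolding diff using R den
        by (intro add_nonpos_nonpos mult_nonneg_nonpos divide_nonpos_pos) auto
      then show "mean_levi M q r s A \<le> d * D r s"
        by simp
    qed
  qed
  have index_iff: "(\<forall>\<epsilon>>0. \<exists>\<rho>>0. ball a \<rho> \<subseteq> \<Omega> \<and> (\<forall>r s A. r > 0 \<and> s > 0 \<and> r\<^sup>2 + s\<^sup>2 < \<rho>\<^sup>2 \<and> unitary_matrix A \<longrightarrow>
        ereal (1 - (d + \<epsilon>) * D r s) \<le> ext_index q \<phi> \<xi> a r s A \<and> ext_index q \<phi> \<xi> a r s A \<le> ereal (1 - (c - \<epsilon>) * D r s)))
    \<longleftrightarrow> (\<forall>A. unitary_matrix A \<longrightarrow>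
        (\<forall>r>0. \<forall>s>0. c * D r s \<le> mean_levi M q r s A \<and> mean_levi M q r s A \<le> d * D r s))"
    (is "?L \<longleftrightarrow> ?R")
  proof
    assume R: ?R
    show ?L
    proof (intro allI impI)
      fix \<epsilon> :: real assume "0 < \<epsilon>"
      then obtain \<rho> where \<rho>: "0 < \<rho>" "ball a \<rho> \<subseteq> \<Omega>"
        "\<And>r s A. \<lbrakk>0 < r; 0 < s; r\<^sup>2 + s\<^sup>2 < \<rho>\<^sup>2; unitary_matrix A\<rbrakk> \<Longrightarrow>
          ereal (1 - mean_levi M q r s A - \<epsilon> * D r s) \<le> ext_index q \<phi> \<xi> a r s A \<and>
          ext_index q \<phi> \<xi> a r s A \<le> ereal (1 - mean_levi M q r s A + \<epsilon> * D r s)"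
        using ext_index_asymptotics[OF C2 cont assms(2,8) q(2) assms(9)] unfolding M_def D_def by metis
      show "\<exists>\<rho>>0. ball a \<rho> \<subseteq> \<Omega> \<and> (\<forall>r s A. r > 0 \<and> s > 0 \<and> r\<^sup>2 + s\<^sup>2 < \<rho>\<^sup>2 \<and> unitary_matrix A \<longrightarrow>
        ereal (1 - (d + \<epsilon>) * D r s) \<le> ext_index q \<phi> \<xi> a r s A \<and> ext_index q \<phi> \<xi> a r s A \<le> ereal (1 - (c - \<epsilon>) * D r s))"
      proof (intro exI conjI allI impI)
        fix r s :: real and A :: "complex ^ 'n::{finite,linorder} ^ 'n::{finite,linorder}"
        assume *: "r > 0 \<and> s > 0 \<and> r\<^sup>2 + s\<^sup>2 < \<rho>\<^sup>2 \<and> unitary_matrix A"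
        then have m: "c * D r s \<le> mean_levi M q r s A" "mean_levi M q r s A \<le> d * D r s"
          using R by blast+
        have "ereal (1 - (d + \<epsilon>) * D r s) \<le> ereal (1 - mean_levi M q r s A - \<epsilon> * D r s)"
          using m by (simp add: algebra_simps)
        then show "ereal (1 - (d + \<epsilon>) * D r s) \<le> ext_index q \<phi> \<xi> a r s A"
          using \<rho>(3)[of r s A] * order_trans by blast
        have "ereal (1 - mean_levi M q r s A + \<epsilon> * D r s) \<le> ereal (1 - (c - \<epsilon>) * D r s)"
          using m by (simp add: algebra_simps)
        then show "ext_index q \<phi> \<xi> a r s A \<le> ereal (1 - (c - \<epsilon>) * D r s)"
          using \<rho>(3)[of r s A] * order_trans by blast
      qed (use \<rho> in auto)
    qed
  next
    assume L: ?L
    \<comment> \<open>Shrinking the radii by a common factor brings them below any \<open>\<rho>\<close>, and the resulting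
      inequality is homogeneous, so it holds for the original radii.\<close>
    have near: "mean_levi M q r s A \<le> (d + 2 * \<epsilon>) * D r s \<and> (c - 2 * \<epsilon>) * D r s \<le> mean_levi M q r s A"
      if A: "unitary_matrix A" and r: "0 < r" and s: "0 < s" and \<epsilon>: "0 < \<epsilon>" for A r s \<epsilon>
    proof -
      obtain \<rho>1 where \<rho>1: "0 < \<rho>1" "\<And>r s A. r > 0 \<and> s > 0 \<and> r\<^sup>2 + s\<^sup>2 < \<rho>1\<^sup>2 \<and> unitary_matrix A \<Longrightarrow>
        ereal (1 - (d + \<epsilon>) * D r s) \<le> ext_index q \<phi> \<xi> a r s A \<and> ext_index q \<phi> \<xi> a r s A \<le> ereal (1 - (c - \<epsilon>) * D r s)"
        using L \<epsilon> by blast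
      obtain \<rho>2 where \<rho>2: "0 < \<rho>2"
        "\<And>r s A. \<lbrakk>0 < r; 0 < s; r\<^sup>2 + s\<^sup>2 < \<rho>2\<^sup>2; unitary_matrix A\<rbrakk> \<Longrightarrow>
          ereal (1 - mean_levi M q r s A - \<epsilon> * D r s) \<le> ext_index q \<phi> \<xi> a r s A \<and>
          ext_index q \<phi> \<xi> a r s A \<le> ereal (1 - mean_levi M q r s A + \<epsilon> * D r s)"
        using ext_index_asymptotics[OF C2 cont assms(2,8) q(2) assms(9) \<epsilon>] unfolding M_def D_def by metis
      define t where "t = min \<rho>1 \<rho>2 / (r + s + 1)"
      have t: "0 < t"
        using \<rho>1(1) \<rho>2(1) r s by (simp add: t_def)
      have tr: "0 < t * r" "0 < t * s"
        using t r s by simp_all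
      have "(t * r)\<^sup>2 + (t * s)\<^sup>2 < (t * (r + s + 1))\<^sup>2"
        using t r s by (simp add: power_mult_distrib power2_eq_square algebra_simps add_pos_pos)
      also have "t * (r + s + 1) = min \<rho>1 \<rho>2"
        using r s by (simp add: t_def)
      finally have ts: "(t * r)\<^sup>2 + (t * s)\<^sup>2 < (min \<rho>1 \<rho>2)\<^sup>2" .
      have "(min \<rho>1 \<rho>2)\<^sup>2 \<le> \<rho>1\<^sup>2" "(min \<rho>1 \<rho>2)\<^sup>2 \<le> \<rho>2\<^sup>2"
        using \<rho>1(1) \<rho>2(1) by (auto intro!: power_mono)
      with ts have "(t * r)\<^sup>2 + (t * s)\<^sup>2 < \<rho>1\<^sup>2" "(t * r)\<^sup>2 + (t * s)\<^sup>2 < \<rho>2\<^sup>2"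
        by simp_all
      then have b1: "ereal (1 - (d + \<epsilon>) * D (t * r) (t * s)) \<le> ext_index q \<phi> \<xi> a (t * r) (t * s) A"
          "ext_index q \<phi> \<xi> a (t * r) (t * s) A \<le> ereal (1 - (c - \<epsilon>) * D (t * r) (t * s))"
        and b2: "ereal (1 - mean_levi M q (t * r) (t * s) A - \<epsilon> * D (t * r) (t * s)) \<le> ext_index q \<phi> \<xi> a (t * r) (t * s) A"
          "ext_index q \<phi> \<xi> a (t * r) (t * s) A \<le> ereal (1 - mean_levi M q (t * r) (t * s) A + \<epsilon> * D (t * r) (t * s))"
        using \<rho>1(2)[of "t * r" "t * s" A] \<rho>2(2)[of "t * r" "t * s" A] tr A by blast+
      have "t\<^sup>2 * mean_levi M q r s A \<le> t\<^sup>2 * ((d + 2 * \<epsilon>) * D r s)"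
        using order_trans[OF b1(1) b2(2)] unfolding scale by (simp add: algebra_simps)
      moreover have "t\<^sup>2 * ((c - 2 * \<epsilon>) * D r s) \<le> t\<^sup>2 * mean_levi M q r s A"
        using order_trans[OF b2(1) b1(2)] unfolding scale by (simp add: algebra_simps)
      ultimately show ?thesis
        using t by (simp add: mult_le_cancel_left_pos)
    qed
    show ?R
    proof (intro allI impI conjI)
      fix r s :: real and A :: "complex ^ 'n::{finite,linorder} ^ 'n::{finite,linorder}"
      assume A: "unitary_matrix A" and rs: "0 < r" "0 < s"
      have lim: "((\<lambda>\<epsilon>. (b + k * \<epsilon>) * D r s) \<longlongrightarrow> b * D r s) (at_right 0)" for b k
        by (auto intro!: tendsto_eq_intros)
      show "mean_levi M q r s A \<le> d * D r s"
        using near[OF A rs] by (intro tendsto_lowerbound[OF lim[of d 2]]) (auto simp: eventually_at_filter)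
      show "c * D r s \<le> mean_levi M q r s A"
        using near[OF A rs] by (intro tendsto_upperbound[OF lim[of c "- 2"]]) (auto simp: eventually_at_filter)
    qed
  qed
  have "(\<forall>S. S \<subseteq># hermitian_eigenvalues M \<and> size S = m \<longrightarrow>
            c * real m \<le> sum_mset S \<and> sum_mset S \<le> d * real m) \<longleftrightarrow>
      (\<forall>A. unitary_matrix A \<longrightarrow>
        c * real q \<le> partial_trace M A ?F \<and> partial_trace M A ?F \<le> d * real q \<and>
        c * (?n - real q) \<le> partial_trace M A (- ?F) \<and> partial_trace M A (- ?F) \<le> d * (?n - real q))"
  proof (rule eigenvalue_sums_iff_partial_traces[OF _ q assms(10)])
    show "M $ j $ k = cnj (M $ k $ j)" for j k
      unfolding M_def by (rule complex_hessian_hermitian[OF C2 assms(2,8)])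
  qed
  also have "\<dots> \<longleftrightarrow> (\<forall>A. unitary_matrix A \<longrightarrow>
        (\<forall>r>0. \<forall>s>0. c * D r s \<le> mean_levi M q r s A \<and> mean_levi M q r s A \<le> d * D r s))"
    by (simp only: traces)
  also note index_iff[symmetric]
  finally show ?thesis
    unfolding M_def D_def .
qed

end
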